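(* Let $X$ be a separable real Banach space. Suppose that at least one of the following holds: (i) $X$ contains an isometric copy of every separable Banach space whose dual space is Fréchet smooth; (ii) $X$ contains an isometric copy of every separable reflexive Fréchet smooth Banach space. Then $X$ contains an isometric copy of every separable Banach space.
   Context: A Banach space is Fréchet smooth if its norm is Fréchet differentiable at every nonzero point; "the dual is Fréchet smooth" means the dual norm on $X^*$ is Fréchet differentiable at every nonzero point of $X^*$. All Banach spaces are real. *)

theory Defs
  imports "HOL-Analysis.Analysis"
begin

text \<open>A real normed-space structure on a carrier set inside an ambient type 'u.
  This lets us quantify (in hypotheses) over all separable Banach spaces,
  represented on a carrier inside a fixed type of cardinality continuum.\<close>

record 'u nspace =
  carr :: "'u set"
  addv :: "'u \<Rightarrow> 'u \<Rightarrow> 'u"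
  smul :: "real \<Rightarrow> 'u \<Rightarrow> 'u"
  zer  :: "'u"
  nrm  :: "'u \<Rightarrow> real"

definition minusv :: "('u, 'm) nspace_scheme \<Rightarrow> 'u \<Rightarrow> 'u \<Rightarrow> 'u" where
  "minusv S x y = addv S x (smul S (-1) y)"

definition normed_space_str :: "('u, 'm) nspace_scheme \<Rightarrow> bool" where
  "normed_space_str S \<longleftrightarrow>
     zer S \<in> carr S \<and>
     (\<forall>x\<in>carr S. \<forall>y\<in>carr S. addv S x y \<in> carr S) \<and>
     (\<forall>c. \<forall>x\<in>carr S. smul S c x \<in> carr S) \<and>
     (\<forall>x\<in>carr S. \<forall>y\<in>carr S. \<forall>z\<in>carr S. addv S (addv S x y) z = addv S x (addv S y z)) \<and>
     (\<forall>x\<in>carr S. \<forall>y\<in>carr S. addv S x y = addv S y x) \<and>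
     (\<forall>x\<in>carr S. addv S x (zer S) = x) \<and>
     (\<forall>x\<in>carr S. addv S x (smul S (-1) x) = zer S) \<and>
     (\<forall>a b. \<forall>x\<in>carr S. smul S a (smul S b x) = smul S (a * b) x) \<and>
     (\<forall>x\<in>carr S. smul S 1 x = x) \<and>
     (\<forall>a. \<forall>x\<in>carr S. \<forall>y\<in>carr S. smul S a (addv S x y) = addv S (smul S a x) (smul S a y)) \<and>
     (\<forall>a b. \<forall>x\<in>carr S. smul S (a + b) x = addv S (smul S a x) (smul S b x)) \<and>
     (\<forall>x\<in>carr S. 0 \<le> nrm S x) \<and>
     (\<forall>x\<in>carr S. nrm S x = 0 \<longleftrightarrow> x = zer S) \<and>
     (\<forall>c. \<forall>x\<in>carr S. nrm S (smul S c x) = \<bar>c\<bar> * nrm S x) \<and>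
     (\<forall>x\<in>carr S. \<forall>y\<in>carr S. nrm S (addv S x y) \<le> nrm S x + nrm S y)"

definition banach_str :: "('u, 'm) nspace_scheme \<Rightarrow> bool" where
  "banach_str S \<longleftrightarrow> normed_space_str S \<and>
     (\<forall>s. (\<forall>n. s n \<in> carr S) \<and>
          (\<forall>e>0. \<exists>N. \<forall>m\<ge>N. \<forall>n\<ge>N. nrm S (minusv S (s m) (s n)) < e)
       \<longrightarrow> (\<exists>x\<in>carr S. (\<lambda>n. nrm S (minusv S (s n) x)) \<longlonglongrightarrow> 0))"

definition separable_str :: "('u, 'm) nspace_scheme \<Rightarrow> bool" where
  "separable_str S \<longleftrightarrow> (\<exists>D. countable D \<and> D \<subseteq> carr S \<and>
     (\<forall>x\<in>carr S. \<forall>e>0. \<exists>d\<in>D. nrm S (minusv S x d) < e))"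

definition bdd_lin_fun :: "('u, 'm) nspace_scheme \<Rightarrow> ('u \<Rightarrow> real) \<Rightarrow> bool" where
  "bdd_lin_fun S f \<longleftrightarrow>
     (\<forall>x\<in>carr S. \<forall>y\<in>carr S. f (addv S x y) = f x + f y) \<and>
     (\<forall>c. \<forall>x\<in>carr S. f (smul S c x) = c * f x) \<and>
     (\<exists>C. \<forall>x\<in>carr S. \<bar>f x\<bar> \<le> C * nrm S x)"

definition dual_set :: "('u, 'm) nspace_scheme \<Rightarrow> ('u \<Rightarrow> real) set" where
  "dual_set S = {f. bdd_lin_fun S f \<and> (\<forall>x. x \<notin> carr S \<longrightarrow> f x = 0)}"

definition dual_norm :: "('u, 'm) nspace_scheme \<Rightarrow> ('u \<Rightarrow> real) \<Rightarrow> real" where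
  "dual_norm S f = Sup {\<bar>f x\<bar> | x. x \<in> carr S \<and> nrm S x \<le> 1}"

definition dual_space :: "('u, 'm) nspace_scheme \<Rightarrow> ('u \<Rightarrow> real) nspace" where
  "dual_space S = \<lparr> carr = dual_set S,
                    addv = (\<lambda>f g x. f x + g x),
                    smul = (\<lambda>c f x. c * f x),
                    zer = (\<lambda>x. 0),
                    nrm = dual_norm S \<rparr>"

definition frechet_smooth :: "('u, 'm) nspace_scheme \<Rightarrow> bool" where
  "frechet_smooth S \<longleftrightarrow>
     (\<forall>x\<in>carr S. x \<noteq> zer S \<longrightarrow>
        (\<exists>L. bdd_lin_fun S L \<and>
           (\<forall>e>0. \<exists>d>0. \<forall>h\<in>carr S. 0 < nrm S h \<and> nrm S h < d \<longrightarrow>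
               \<bar>nrm S (addv S x h) - nrm S x - L h\<bar> \<le> e * nrm S h)))"

definition reflexive_str :: "('u, 'm) nspace_scheme \<Rightarrow> bool" where
  "reflexive_str S \<longleftrightarrow>
     (\<forall>\<Phi>\<in>dual_set (dual_space S). \<exists>x\<in>carr S. \<forall>f\<in>dual_set S. \<Phi> f = f x)"

definition isom_embeds :: "('u, 'm) nspace_scheme \<Rightarrow> 'a::real_normed_vector itself \<Rightarrow> bool" where
  "isom_embeds S _ \<longleftrightarrow> (\<exists>T :: 'u \<Rightarrow> 'a.
     (\<forall>x\<in>carr S. \<forall>y\<in>carr S. T (addv S x y) = T x + T y) \<and>
     (\<forall>c. \<forall>x\<in>carr S. T (smul S c x) = c *\<^sub>R T x) \<and>
     (\<forall>x\<in>carr S. norm (T x) = nrm S x))"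

end

(* Call a pair (V, N) good if V is a space of real sequences whose norm N is Frechet smooth and locally
   uniformly rotund, with coordinatewise limits of bounded sequences being weak limits inside V. A good
   space is a separable reflexive Frechet smooth Banach space, and local uniform rotundity makes its dual
   Frechet smooth, so under either hypothesis X contains every good space.

   Countably many good spaces that share an approximate copy of a finite-dimensional sup-norm space can
   be amalgamated into one good space containing each of them isometrically, with the copies almost
   identified. Now fix a separable target Y and consider the tree of finite sequences of better and
   better, almost consistent, almost isometric maps of larger and larger finite-dimensional pieces of Y
   into X. An infinite branch converges to an embedding of Y. If there is none, the tree is well-founded,
   and recursion along it produces one good space containing almost isometric pieces of Y for
   every node. That space embeds into X, so every node met along this embedding has a successor in the
   tree: a contradiction. *)

theory Submission
  imports Defs "HOL-Library.Function_Algebras" "HOL-Library.Diagonal_Subsequence" "HOL-Library.Nat_Bijection"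
begin

section \<open>Norms on subspaces of real vector spaces\<close>

text \<open>The rank of the well-founded tree is not bounded in advance, so no step of the recursion
  may lose a fixed amount. Hence every child space sits exactly isometrically in the space of its
  parent, and the distortion of the common part depends on the depth alone: passing from depth
  \<open>Suc n\<close> to depth \<open>n\<close> replaces the bounds \<open>B (Suc n)\<close> and
  \<open>B (Suc (Suc n))\<close> by \<open>B n\<close> and \<open>B (Suc n)\<close>. The gap between
  \<open>B n\<close> and \<open>B (Suc n)\<close> is the room in which the sup norm is exchanged for
  a smooth, strictly convex function. The other obstacle is that infinitely many pieces must give
  one norm that is smooth, rotund and reflexive. Squares of positive parts above a threshold
  \<open>\<theta>\<close> leave finitely many active terms near a point, hence smoothness, but they
  are flat below the threshold. A small multiple of an l2 norm restores rotundity in the rows, while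
  the common part has finite dimension, where compactness upgrades plain rotundity. All spaces are
  sets of real sequences, with nested sums coded by a pairing function, so recursion and hypotheses
  stay within one type.\<close>

instantiation "fun" :: (type, real_vector) real_vector
begin

definition scaleR_fun :: "real \<Rightarrow> ('a \<Rightarrow> 'b) \<Rightarrow> 'a \<Rightarrow> 'b" where
  "scaleR_fun c f = (\<lambda>x. c *\<^sub>R f x)"

instance
  by standard (auto simp: scaleR_fun_def fun_eq_iff scaleR_add_right scaleR_add_left)

end

lemma scaleR_fun_apply [simp]: "(c *\<^sub>R f) x = c *\<^sub>R f x"
  by (simp add: scaleR_fun_def)

lemma mult_bound_trans: "a \<le> K * b \<Longrightarrow> b \<le> C * c \<Longrightarrow> 0 \<le> K \<Longrightarrow> a \<le> K * C * (c::real)"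
  using mult_left_mono[of b "C * c" K] by (simp add: mult.assoc)

definition seminorm_on :: "'v::real_vector set \<Rightarrow> ('v \<Rightarrow> real) \<Rightarrow> bool" where
  "seminorm_on V N \<longleftrightarrow> subspace V \<and> (\<forall>c. \<forall>x\<in>V. N (c *\<^sub>R x) = \<bar>c\<bar> * N x) \<and>
     (\<forall>x\<in>V. \<forall>y\<in>V. N (x + y) \<le> N x + N y)"

definition norm_on :: "'v::real_vector set \<Rightarrow> ('v \<Rightarrow> real) \<Rightarrow> bool" where
  "norm_on V N \<longleftrightarrow> seminorm_on V N \<and> (\<forall>x\<in>V. N x = 0 \<longrightarrow> x = 0)"

definition blf :: "'v::real_vector set \<Rightarrow> ('v \<Rightarrow> real) \<Rightarrow> ('v \<Rightarrow> real) \<Rightarrow> bool" where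
  "blf V N f \<longleftrightarrow> (\<forall>x\<in>V. \<forall>y\<in>V. f (x + y) = f x + f y) \<and> (\<forall>c. \<forall>x\<in>V. f (c *\<^sub>R x) = c * f x) \<and>
     (\<exists>C. \<forall>x\<in>V. \<bar>f x\<bar> \<le> C * N x)"

text \<open>\<open>N\<close> only measures increments and \<open>f\<close> is arbitrary, so powers,
  gauges and partial sums can be differentiated with respect to whichever equivalent norm is
  convenient.\<close>

definition fdiff :: "'v::real_vector set \<Rightarrow> ('v \<Rightarrow> real) \<Rightarrow> ('v \<Rightarrow> real) \<Rightarrow> 'v \<Rightarrow> ('v \<Rightarrow> real) \<Rightarrow> bool" where
  "fdiff V N f x D \<longleftrightarrow> blf V N D \<and>
     (\<forall>e>0. \<exists>d>0. \<forall>h\<in>V. N h < d \<longrightarrow> \<bar>f (x + h) - f x - D h\<bar> \<le> e * N h)"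

definition smooth_on :: "'v::real_vector set \<Rightarrow> ('v \<Rightarrow> real) \<Rightarrow> bool" where
  "smooth_on V N \<longleftrightarrow> (\<forall>x\<in>V. x \<noteq> 0 \<longrightarrow> (\<exists>D. fdiff V N N x D))"

definition lur_on :: "'v::real_vector set \<Rightarrow> ('v \<Rightarrow> real) \<Rightarrow> bool" where
  "lur_on V N \<longleftrightarrow> (\<forall>x\<in>V. \<forall>s. (\<forall>k. s k \<in> V) \<longrightarrow> (\<lambda>k. N (s k)) \<longlonglongrightarrow> N x \<longrightarrow>
     (\<lambda>k. N (x + s k)) \<longlonglongrightarrow> 2 * N x \<longrightarrow> (\<lambda>k. N (s k - x)) \<longlonglongrightarrow> 0)"

text \<open>For complete spaces this combines reflexivity with a choice of coordinates separating points.\<close>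

definition coordinatewise_weak :: "(nat \<Rightarrow> real) set \<Rightarrow> ((nat \<Rightarrow> real) \<Rightarrow> real) \<Rightarrow> bool" where
  "coordinatewise_weak V N \<longleftrightarrow> (\<forall>s x C. (\<forall>k. s k \<in> V \<and> N (s k) \<le> C) \<longrightarrow> (\<forall>i. (\<lambda>k. s k i) \<longlonglongrightarrow> x i) \<longrightarrow>
     x \<in> V \<and> (\<forall>f. blf V N f \<longrightarrow> (\<lambda>k. f (s k)) \<longlonglongrightarrow> f x))"

definition separable_on :: "'v::real_vector set \<Rightarrow> ('v \<Rightarrow> real) \<Rightarrow> bool" where
  "separable_on V N \<longleftrightarrow> (\<exists>D. countable D \<and> D \<subseteq> V \<and> (\<forall>x\<in>V. \<forall>e>0. \<exists>d\<in>D. N (x - d) < e))"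

text \<open>Smoothness provides norming functionals, local uniform rotundity serves the dual norm,
  and the coordinate bounds give coordinatewise convergent subsequences, which
  \<open>coordinatewise_weak\<close> turns into weakly convergent ones.\<close>

definition good :: "(nat \<Rightarrow> real) set \<Rightarrow> ((nat \<Rightarrow> real) \<Rightarrow> real) \<Rightarrow> bool" where
  "good V N \<longleftrightarrow> norm_on V N \<and> smooth_on V N \<and> lur_on V N \<and> coordinatewise_weak V N \<and>
     separable_on V N \<and> (\<forall>i. \<exists>C. \<forall>x\<in>V. \<bar>x i\<bar> \<le> C * N x)"

lemma norm_on_seminorm: "norm_on V N \<Longrightarrow> seminorm_on V N"
  by (simp add: norm_on_def)

context
  fixes V :: "'v::real_vector set" and N
  assumes sn: "seminorm_on V N"
begin

lemma sn_sub: "subspace V" and sn_scale: "x \<in> V \<Longrightarrow> N (c *\<^sub>R x) = \<bar>c\<bar> * N x"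
  and sn_tri: "x \<in> V \<Longrightarrow> y \<in> V \<Longrightarrow> N (x + y) \<le> N x + N y"
  using sn by (auto simp: seminorm_on_def)

lemma sn_mem: "0 \<in> V" "x \<in> V \<Longrightarrow> y \<in> V \<Longrightarrow> x + y \<in> V" "x \<in> V \<Longrightarrow> c *\<^sub>R x \<in> V"
  "x \<in> V \<Longrightarrow> y \<in> V \<Longrightarrow> x - y \<in> V" "x \<in> V \<Longrightarrow> - x \<in> V"
  using sn_sub by (auto simp: subspace_0 subspace_add subspace_scale subspace_diff subspace_neg)

lemma sn_zero: "N 0 = 0"
  using sn_scale[of 0 0] sn_mem(1) by simp

lemma sn_neg: "x \<in> V \<Longrightarrow> N (- x) = N x"
  using sn_scale[of x "-1"] by simp

lemma sn_nonneg: "x \<in> V \<Longrightarrow> 0 \<le> N x"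
  using sn_tri[of x "- x"] sn_neg[of x] sn_mem(5)[of x] sn_zero by simp

lemma sn_diff: "x \<in> V \<Longrightarrow> y \<in> V \<Longrightarrow> N (x - y) \<le> N x + N y"
  using sn_tri[of x "- y"] sn_neg[of y] sn_mem(5)[of y] by simp

lemma sn_commute: "x \<in> V \<Longrightarrow> y \<in> V \<Longrightarrow> N (x - y) = N (y - x)"
  using sn_neg[of "x - y"] sn_mem(4)[of x y] by simp

lemma sn_tri2: "x \<in> V \<Longrightarrow> y \<in> V \<Longrightarrow> N x - N y \<le> N (x - y)"
  using sn_tri[of "x - y" y] sn_mem(4)[of x y] by simp

lemma sn_tri3: "x \<in> V \<Longrightarrow> y \<in> V \<Longrightarrow> \<bar>N x - N y\<bar> \<le> N (x - y)"
  using sn_tri2[of x y] sn_tri2[of y x] sn_commute[of x y] by linarith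

lemma sn_tri_minus: "x \<in> V \<Longrightarrow> y \<in> V \<Longrightarrow> N x - N y \<le> N (x + y)"
  using sn_tri2[of x "- y"] sn_neg[of y] sn_mem(5)[of y] by simp

lemma sn_sum: "finite A \<Longrightarrow> (\<And>i. i \<in> A \<Longrightarrow> g i \<in> V) \<Longrightarrow> sum g A \<in> V \<and> N (sum g A) \<le> (\<Sum>i\<in>A. N (g i))"
proof (induction A rule: finite_induct)
  case empty then show ?case using sn_mem(1) sn_zero by simp
next
  case (insert a A)
  then show ?case using sn_mem(2)[of "g a" "sum g A"] sn_tri[of "g a" "sum g A"] by force
qed

lemma blf_add: "blf V N f \<Longrightarrow> x \<in> V \<Longrightarrow> y \<in> V \<Longrightarrow> f (x + y) = f x + f y"
  and blf_scale: "blf V N f \<Longrightarrow> x \<in> V \<Longrightarrow> f (c *\<^sub>R x) = c * f x"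
  by (auto simp: blf_def)

lemma blf_zero: "blf V N f \<Longrightarrow> f 0 = 0"
  using blf_scale[of f 0 0] sn_mem(1) by simp

lemma blf_neg: "blf V N f \<Longrightarrow> x \<in> V \<Longrightarrow> f (- x) = - f x"
  using blf_scale[of f x "-1"] by simp

lemma blf_diff: "blf V N f \<Longrightarrow> x \<in> V \<Longrightarrow> y \<in> V \<Longrightarrow> f (x - y) = f x - f y"
  using blf_add[of f x "- y"] blf_neg[of f y] sn_mem(5)[of y] by simp

lemma blf_bound: assumes "blf V N f" obtains C where "C > 0" "\<And>x. x \<in> V \<Longrightarrow> \<bar>f x\<bar> \<le> C * N x"
proof -
  obtain C where C: "\<forall>x\<in>V. \<bar>f x\<bar> \<le> C * N x" using assms by (auto simp: blf_def)
  have "\<bar>f x\<bar> \<le> (\<bar>C\<bar> + 1) * N x" if "x \<in> V" for x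
  proof -
    have "C * N x \<le> (\<bar>C\<bar> + 1) * N x" using sn_nonneg[OF that] by (intro mult_right_mono) auto
    then show ?thesis using C that by force
  qed
  then show ?thesis using that[of "\<bar>C\<bar> + 1"] by simp
qed

lemma blfI: "(\<And>x y. x \<in> V \<Longrightarrow> y \<in> V \<Longrightarrow> f (x + y) = f x + f y) \<Longrightarrow> (\<And>c x. x \<in> V \<Longrightarrow> f (c *\<^sub>R x) = c * f x) \<Longrightarrow>
   (\<And>x. x \<in> V \<Longrightarrow> \<bar>f x\<bar> \<le> C * N x) \<Longrightarrow> blf V N f"
  unfolding blf_def by blast

lemma blf_0: "blf V N (\<lambda>x. 0)"
  by (rule blfI[where C=0]) auto

lemma blf_cmul: assumes "blf V N f" shows "blf V N (\<lambda>x. c * f x)"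
proof -
  obtain C where C: "C > 0" "\<And>x. x \<in> V \<Longrightarrow> \<bar>f x\<bar> \<le> C * N x" using blf_bound[OF assms] by blast
  show ?thesis
  proof (rule blfI[where C="\<bar>c\<bar> * C"])
    show "\<bar>c * f x\<bar> \<le> \<bar>c\<bar> * C * N x" if "x \<in> V" for x
      using mult_left_mono[OF C(2)[OF that], of "\<bar>c\<bar>"] by (simp add: abs_mult)
  qed (simp_all add: blf_add[OF assms] blf_scale[OF assms] algebra_simps)
qed

lemma blf_plus: assumes "blf V N f" "blf V N g" shows "blf V N (\<lambda>x. f x + g x)"
proof -
  obtain C where C: "C > 0" "\<And>x. x \<in> V \<Longrightarrow> \<bar>f x\<bar> \<le> C * N x" using blf_bound[OF assms(1)] by blast
  obtain C' where C': "C' > 0" "\<And>x. x \<in> V \<Longrightarrow> \<bar>g x\<bar> \<le> C' * N x" using blf_bound[OF assms(2)] by blast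
  show ?thesis
  proof (rule blfI[where C="C + C'"])
    show "\<bar>f x + g x\<bar> \<le> (C + C') * N x" if "x \<in> V" for x
      using C(2)[OF that] C'(2)[OF that] by (simp add: algebra_simps)
  qed (simp_all add: blf_add[OF assms(1)] blf_scale[OF assms(1)] blf_add[OF assms(2)] blf_scale[OF assms(2)] algebra_simps)
qed

lemma fdiff_blf: "fdiff V N f x D \<Longrightarrow> blf V N D"
  by (simp add: fdiff_def)

lemma fdiffE: assumes "fdiff V N f x D" "e > 0"
  obtains d where "d > 0" "\<And>h. h \<in> V \<Longrightarrow> N h < d \<Longrightarrow> \<bar>f (x + h) - f x - D h\<bar> \<le> e * N h"
  using assms unfolding fdiff_def by metis

lemma fdiff_lipschitz: assumes "fdiff V N f x D"
  obtains C d where "C > 0" "d > 0" "\<And>h. h \<in> V \<Longrightarrow> N h < d \<Longrightarrow> \<bar>f (x + h) - f x\<bar> \<le> C * N h"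
proof -
  obtain C where C: "C > 0" "\<And>x. x \<in> V \<Longrightarrow> \<bar>D x\<bar> \<le> C * N x" using blf_bound[OF fdiff_blf[OF assms]] by blast
  obtain d where d: "d > 0" "\<And>h. h \<in> V \<Longrightarrow> N h < d \<Longrightarrow> \<bar>f (x + h) - f x - D h\<bar> \<le> 1 * N h"
    using fdiffE[OF assms zero_less_one] by blast
  have "\<bar>f (x + h) - f x\<bar> \<le> (C + 1) * N h" if "h \<in> V" "N h < d" for h
    using C(2)[OF that(1)] d(2)[OF that] by (simp add: algebra_simps)
  then show ?thesis using that[of "C + 1" d] C d by auto
qed

lemma fdiff_linear: "blf V N D \<Longrightarrow> x \<in> V \<Longrightarrow> fdiff V N D x D"
  unfolding fdiff_def by (auto simp: blf_add sn_nonneg intro!: exI[of _ "1::real"])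

lemma fdiff_const: "fdiff V N (\<lambda>_. c) x (\<lambda>_. 0)"
  unfolding fdiff_def using blf_0 by (auto simp: sn_nonneg intro!: exI[of _ "1::real"])

lemma fdiff_add: assumes "fdiff V N f x D" "fdiff V N g x E" shows "fdiff V N (\<lambda>z. f z + g z) x (\<lambda>h. D h + E h)"
  unfolding fdiff_def
proof (intro conjI allI impI)
  show "blf V N (\<lambda>h. D h + E h)" by (intro blf_plus fdiff_blf[OF assms(1)] fdiff_blf[OF assms(2)])
  fix e :: real assume "e > 0"
  then have e: "e / 2 > 0" by simp
  obtain d where d: "d > 0" "\<And>h. h \<in> V \<Longrightarrow> N h < d \<Longrightarrow> \<bar>f (x + h) - f x - D h\<bar> \<le> e / 2 * N h"
    using fdiffE[OF assms(1) e] by blast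
  obtain d' where d': "d' > 0" "\<And>h. h \<in> V \<Longrightarrow> N h < d' \<Longrightarrow> \<bar>g (x + h) - g x - E h\<bar> \<le> e / 2 * N h"
    using fdiffE[OF assms(2) e] by blast
  show "\<exists>d>0. \<forall>h\<in>V. N h < d \<longrightarrow> \<bar>f (x + h) + g (x + h) - (f x + g x) - (D h + E h)\<bar> \<le> e * N h"
  proof (intro exI[of _ "min d d'"] conjI ballI impI)
    fix h assume "h \<in> V" "N h < min d d'"
    then show "\<bar>f (x + h) + g (x + h) - (f x + g x) - (D h + E h)\<bar> \<le> e * N h"
      using d(2)[of h] d'(2)[of h] by linarith
  qed (use d d' in auto)
qed

lemma fdiff_chain: assumes "fdiff V N f x D" "(g has_real_derivative g') (at (f x))"
  shows "fdiff V N (\<lambda>z. g (f z)) x (\<lambda>h. g' * D h)"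
  unfolding fdiff_def
proof (intro conjI allI impI)
  show "blf V N (\<lambda>h. g' * D h)" by (intro blf_cmul fdiff_blf[OF assms(1)])
  fix e :: real assume e: "e > 0"
  obtain C d0 where C: "C > 0" "d0 > 0" "\<And>h. h \<in> V \<Longrightarrow> N h < d0 \<Longrightarrow> \<bar>f (x + h) - f x\<bar> \<le> C * N h"
    using fdiff_lipschitz[OF assms(1)] by blast
  have "\<forall>e>0. \<exists>d>0. \<forall>y. norm (y - f x) < d \<longrightarrow> norm (g y - g (f x) - g' * (y - f x)) \<le> e * norm (y - f x)"
    using assms(2) unfolding has_field_derivative_def has_derivative_at_alt by blast
  then obtain d1 where d1: "d1 > 0" "\<And>y. \<bar>y - f x\<bar> < d1 \<Longrightarrow> \<bar>g y - g (f x) - g' * (y - f x)\<bar> \<le> e / (2 * C) * \<bar>y - f x\<bar>"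
    using e C(1) by (metis real_norm_def divide_pos_pos mult_pos_pos zero_less_numeral)
  have "e / (2 * (\<bar>g'\<bar> + 1)) > 0" using e by (simp add: add_nonneg_pos)
  then obtain d2 where d2: "d2 > 0" "\<And>h. h \<in> V \<Longrightarrow> N h < d2 \<Longrightarrow> \<bar>f (x + h) - f x - D h\<bar> \<le> e / (2 * (\<bar>g'\<bar> + 1)) * N h"
    using fdiffE[OF assms(1)] by blast
  show "\<exists>d>0. \<forall>h\<in>V. N h < d \<longrightarrow> \<bar>g (f (x + h)) - g (f x) - g' * D h\<bar> \<le> e * N h"
  proof (intro exI[of _ "min (min d0 d2) (d1 / C)"] conjI ballI impI)
    fix h assume h: "h \<in> V" and n: "N h < min (min d0 d2) (d1 / C)"
    have a: "\<bar>f (x + h) - f x\<bar> \<le> C * N h" using C(3)[OF h] n by simp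
    also have "\<dots> < d1" using n C(1) by (simp add: field_simps)
    finally have "\<bar>g (f (x + h)) - g (f x) - g' * (f (x + h) - f x)\<bar> \<le> e / (2 * C) * \<bar>f (x + h) - f x\<bar>"
      using d1(2) by blast
    also have "\<dots> \<le> e / (2 * C) * (C * N h)" using a e C(1) by (intro mult_left_mono) auto
    finally have 1: "\<bar>g (f (x + h)) - g (f x) - g' * (f (x + h) - f x)\<bar> \<le> e / 2 * N h" using C(1) by simp
    have "\<bar>g' * (f (x + h) - f x) - g' * D h\<bar> = \<bar>g'\<bar> * \<bar>f (x + h) - f x - D h\<bar>"
      by (simp add: abs_mult[symmetric] algebra_simps)
    also have "\<dots> \<le> (\<bar>g'\<bar> + 1) * (e / (2 * (\<bar>g'\<bar> + 1)) * N h)"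
      using d2(2)[OF h] n by (intro mult_mono) auto
    also have "\<dots> = e / 2 * N h" by (simp add: field_simps add_nonneg_eq_0_iff)
    finally show "\<bar>g (f (x + h)) - g (f x) - g' * D h\<bar> \<le> e * N h" using 1 by linarith
  qed (use C d1 d2 in auto)
qed

lemma fdiff_cmul: "fdiff V N f x D \<Longrightarrow> fdiff V N (\<lambda>z. c * f z) x (\<lambda>h. c * D h)"
  by (rule fdiff_chain) (auto intro!: derivative_eq_intros)

lemma fdiff_sum: "finite A \<Longrightarrow> (\<And>i. i \<in> A \<Longrightarrow> fdiff V N (f i) x (D i)) \<Longrightarrow>
   fdiff V N (\<lambda>z. \<Sum>i\<in>A. f i z) x (\<lambda>h. \<Sum>i\<in>A. D i h)"
  by (induction A rule: finite_induct) (auto intro: fdiff_const fdiff_add)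

lemma fdiff_local: assumes "fdiff V N f x D" "d > 0" "\<And>h. h \<in> V \<Longrightarrow> N h < d \<Longrightarrow> g (x + h) = f (x + h)"
  shows "fdiff V N g x D"
  unfolding fdiff_def
proof (intro conjI allI impI fdiff_blf[OF assms(1)])
  fix e :: real assume "e > 0"
  then obtain d1 where d: "d1 > 0" "\<And>h. h \<in> V \<Longrightarrow> N h < d1 \<Longrightarrow> \<bar>f (x + h) - f x - D h\<bar> \<le> e * N h"
    using fdiffE[OF assms(1)] by blast
  have "g x = f x" using assms(3)[of 0] sn_mem(1) sn_zero assms(2) by simp
  then show "\<exists>d>0. \<forall>h\<in>V. N h < d \<longrightarrow> \<bar>g (x + h) - g x - D h\<bar> \<le> e * N h"
    using d assms(2,3) by (intro exI[of _ "min d d1"]) auto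
qed

text \<open>Scaling point and increment together scales the remainder as well. This carries
  differentiability of a gauge from its unit sphere to all nonzero points.\<close>

lemma fdiff_homog: assumes "fdiff V N f x D" "c > 0" "x \<in> V" "\<And>z c. z \<in> V \<Longrightarrow> c > 0 \<Longrightarrow> f (c *\<^sub>R z) = c * f z"
  shows "fdiff V N f (c *\<^sub>R x) D"
  unfolding fdiff_def
proof (intro conjI allI impI fdiff_blf[OF assms(1)])
  fix e :: real assume "e > 0"
  then obtain d where d: "d > 0" "\<And>h. h \<in> V \<Longrightarrow> N h < d \<Longrightarrow> \<bar>f (x + h) - f x - D h\<bar> \<le> e * N h"
    using fdiffE[OF assms(1)] by blast
  show "\<exists>d>0. \<forall>h\<in>V. N h < d \<longrightarrow> \<bar>f (c *\<^sub>R x + h) - f (c *\<^sub>R x) - D h\<bar> \<le> e * N h"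
  proof (intro exI[of _ "c * d"] conjI ballI impI)
    fix h assume h: "h \<in> V" "N h < c * d"
    let ?h = "(1 / c) *\<^sub>R h"
    have m: "?h \<in> V" using sn_mem h by auto
    have nh: "N ?h = N h / c" using sn_scale[OF h(1)] assms(2) by simp
    have "N h / c < d" using h(2) assms(2) by (simp add: field_simps)
    with nh have "N ?h < d" by simp
    then have a: "c * \<bar>f (x + ?h) - f x - D ?h\<bar> \<le> c * (e * N ?h)" using d(2)[OF m] assms(2) by simp
    have b: "c *\<^sub>R (x + ?h) = c *\<^sub>R x + h" "c *\<^sub>R ?h = h" using assms(2) by (simp_all add: scaleR_add_right)
    have "f (c *\<^sub>R x + h) = c * f (x + ?h)" using assms(2,4) b(1) sn_mem(2)[OF assms(3) m] by metis
    moreover have "D h = c * D ?h" using blf_scale[OF fdiff_blf[OF assms(1)] m, of c] b(2) by simp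
    ultimately have "f (c *\<^sub>R x + h) - f (c *\<^sub>R x) - D h = c * (f (x + ?h) - f x - D ?h)"
      using assms(2,3) by (simp add: assms(4) right_diff_distrib)
    then have "\<bar>f (c *\<^sub>R x + h) - f (c *\<^sub>R x) - D h\<bar> = c * \<bar>f (x + ?h) - f x - D ?h\<bar>"
      using assms(2) by (simp add: abs_mult)
    also have "\<dots> \<le> c * (e * N ?h)" by (rule a)
    also have "\<dots> = e * N h" using nh assms(2) by simp
    finally show "\<bar>f (c *\<^sub>R x + h) - f (c *\<^sub>R x) - D h\<bar> \<le> e * N h" .
  qed (use d assms in auto)
qed

end

lemma fdiff_linear_comp:
  assumes sn: "seminorm_on V N" and sn': "seminorm_on V' N'"
    and f: "fdiff V' N' f (T x) D"
    and T: "\<And>y z. y \<in> V \<Longrightarrow> z \<in> V \<Longrightarrow> T (y + z) = T y + T z" "\<And>c y. y \<in> V \<Longrightarrow> T (c *\<^sub>R y) = c *\<^sub>R T y"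
      "\<And>y. y \<in> V \<Longrightarrow> T y \<in> V' \<and> N' (T y) \<le> C * N y" and x: "x \<in> V"
  shows "fdiff V N (\<lambda>z. f (T z)) x (\<lambda>h. D (T h))"
proof -
  have D: "blf V' N' D" using fdiff_blf[OF sn' f] .
  obtain K where K: "K > 0" "\<And>x. x \<in> V' \<Longrightarrow> \<bar>D x\<bar> \<le> K * N' x" using blf_bound[OF sn' D] by blast
  define C' where "C' = \<bar>C\<bar> + 1"
  have C': "C' > 0" by (simp add: C'_def)
  have T3: "T y \<in> V' \<and> N' (T y) \<le> C' * N y" if "y \<in> V" for y
  proof -
    have "C * N y \<le> C' * N y" unfolding C'_def using sn_nonneg[OF sn that] by (intro mult_right_mono) auto
    then show ?thesis using T(3)[OF that] by force
  qed
  have "blf V N (\<lambda>h. D (T h))"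
  proof (rule blfI[OF sn, where C="K * C'"])
    show "\<bar>D (T y)\<bar> \<le> K * C' * N y" if "y \<in> V" for y
      by (rule mult_bound_trans[OF K(2)[of "T y"]]) (use T3[OF that] K in auto)
  qed (simp_all add: T T3 blf_add[OF sn' D] blf_scale[OF sn' D])
  moreover have "\<exists>d>0. \<forall>h\<in>V. N h < d \<longrightarrow> \<bar>f (T (x + h)) - f (T x) - D (T h)\<bar> \<le> e * N h" if e: "e > 0" for e :: real
  proof -
    obtain d where d: "d > 0" "\<And>h. h \<in> V' \<Longrightarrow> N' h < d \<Longrightarrow> \<bar>f (T x + h) - f (T x) - D h\<bar> \<le> e / C' * N' h"
      using fdiffE[OF sn' f, of "e / C'"] e C' by auto
    show ?thesis
    proof (intro exI[of _ "d / C'"] conjI ballI impI)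
      fix h assume h: "h \<in> V" "N h < d / C'"
      have "N' (T h) \<le> C' * N h" using T3 h by auto
      also have "\<dots> < d" using h C' by (simp add: field_simps)
      finally have "\<bar>f (T x + T h) - f (T x) - D (T h)\<bar> \<le> e / C' * N' (T h)" using d T3 h by auto
      also have "\<dots> \<le> e / C' * (C' * N h)" using T3[OF h(1)] e C' by (intro mult_left_mono) auto
      finally show "\<bar>f (T (x + h)) - f (T x) - D (T h)\<bar> \<le> e * N h" using T(1)[OF x h(1)] C' by simp
    qed (use d C' in auto)
  qed
  ultimately show ?thesis unfolding fdiff_def by blast
qed

lemma blf_equiv: assumes "seminorm_on V N" "seminorm_on V N'" "\<And>y. y \<in> V \<Longrightarrow> N' y \<le> C * N y" "blf V N' f"
  shows "blf V N f"
proof -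
  obtain K where K: "K > 0" "\<And>x. x \<in> V \<Longrightarrow> \<bar>f x\<bar> \<le> K * N' x" using blf_bound[OF assms(2,4)] by blast
  show ?thesis
  proof (rule blfI[OF assms(1), where C="K * C"])
    show "\<bar>f y\<bar> \<le> K * C * N y" if "y \<in> V" for y
      by (rule mult_bound_trans[OF K(2)[OF that] assms(3)[OF that]]) (use K in simp)
  qed (simp_all add: blf_add[OF assms(2,4)] blf_scale[OF assms(2,4)])
qed

lemma fdiff_equiv: assumes "seminorm_on V N" "seminorm_on V N'" "\<And>y. y \<in> V \<Longrightarrow> N' y \<le> C * N y" "fdiff V N' f x D" "x \<in> V"
  shows "fdiff V N f x D"
  by (rule fdiff_linear_comp[where T="\<lambda>x. x" and C=C, OF assms(1,2)]) (use assms in auto)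

lemma fdiff_ray: assumes sn: "seminorm_on V N" and f: "fdiff V N f x D" and y: "y \<in> V" and e: "e > 0"
  obtains t0 where "t0 > 0" "\<And>t. 0 < t \<Longrightarrow> t \<le> t0 \<Longrightarrow> \<bar>f (x + t *\<^sub>R y) - f x - t * D y\<bar> \<le> t * e"
proof -
  have ny: "N y \<ge> 0" using sn_nonneg[OF sn y] .
  define e' where "e' = e / (N y + 1)"
  have e': "e' > 0" using e ny by (simp add: e'_def)
  then obtain d where d: "d > 0" "\<And>h. h \<in> V \<Longrightarrow> N h < d \<Longrightarrow> \<bar>f (x + h) - f x - D h\<bar> \<le> e' * N h"
    using fdiffE[OF sn f] by blast
  have "\<bar>f (x + t *\<^sub>R y) - f x - t * D y\<bar> \<le> t * e" if t: "0 < t" "t \<le> d / (2 * (N y + 1))" for t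
  proof -
    have nt: "N (t *\<^sub>R y) = t * N y" using sn_scale[OF sn y] t by simp
    have "t * N y \<le> t * (N y + 1)" using t by simp
    also have "\<dots> \<le> d / (2 * (N y + 1)) * (N y + 1)" using t ny by (intro mult_right_mono) auto
    also have "\<dots> = d / 2" using ny by (simp add: field_simps)
    also have "\<dots> < d" using d by simp
    finally have "\<bar>f (x + t *\<^sub>R y) - f x - t * D y\<bar> \<le> t * (e' * N y)"
      using d(2)[of "t *\<^sub>R y"] nt sn_mem[OF sn] y blf_scale[OF sn fdiff_blf[OF sn f] y] by (simp add: mult_ac)
    also have "\<dots> \<le> t * e"
    proof (intro mult_left_mono)
      show "e' * N y \<le> e" unfolding e'_def using e ny by (simp add: field_simps)
    qed (use t in simp)
    finally show ?thesis .
  qed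
  then show ?thesis using that[of "d / (2 * (N y + 1))"] d(1) ny by simp
qed

text \<open>Difference quotients along \<open>y\<close> never exceed \<open>N y\<close> by the
  triangle inequality; replacing \<open>y\<close> by \<open>- y\<close> gives the other
  sign.\<close>

lemma fdiff_norm_le: assumes sn: "seminorm_on V N" and L: "fdiff V N N x L" and x: "x \<in> V" and y: "y \<in> V"
  shows "\<bar>L y\<bar> \<le> N y"
proof -
  note b = fdiff_blf[OF sn L]
  have le: "L y \<le> N y" if y: "y \<in> V" for y
  proof (rule field_le_epsilon)
    fix e :: real assume "e > 0"
    then obtain t where t: "t > 0" "\<bar>N (x + t *\<^sub>R y) - N x - t * L y\<bar> \<le> t * e"
      using fdiff_ray[OF sn L y] by (metis order_refl)
    moreover have "N (x + t *\<^sub>R y) \<le> N x + t * N y"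
      using sn_tri[OF sn x, of "t *\<^sub>R y"] sn_mem[OF sn] y sn_scale[OF sn y] t by simp
    ultimately have "t * L y \<le> t * (N y + e)" by (simp add: abs_le_iff distrib_left)
    then show "L y \<le> N y + e" using t by simp
  qed
  show ?thesis
    using le[OF y] le[of "- y"] y sn_mem[OF sn] sn_neg[OF sn y] blf_neg[OF sn b y] by (simp add: abs_le_iff)
qed

text \<open>The derivative of the norm at \<open>x\<close> does the work of Hahn-Banach: it has norm
  at most one, and along the ray through \<open>x\<close> the norm grows exactly at the rate
  \<open>N x\<close>. At \<open>x = 0\<close> the zero functional serves.\<close>

lemma smooth_norming: assumes N: "norm_on V N" and s: "smooth_on V N" and x: "x \<in> V"
  obtains L where "blf V N L" "L x = N x" "\<And>y. y \<in> V \<Longrightarrow> \<bar>L y\<bar> \<le> N y"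
proof (cases "x = 0")
  case True
  note sn = norm_on_seminorm[OF N]
  show ?thesis by (rule that[of "\<lambda>_. 0"]) (use True sn_zero[OF sn] sn_nonneg[OF sn] blf_0[OF sn] in auto)
next
  case False
  note sn = norm_on_seminorm[OF N]
  obtain L where L: "fdiff V N N x L" using s x False by (auto simp: smooth_on_def)
  have "N x \<le> L x"
  proof (rule field_le_epsilon)
    fix e :: real assume "e > 0"
    then obtain t where t: "t > 0" "\<bar>N (x + t *\<^sub>R x) - N x - t * L x\<bar> \<le> t * e"
      using fdiff_ray[OF sn L x] by (metis order_refl)
    have "N (x + t *\<^sub>R x) = (1 + t) * N x"
      using sn_scale[OF sn x, of "1 + t"] t by (simp add: scaleR_add_left)
    then have "t * N x \<le> t * (L x + e)" using t by (simp add: algebra_simps abs_le_iff)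
    then show "N x \<le> L x + e" using t by simp
  qed
  then have "L x = N x" using fdiff_norm_le[OF sn L x x] by simp
  then show ?thesis using that fdiff_blf[OF sn L] fdiff_norm_le[OF sn L x] by blast
qed

section \<open>Good spaces are reflexive with Frechet smooth dual\<close>

text \<open>Bolzano-Weierstrass in each coordinate, followed by a diagonal choice.\<close>

lemma coordinatewise_subseq:
  fixes s :: "nat \<Rightarrow> nat \<Rightarrow> real"
  assumes "\<And>i. \<exists>C. \<forall>k. \<bar>s k i\<bar> \<le> C"
  obtains r x where "strict_mono r" "\<And>i. (\<lambda>k. s (r k) i) \<longlonglongrightarrow> x i"
proof -
  interpret subseqs "\<lambda>n f. convergent (\<lambda>k. s (f k) n)"
  proof
    fix n and f :: "nat \<Rightarrow> nat" assume "strict_mono f"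
    obtain C where "\<forall>k. \<bar>s k n\<bar> \<le> C" using assms by blast
    then have "bounded (range (\<lambda>k. s (f k) n))" by (auto simp: bounded_iff)
    then obtain l r where "strict_mono r" "((\<lambda>k. s (f k) n) \<circ> r) \<longlonglongrightarrow> l"
      using bounded_imp_convergent_subsequence by metis
    then show "\<exists>r'. strict_mono r' \<and> convergent (\<lambda>k. s ((f \<circ> r') k) n)"
      by (intro exI[of _ r]) (auto simp: convergent_def o_def)
  qed
  have "convergent (\<lambda>k. s (diagseq k) n)" for n
  proof -
    \<comment> \<open>Stage \<open>n\<close> controls the diagonal sequence only from index
      \<open>Suc n\<close> on; the initial segment does not matter for convergence.\<close>
    have "convergent (\<lambda>k. s ((diagseq \<circ> ((+) (Suc n))) k) n)"
    proof (rule diagseq_holds)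
      fix r q :: "nat \<Rightarrow> nat" and m assume "strict_mono r" "convergent (\<lambda>k. s (q k) m)"
      then show "convergent (\<lambda>k. s ((q \<circ> r) k) m)"
        using convergent_subseq_convergent[of "\<lambda>k. s (q k) m" r] by (simp add: o_def)
    qed
    then have "convergent (\<lambda>k. s (diagseq (k + Suc n)) n)" by (simp add: o_def add.commute)
    then show ?thesis using convergent_ignore_initial_segment[of "\<lambda>k. s (diagseq k) n" "Suc n"] by simp
  qed
  then have "(\<lambda>k. s (diagseq k) i) \<longlonglongrightarrow> lim (\<lambda>k. s (diagseq k) i)" for i
    by (simp add: convergent_LIMSEQ_iff)
  from that[OF subseq_diagseq this] show ?thesis .
qed

lemma good_norm: "good V N \<Longrightarrow> norm_on V N" and good_sn: "good V N \<Longrightarrow> seminorm_on V N"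
  and good_smooth: "good V N \<Longrightarrow> smooth_on V N" and good_lur: "good V N \<Longrightarrow> lur_on V N"
  and good_weak: "good V N \<Longrightarrow> coordinatewise_weak V N"
  and good_separable: "good V N \<Longrightarrow> separable_on V N"
  and good_coord: "good V N \<Longrightarrow> \<exists>C. \<forall>x\<in>V. \<bar>x i\<bar> \<le> C * N x"
  by (simp_all add: good_def norm_on_def)

lemma weak_limit:
  assumes "coordinatewise_weak V N" "\<And>k. s k \<in> V" "\<And>k. N (s k) \<le> C" "\<And>i. (\<lambda>k. s k i) \<longlonglongrightarrow> x i"
  shows "x \<in> V" "blf V N f \<Longrightarrow> (\<lambda>k. f (s k)) \<longlonglongrightarrow> f x"
  using assms unfolding coordinatewise_weak_def by blast+

text \<open>A norming functional at the limit converges along the sequence and stays below the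
  norms.\<close>

lemma weak_lsc:
  assumes N: "norm_on V N" "smooth_on V N" and w: "coordinatewise_weak V N"
    and s: "\<And>k. s k \<in> V" "\<And>k. N (s k) \<le> C" "\<And>i. (\<lambda>k. s k i) \<longlonglongrightarrow> x i"
  shows "N x \<le> C" "e > 0 \<Longrightarrow> eventually (\<lambda>k. N x - e < N (s k)) sequentially"
proof -
  have x: "x \<in> V" by (rule weak_limit(1)[OF w s])
  obtain L where L: "blf V N L" "L x = N x" "\<And>y. y \<in> V \<Longrightarrow> \<bar>L y\<bar> \<le> N y"
    using smooth_norming[OF N x] by blast
  have lim: "(\<lambda>k. L (s k)) \<longlonglongrightarrow> N x" using weak_limit(2)[OF w s L(1)] L(2) by simp
  have le: "L (s k) \<le> N (s k)" for k using L(3)[OF s(1)[of k]] by simp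
  show "N x \<le> C" by (rule LIMSEQ_le_const2[OF lim]) (use le s(2) order_trans in blast)
  show "eventually (\<lambda>k. N x - e < N (s k)) sequentially" if "e > 0"
  proof (rule eventually_mono[OF order_tendstoD(1)[OF lim, of "N x - e"]])
    show "N x - e < N (s k)" if "N x - e < L (s k)" for k using that le[of k] by simp
  qed (use that in simp)
qed

text \<open>Weak sequential compactness of balls, obtained without a weak topology: bounded
  coordinates give a coordinatewise limit, which is then a weak one.\<close>

lemma good_bounded_subseq:
  fixes s :: "nat \<Rightarrow> nat \<Rightarrow> real"
  assumes g: "good V N" and s: "\<And>k. s k \<in> V" "\<And>k. N (s k) \<le> C"
  shows "\<exists>r x. strict_mono r \<and> x \<in> V \<and> N x \<le> C \<and> (\<forall>i. (\<lambda>k. s (r k) i) \<longlonglongrightarrow> x i) \<and>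
    (\<forall>f. blf V N f \<longrightarrow> (\<lambda>k. f (s (r k))) \<longlonglongrightarrow> f x)"
proof -
  have "\<exists>B. \<forall>k. \<bar>s k i\<bar> \<le> B" for i
  proof -
    obtain K where K: "\<forall>x\<in>V. \<bar>x i\<bar> \<le> K * N x" using good_coord[OF g] by blast
    have "\<bar>s k i\<bar> \<le> \<bar>K\<bar> * C" for k
    proof -
      have "\<bar>s k i\<bar> \<le> K * N (s k)" using K s by blast
      also have "\<dots> \<le> \<bar>K\<bar> * N (s k)" using sn_nonneg[OF good_sn[OF g] s(1)] by (intro mult_right_mono) auto
      also have "\<dots> \<le> \<bar>K\<bar> * C" using s(2) by (intro mult_left_mono) auto
      finally show ?thesis .
    qed
    then show ?thesis by blast
  qed
  then obtain r x where r: "strict_mono r" "\<And>i. (\<lambda>k. s (r k) i) \<longlonglongrightarrow> x i"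
    using coordinatewise_subseq[of s] by metis
  note w = weak_limit[OF good_weak[OF g], of "\<lambda>k. s (r k)" C x, OF s r(2)]
  moreover have "N x \<le> C"
    by (rule weak_lsc(1)[OF good_norm[OF g] good_smooth[OF g] good_weak[OF g], of "\<lambda>k. s (r k)", OF s r(2)])
  ultimately show ?thesis using r by blast
qed

text \<open>A Cauchy sequence has a weak limit along a subsequence; lower semicontinuity applied to
  the differences \<open>s m - t (r (k + P))\<close> makes it a norm limit.\<close>

lemma good_complete:
  assumes g: "good V N" and s: "\<And>k. s k \<in> V" and c: "\<And>e. e > 0 \<Longrightarrow> \<exists>M. \<forall>m\<ge>M. \<forall>n\<ge>M. N (s m - s n) < e"
  obtains x where "x \<in> V" "(\<lambda>k. N (s k - x)) \<longlonglongrightarrow> 0"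
proof -
  note sn = good_sn[OF g]
  obtain M where M: "\<And>m n. m \<ge> M \<Longrightarrow> n \<ge> M \<Longrightarrow> N (s m - s n) < 1" using c[of 1] by auto
  define t where "t = (\<lambda>k. s (k + M))"
  have t: "t k \<in> V" for k by (simp add: t_def s)
  have "N (t k) \<le> N (s M) + 1" for k
    using M[of "k + M" M] sn_tri2[OF sn t s, of k M] by (simp add: t_def)
  then obtain r x where r: "strict_mono r" "x \<in> V" "\<And>i. (\<lambda>k. t (r k) i) \<longlonglongrightarrow> x i"
    using good_bounded_subseq[of V N t "N (s M) + 1", OF g t] by blast
  have "(\<lambda>k. N (s k - x)) \<longlonglongrightarrow> 0"
  proof (rule LIMSEQ_I)
    fix e :: real assume e: "e > 0"
    then obtain P where P: "\<And>m n. m \<ge> P \<Longrightarrow> n \<ge> P \<Longrightarrow> N (s m - s n) < e / 2" using c[of "e / 2"] by auto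
    have "norm (N (s m - x) - 0) < e" if m: "m \<ge> P" for m
    proof -
      have mem: "s m - t (r (k + P)) \<in> V" for k using sn_mem(4)[OF sn s t] by simp
      have "k + P \<le> r (k + P)" for k using r(1) by (rule seq_suble)
      then have "r (k + P) + M \<ge> P" for k by (meson le_add2 order_trans le_add1)
      then have bd: "N (s m - t (r (k + P))) \<le> e / 2" for k using P[OF m, of "r (k + P) + M"] by (simp add: t_def less_imp_le)
      have "(\<lambda>k. (s m - t (r (k + P))) i) \<longlonglongrightarrow> (s m - x) i" for i
        using LIMSEQ_ignore_initial_segment[OF r(3)[of i], of P] by (auto intro!: tendsto_intros)
      then have "N (s m - x) \<le> e / 2"
        using weak_lsc(1)[OF good_norm[OF g] good_smooth[OF g] good_weak[OF g], of "\<lambda>k. s m - t (r (k + P))"] mem bd by blast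
      then show ?thesis using e sn_nonneg[OF sn sn_mem(4)[OF sn s r(2)], of m] by simp
    qed
    then show "\<exists>no. \<forall>n\<ge>no. norm (N (s n - x) - 0) < e" by blast
  qed
  then show ?thesis using that r by blast
qed

definition space_of :: "(nat \<Rightarrow> real) set \<Rightarrow> ((nat \<Rightarrow> real) \<Rightarrow> real) \<Rightarrow> (nat \<Rightarrow> real) nspace" where
  "space_of V N = \<lparr>carr = V, addv = (+), smul = (*\<^sub>R), zer = 0, nrm = N\<rparr>"

lemma space_of_sel [simp]: "carr (space_of V N) = V" "addv (space_of V N) = (+)" "smul (space_of V N) = (*\<^sub>R)"
  "zer (space_of V N) = 0" "nrm (space_of V N) = N"
  by (simp_all add: space_of_def)

lemma minusv_space_of [simp]: "minusv (space_of V N) x y = x - y"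
  by (simp add: minusv_def)

lemma bdd_lin_fun_space_of [simp]: "bdd_lin_fun (space_of V N) = blf V N"
  by (simp add: bdd_lin_fun_def blf_def fun_eq_iff)

lemma good_normed_space_str: "good V N \<Longrightarrow> normed_space_str (space_of V N)"
proof -
  assume g: "good V N"
  note sn = good_sn[OF g]
  show ?thesis unfolding normed_space_str_def space_of_sel
    using sn_mem[OF sn] sn_nonneg[OF sn] sn_zero[OF sn] sn_scale[OF sn] sn_tri[OF sn] good_norm[OF g]
    unfolding norm_on_def by (auto simp: scaleR_add_left scaleR_add_right add.assoc add.commute)
qed

lemma good_banach_str: "good V N \<Longrightarrow> banach_str (space_of V N)"
  unfolding banach_str_def using good_normed_space_str[of V N]
  by (auto elim!: good_complete)

lemma good_separable_str: "good V N \<Longrightarrow> separable_str (space_of V N)"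
  unfolding separable_str_def using good_separable[of V N] by (auto simp: separable_on_def)

lemma good_frechet_smooth: "good V N \<Longrightarrow> frechet_smooth (space_of V N)"
  unfolding frechet_smooth_def using good_smooth[of V N]
  by (force simp: smooth_on_def fdiff_def)

section \<open>The dual norm: attainment, differentiability and reflexivity\<close>

context
  fixes V N assumes g: "good V N"
begin

abbreviation (input) "dn \<equiv> dual_norm (space_of V N)"

lemma dn_bdd: "blf V N f \<Longrightarrow> bdd_above {\<bar>f x\<bar> | x. x \<in> V \<and> N x \<le> 1}"
proof -
  assume f: "blf V N f"
  obtain C where C: "C > 0" "\<And>x. x \<in> V \<Longrightarrow> \<bar>f x\<bar> \<le> C * N x" using blf_bound[OF good_sn[OF g] f] by blast
  show ?thesis
  proof (rule bdd_aboveI[where M=C], clarify)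
    fix x assume "x \<in> V" "N x \<le> 1"
    then show "\<bar>f x\<bar> \<le> C" using C(2)[of x] mult_left_mono[of "N x" 1 C] C(1) by linarith
  qed
qed

lemma dn_upper1: "blf V N f \<Longrightarrow> x \<in> V \<Longrightarrow> N x \<le> 1 \<Longrightarrow> \<bar>f x\<bar> \<le> dn f"
  unfolding dual_norm_def space_of_sel by (rule cSup_upper) (auto intro: dn_bdd)

lemma dn_nonneg: "blf V N f \<Longrightarrow> 0 \<le> dn f"
  using dn_upper1[of f 0] sn_mem[OF good_sn[OF g]] sn_zero[OF good_sn[OF g]] by force

lemma dn_least: "(\<And>x. x \<in> V \<Longrightarrow> N x \<le> 1 \<Longrightarrow> \<bar>f x\<bar> \<le> C) \<Longrightarrow> dn f \<le> C"
  unfolding dual_norm_def space_of_sel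
  using sn_mem[OF good_sn[OF g]] sn_zero[OF good_sn[OF g]] by (intro cSup_least) force+

lemma dn_upper: assumes f: "blf V N f" and x: "x \<in> V" shows "\<bar>f x\<bar> \<le> dn f * N x"
proof (cases "N x = 0")
  case True
  then have "x = 0" using good_norm[OF g] x by (simp add: norm_on_def)
  then show ?thesis using blf_zero[OF good_sn[OF g] f] True by simp
next
  case False
  note sn = good_sn[OF g]
  have p: "N x > 0" using False sn_nonneg[OF sn x] by simp
  have "\<bar>f ((1 / N x) *\<^sub>R x)\<bar> \<le> dn f"
    using dn_upper1[OF f, of "(1 / N x) *\<^sub>R x"] sn_scale[OF sn x] sn_mem[OF sn] x p by simp
  then show ?thesis using blf_scale[OF sn f x] p by (simp add: abs_mult field_simps)
qed

lemma dn_approx: assumes f: "blf V N f" and c: "c < dn f" obtains x where "x \<in> V" "N x \<le> 1" "c < f x"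
proof -
  note sn = good_sn[OF g]
  have "\<exists>x. x \<in> V \<and> N x \<le> 1 \<and> c < \<bar>f x\<bar>"
    using c dn_least[of f c] by (meson not_le)
  then obtain x where x: "x \<in> V" "N x \<le> 1" "c < \<bar>f x\<bar>" by blast
  show ?thesis
  proof (cases "f x \<ge> 0")
    case False
    then show ?thesis using that[of "- x"] x sn_neg[OF sn] sn_mem(5)[OF sn] blf_neg[OF sn f] by simp
  qed (use x that in simp)
qed

text \<open>Almost maximising points have a weakly convergent subsequence, whose limit
  maximises.\<close>

lemma dn_attained: assumes f: "blf V N f" obtains x where "x \<in> V" "N x \<le> 1" "f x = dn f"
proof -
  have "\<exists>x. x \<in> V \<and> N x \<le> 1 \<and> dn f - inverse (real (Suc k)) < f x" for k
  proof -
    have "dn f - inverse (real (Suc k)) < dn f" by simp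
    from dn_approx[OF f this] show ?thesis by blast
  qed
  then obtain s where s: "\<And>k. s k \<in> V" "\<And>k. N (s k) \<le> 1" "\<And>k. dn f - inverse (real (Suc k)) < f (s k)" by metis
  obtain r x where r: "strict_mono r" "x \<in> V" "N x \<le> 1" "\<And>i. (\<lambda>k. s (r k) i) \<longlonglongrightarrow> x i"
      "\<And>f. blf V N f \<Longrightarrow> (\<lambda>k. f (s (r k))) \<longlonglongrightarrow> f x"
    using good_bounded_subseq[OF g, of s, OF s(1,2)] by blast
  have "(\<lambda>k. dn f - inverse (real (Suc k))) \<longlonglongrightarrow> dn f - 0"
    by (intro tendsto_diff tendsto_const LIMSEQ_inverse_real_of_nat)
  then have "(\<lambda>k. dn f - inverse (real (Suc (r k)))) \<longlonglongrightarrow> dn f"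
    using LIMSEQ_subseq_LIMSEQ[OF _ r(1), of "\<lambda>k. dn f - inverse (real (Suc k))"] by (simp add: o_def)
  then have "dn f \<le> f x" by (rule LIMSEQ_le[OF _ r(5)[OF f]]) (intro exI[of _ 0] allI impI less_imp_le[OF s(3)])
  then have "f x = dn f" using dn_upper1[OF f r(2,3)] by simp
  then show ?thesis using that r by blast
qed

text \<open>The functional \<open>f / dn f\<close> is a lower bound for \<open>N\<close>, so
  \<open>N (s k)\<close> and \<open>N (x + s k)\<close> are squeezed to 1 and 2, and local uniform
  rotundity gives convergence.\<close>

lemma strongly_exposed:
  assumes f: "blf V N f" and p: "dn f > 0" and x: "x \<in> V" "N x \<le> 1" "f x = dn f"
    and s: "\<And>k. s k \<in> V" "\<And>k. N (s k) \<le> 1" "(\<lambda>k. f (s k)) \<longlonglongrightarrow> dn f"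
  shows "(\<lambda>k. N (s k - x)) \<longlonglongrightarrow> 0"
proof -
  note sn = good_sn[OF g]
  have lb: "f y / dn f \<le> N y" if "y \<in> V" for y
    using dn_upper[OF f that] p by (simp add: field_simps)
  have nx: "N x = 1" using lb[OF x(1)] x p by simp
  have lim: "(\<lambda>k. f (s k) / dn f) \<longlonglongrightarrow> 1"
    using tendsto_divide[OF s(3) tendsto_const, of "dn f"] p by simp
  have "(\<lambda>k. N (s k)) \<longlonglongrightarrow> N x"
    unfolding nx by (rule tendsto_sandwich[OF _ _ lim tendsto_const]) (use lb s in auto)
  moreover have "(\<lambda>k. N (x + s k)) \<longlonglongrightarrow> 2 * N x"
  proof (rule tendsto_sandwich)
    show "(\<lambda>k. 1 + f (s k) / dn f) \<longlonglongrightarrow> 2 * N x" using tendsto_add[OF tendsto_const lim, of 1] nx by simp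
    show "\<forall>\<^sub>F k in sequentially. 1 + f (s k) / dn f \<le> N (x + s k)"
    proof (intro always_eventually allI)
      fix k
      have "f (x + s k) / dn f = 1 + f (s k) / dn f"
        using blf_add[OF sn f x(1) s(1)[of k]] x(3) p by (simp add: add_divide_distrib)
      then show "1 + f (s k) / dn f \<le> N (x + s k)"
        using lb[of "x + s k"] sn_mem[OF sn] x s by simp
    qed
    show "\<forall>\<^sub>F k in sequentially. N (x + s k) \<le> 2"
      by (intro always_eventually allI order_trans[OF sn_tri[OF sn x(1) s(1)]]) (use add_mono[OF x(2) s(2)] in simp)
  qed (simp add: nx)
  ultimately show ?thesis using good_lur[OF g] x(1) s(1) unfolding lur_on_def by blast
qed

text \<open>Smulian's argument: the derivative at \<open>f\<close> is evaluation at a point where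
  \<open>f\<close> attains its norm. If the remainder were too large, almost maximisers of the
  perturbed functionals would maximise \<open>f\<close> in the limit without approaching that
  point.\<close>

lemma good_dual_smooth: "frechet_smooth (dual_space (space_of V N))"
  unfolding frechet_smooth_def
proof (intro ballI impI)
  note sn = good_sn[OF g]
  fix f assume "f \<in> carr (dual_space (space_of V N))" "f \<noteq> zer (dual_space (space_of V N))"
  then have f: "blf V N f" and fz: "\<And>x. x \<notin> V \<Longrightarrow> f x = 0" and f0: "f \<noteq> (\<lambda>x. 0)"
    by (auto simp: dual_space_def dual_set_def)
  have p: "dn f > 0"
  proof (rule ccontr)
    assume "\<not> dn f > 0"
    then have "dn f = 0" using dn_nonneg[OF f] by simp
    then have "f x = 0" for x using dn_upper[OF f, of x] fz[of x] by (cases "x \<in> V") auto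
    then show False using f0 by auto
  qed
  obtain x where x: "x \<in> V" "N x \<le> 1" "f x = dn f" using dn_attained[OF f] by blast
  let ?D = "dual_space (space_of V N)"
  have D: "carr ?D = {f. blf V N f \<and> (\<forall>x. x \<notin> V \<longrightarrow> f x = 0)}" "addv ?D = (\<lambda>f g x. f x + g x)"
    "smul ?D = (\<lambda>c f x. c * f x)" "nrm ?D = dn"
    by (simp_all add: dual_space_def dual_set_def)
  show "\<exists>L. bdd_lin_fun ?D L \<and> (\<forall>e>0. \<exists>d>0. \<forall>h\<in>carr ?D. 0 < nrm ?D h \<and> nrm ?D h < d \<longrightarrow>
     \<bar>nrm ?D (addv ?D f h) - nrm ?D f - L h\<bar> \<le> e * nrm ?D h)"
  proof (intro exI[of _ "\<lambda>h. h x"] conjI allI impI)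
    show "bdd_lin_fun ?D (\<lambda>h. h x)"
      unfolding bdd_lin_fun_def D using dn_upper1 x by (auto intro!: exI[of _ 1])
    fix e :: real assume e: "e > 0"
    show "\<exists>d>0. \<forall>h\<in>carr ?D. 0 < nrm ?D h \<and> nrm ?D h < d \<longrightarrow>
     \<bar>nrm ?D (addv ?D f h) - nrm ?D f - h x\<bar> \<le> e * nrm ?D h"
    proof (rule ccontr)
      assume neg: "\<not> ?thesis"
      define bad where "bad h \<longleftrightarrow> blf V N h \<and> 0 < dn h \<and> e * dn h < \<bar>dn (\<lambda>x. f x + h x) - dn f - h x\<bar>" for h
      have bad: "\<exists>h. bad h \<and> dn h < d" if d: "d > 0" for d
      proof (rule ccontr)
        assume no: "\<nexists>h. bad h \<and> dn h < d"
        have "\<forall>h\<in>carr ?D. 0 < nrm ?D h \<and> nrm ?D h < d \<longrightarrow> \<bar>nrm ?D (addv ?D f h) - nrm ?D f - h x\<bar> \<le> e * nrm ?D h"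
        proof (intro ballI impI)
          fix h assume h: "h \<in> carr ?D" "0 < nrm ?D h \<and> nrm ?D h < d"
          then have "\<not> bad h" using no unfolding D by blast
          then show "\<bar>nrm ?D (addv ?D f h) - nrm ?D f - h x\<bar> \<le> e * nrm ?D h"
            using h unfolding D bad_def by (simp add: not_less)
        qed
        then show False using neg d by blast
      qed
      have "\<exists>h. bad h \<and> dn h < inverse (real (Suc k))" for k
        by (rule bad) simp
      then obtain h where "\<And>k. bad (h k) \<and> dn (h k) < inverse (real (Suc k))" by metis
      then have h: "\<And>k. blf V N (h k)" "\<And>k. 0 < dn (h k)" "\<And>k. dn (h k) < inverse (real (Suc k))"
        "\<And>k. \<bar>dn (\<lambda>x. f x + h k x) - dn f - h k x\<bar> > e * dn (h k)" by (auto simp: bad_def)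
      \<comment> \<open>Evaluation at \<open>x\<close> bounds the norm of \<open>f + h k\<close>
        from below, so a large remainder can only be an excess.\<close>
      have up: "dn (\<lambda>x. f x + h k x) > dn f + h k x + e * dn (h k)" for k
      proof -
        have "f x + h k x \<le> dn (\<lambda>x. f x + h k x)"
          using dn_upper1[OF blf_plus[OF sn f h(1)[of k]] x(1,2)] by simp
        then show ?thesis using h(4)[of k] x(3) by simp
      qed
      have "\<exists>y. y \<in> V \<and> N y \<le> 1 \<and> f y + h k y > dn f + h k x + e * dn (h k)" for k
        by (rule dn_approx[OF blf_plus[OF sn f h(1)[of k]] up]) blast
      then obtain y where y: "\<And>k. y k \<in> V" "\<And>k. N (y k) \<le> 1" "\<And>k. f (y k) + h k (y k) > dn f + h k x + e * dn (h k)" by metis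
      have ydn: "f (y k) \<le> dn f" for k using dn_upper1[OF f y(1,2)] abs_le_D1 by blast
      \<comment> \<open>Since \<open>f (y k)\<close> cannot exceed \<open>dn f\<close>, the excess
        must come from \<open>h k\<close>, which forces \<open>y k\<close> away from
        \<open>x\<close>.\<close>
      have far: "N (y k - x) > e" for k
      proof -
        have "e * dn (h k) < h k (y k) - h k x" using y(3)[of k] ydn[of k] by simp
        also have "\<dots> = h k (y k - x)" using blf_diff[OF sn h(1) y(1) x(1)] by simp
        also have "\<dots> \<le> dn (h k) * N (y k - x)" using dn_upper[OF h(1), of "y k - x"] sn_mem(4)[OF sn y(1) x(1)] abs_le_D1 by blast
        finally show ?thesis using h(2)[of k] by (simp add: mult.commute)
      qed
      have "(\<lambda>k. f (y k)) \<longlonglongrightarrow> dn f"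
      proof (rule tendsto_sandwich)
        show "(\<lambda>k. dn f - 2 * inverse (real (Suc k))) \<longlonglongrightarrow> dn f"
          using tendsto_diff[OF tendsto_const tendsto_mult[OF tendsto_const LIMSEQ_inverse_real_of_nat], of "dn f" 2] by simp
        show "\<forall>\<^sub>F k in sequentially. dn f - 2 * inverse (real (Suc k)) \<le> f (y k)"
        proof (intro always_eventually allI)
          fix k
          have "\<bar>h k (y k)\<bar> \<le> dn (h k)" "\<bar>h k x\<bar> \<le> dn (h k)" using dn_upper1[OF h(1)] x y by auto
          moreover have "0 < e * dn (h k)" using e h(2) by simp
          ultimately show "dn f - 2 * inverse (real (Suc k)) \<le> f (y k)" using y(3)[of k] h(3)[of k] by linarith
        qed
      qed (use ydn in auto)
      from strongly_exposed[OF f p x y(1,2) this] have "eventually (\<lambda>k. N (y k - x) < e) sequentially"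
        using e by (rule order_tendstoD(2))
      then show False using far by (auto simp: eventually_sequentially) (meson far less_asym order_refl)
    qed
  qed
qed

text \<open>Helly's theorem by least squares: a minimiser of the squared error over the ball of
  radius \<open>C\<close> exists by weak compactness, and a positive minimum would contradict the
  bound \<open>C0 \<le> C\<close> for \<open>\<Phi>\<close>.\<close>

lemma dn_helly:
  assumes \<Phi>: "\<Phi> \<in> dual_set (dual_space (space_of V N))"
  obtains C where "\<And>(m::nat) q. (\<And>i. i < m \<Longrightarrow> q i \<in> dual_set (space_of V N)) \<Longrightarrow>
    \<exists>x\<in>V. N x \<le> C \<and> (\<forall>i<m. q i x = \<Phi> (q i))"
proof -
  note sn = good_sn[OF g]
  let ?D = "dual_set (space_of V N)"
  have dD: "f \<in> ?D \<longleftrightarrow> blf V N f \<and> (\<forall>x. x \<notin> V \<longrightarrow> f x = 0)" for f by (auto simp: dual_set_def)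
  have lin: "\<And>f h. f \<in> ?D \<Longrightarrow> h \<in> ?D \<Longrightarrow> \<Phi> (\<lambda>x. f x + h x) = \<Phi> f + \<Phi> h"
      "\<And>c f. f \<in> ?D \<Longrightarrow> \<Phi> (\<lambda>x. c * f x) = c * \<Phi> f"
    and "\<exists>C. \<forall>f\<in>?D. \<bar>\<Phi> f\<bar> \<le> C * dn f"
    using \<Phi> unfolding dual_set_def[of "dual_space _"] bdd_lin_fun_def by (auto simp: dual_space_def)
  then obtain C0 where C0: "\<And>f. f \<in> ?D \<Longrightarrow> \<bar>\<Phi> f\<bar> \<le> C0 * dn f" by blast
  define C where "C = \<bar>C0\<bar> + 1"
  have C: "C > 0" "C0 \<le> C" by (auto simp: C_def)
  have "\<exists>x\<in>V. N x \<le> C \<and> (\<forall>i<m. q i x = \<Phi> (q i))" if q: "\<And>i. i < m \<Longrightarrow> q i \<in> ?D" for m :: nat and q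
  proof -
    have qb: "\<And>i. i < m \<Longrightarrow> blf V N (q i)" using q by (simp add: dD)
    define F where "F = (\<lambda>x. \<Sum>i<m. (q i x - \<Phi> (q i))\<^sup>2)"
    define I where "I = (INF x\<in>{x\<in>V. N x \<le> C}. F x)"
    have F0: "F x \<ge> 0" for x by (simp add: F_def sum_nonneg)
    have bd: "bdd_below (F ` {x\<in>V. N x \<le> C})" using F0 by (auto intro: bdd_belowI[of _ 0])
    have ne: "{x\<in>V. N x \<le> C} \<noteq> {}" using sn_mem(1)[OF sn] sn_zero[OF sn] C by fastforce
    have "\<exists>x. x \<in> V \<and> N x \<le> C \<and> F x < I + inverse (real (Suc k))" for k
    proof -
      have "I < I + inverse (real (Suc k))" by simp
      then show ?thesis using cINF_less_iff[OF ne bd, folded I_def, of "I + inverse (real (Suc k))"] by auto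
    qed
    then obtain s where s: "\<And>k. s k \<in> V" "\<And>k. N (s k) \<le> C" "\<And>k. F (s k) < I + inverse (real (Suc k))" by metis
    obtain r x where r: "strict_mono r" "x \<in> V" "N x \<le> C" "\<And>i. (\<lambda>k. s (r k) i) \<longlonglongrightarrow> x i"
        "\<And>f. blf V N f \<Longrightarrow> (\<lambda>k. f (s (r k))) \<longlonglongrightarrow> f x"
      using good_bounded_subseq[OF g, of s, OF s(1,2)] by blast
    have 1: "(\<lambda>k. F (s (r k))) \<longlonglongrightarrow> F x" unfolding F_def
      by (intro tendsto_sum tendsto_power tendsto_diff tendsto_const r(5) qb) simp
    have "(\<lambda>k. I + inverse (real (Suc k))) \<longlonglongrightarrow> I + 0"
      by (intro tendsto_add tendsto_const LIMSEQ_inverse_real_of_nat)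
    then have "(\<lambda>k. I + inverse (real (Suc (r k)))) \<longlonglongrightarrow> I"
      using LIMSEQ_subseq_LIMSEQ[OF _ r(1), of "\<lambda>k. I + inverse (real (Suc k))"] by (simp add: o_def)
    then have "F x \<le> I" by (rule LIMSEQ_le[OF 1]) (intro exI[of _ 0] allI impI less_imp_le[OF s(3)])
    then have min: "F x \<le> F y" if "y \<in> V" "N y \<le> C" for y
      using cINF_lower[OF bd, of y] that by (simp add: I_def)
    define d where "d = (\<lambda>i. \<Phi> (q i) - q i x)"
    \<comment> \<open>Up to a factor, \<open>G\<close> is the negative gradient of the squared error
      at the minimiser \<open>x\<close>.\<close>
    define G where "G = (\<lambda>y. \<Sum>i<m. d i * q i y)"
    have Gk: "(\<lambda>y. \<Sum>i<k. d i * q i y) \<in> ?D \<and> \<Phi> (\<lambda>y. \<Sum>i<k. d i * q i y) = (\<Sum>i<k. d i * \<Phi> (q i))" if "k \<le> m" for k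
      using that
    proof (induction k)
      case 0
      have z: "(\<lambda>y. 0) \<in> ?D" using blf_0[OF sn] by (simp add: dD)
      then show ?case using lin(2)[OF z, of 0] by simp
    next
      case (Suc k)
      then have i: "(\<lambda>y. \<Sum>i<k. d i * q i y) \<in> ?D" "\<Phi> (\<lambda>y. \<Sum>i<k. d i * q i y) = (\<Sum>i<k. d i * \<Phi> (q i))" by auto
      have j: "(\<lambda>y. d k * q k y) \<in> ?D" using q[of k] Suc.prems blf_cmul[OF sn] by (simp add: dD)
      have "(\<lambda>y. (\<Sum>i<k. d i * q i y) + d k * q k y) \<in> ?D"
        using i(1) j blf_plus[OF sn] by (simp add: dD)
      then show ?case using lin(1)[OF i(1) j] lin(2)[OF q[of k], of "d k"] i(2) Suc.prems by simp
    qed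
    then have GD: "G \<in> ?D" and \<Phi>G: "\<Phi> G = (\<Sum>i<m. d i * \<Phi> (q i))" by (auto simp: G_def)
    have Gb: "blf V N G" using GD by (simp add: dD)
    \<comment> \<open>Otherwise a short step \<open>t\<close> from \<open>x\<close> towards
      \<open>y\<close> would lower the squared error: the linear gain \<open>2 * t * a\<close> beats
      the quadratic loss \<open>t\<^sup>2 * b\<close>.\<close>
    have Gmax: "G y \<le> G x" if y: "y \<in> V" "N y \<le> C" for y
    proof -
      have "(\<Sum>i<m. d i * (q i y - q i x)) \<le> 0"
      proof (rule ccontr)
        define a where "a = (\<Sum>i<m. d i * (q i y - q i x))"
        define b where "b = (\<Sum>i<m. (q i y - q i x)\<^sup>2)"
        assume "\<not> (\<Sum>i<m. d i * (q i y - q i x)) \<le> 0"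
        then have a: "a > 0" by (simp add: a_def)
        have b: "b \<ge> 0" by (simp add: b_def sum_nonneg)
        define t where "t = min 1 (a / (b + 1))"
        have t: "0 < t" "t \<le> 1" using a b by (auto simp: t_def)
        have "t * b < 2 * a"
        proof -
          have "t * b \<le> a / (b + 1) * b" using b by (intro mult_right_mono) (auto simp: t_def)
          also have "\<dots> \<le> a" using a b by (simp add: field_simps)
          finally show ?thesis using a by simp
        qed
        let ?z = "(1 - t) *\<^sub>R x + t *\<^sub>R y"
        have zV: "?z \<in> V" using sn_mem[OF sn] r(2) y(1) by simp
        have "N ?z \<le> (1 - t) * N x + t * N y"
          using sn_tri[OF sn, of "(1 - t) *\<^sub>R x" "t *\<^sub>R y"] sn_mem[OF sn] r(2) y t sn_scale[OF sn] by simp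
        also have "\<dots> \<le> (1 - t) * C + t * C" using r(3) y(2) t by (intro add_mono mult_left_mono) auto
        finally have zC: "N ?z \<le> C" by (simp add: algebra_simps)
        have "F ?z = (\<Sum>i<m. (d i)\<^sup>2 - 2 * t * (d i * (q i y - q i x)) + t\<^sup>2 * (q i y - q i x)\<^sup>2)"
          unfolding F_def
        proof (intro sum.cong refl)
          fix i assume "i \<in> {..<m}"
          then have e: "q i ?z = (1 - t) * q i x + t * q i y"
            using blf_add[OF sn qb, of i "(1 - t) *\<^sub>R x" "t *\<^sub>R y"] blf_scale[OF sn qb] sn_mem[OF sn] r(2) y by simp
          show "(q i ?z - \<Phi> (q i))\<^sup>2 = (d i)\<^sup>2 - 2 * t * (d i * (q i y - q i x)) + t\<^sup>2 * (q i y - q i x)\<^sup>2"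
            unfolding e by (simp add: d_def power2_eq_square algebra_simps)
        qed
        also have "\<dots> = F x - 2 * t * a + t\<^sup>2 * b"
          unfolding F_def a_def b_def
          by (simp add: sum.distrib sum_subtractf sum_distrib_left d_def power2_commute)
        also have "\<dots> = F x - t * (2 * a - t * b)" by (simp add: power2_eq_square algebra_simps)
        also have "\<dots> < F x" using t \<open>t * b < 2 * a\<close> by simp
        finally show False using min[OF zV zC] by simp
      qed
      then show ?thesis by (simp add: G_def right_diff_distrib sum_subtractf)
    qed
    \<comment> \<open>The ball is symmetric and \<open>G\<close> is maximal at \<open>x\<close> on
      it, so \<open>G x\<close> is at least \<open>C\<close> times the norm of \<open>G\<close>.
      Compared with the bound for \<open>\<Phi> G\<close> this leaves no room for a nonzero
      error.\<close>
    have "dn G \<le> G x / C"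
    proof (rule dn_least)
      fix y assume y: "y \<in> V" "N y \<le> 1"
      have "G (C *\<^sub>R y) \<le> G x" "G ((- C) *\<^sub>R y) \<le> G x"
        by (rule Gmax; use y C sn_mem(3)[OF sn y(1)] sn_scale[OF sn y(1)] in \<open>simp del: scaleR_minus_left add: mult_left_le\<close>)+
      then have "C * G y \<le> G x" "- C * G y \<le> G x" unfolding blf_scale[OF sn Gb y(1)] by simp_all
      then show "\<bar>G y\<bar> \<le> G x / C" using C by (simp add: field_simps abs_le_iff)
    qed
    then have "C * dn G \<le> G x" using C by (simp add: field_simps)
    moreover have "C0 * dn G \<le> C * dn G" using C(2) dn_nonneg[OF Gb] by (rule mult_right_mono)
    ultimately have "\<Phi> G \<le> G x" using C0[OF GD] by linarith
    then have "(\<Sum>i<m. d i * d i) \<le> 0"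
      using \<Phi>G by (simp add: G_def d_def right_diff_distrib sum_subtractf)
    then have "(\<Sum>i<m. d i * d i) = 0" by (intro antisym) (simp_all add: sum_nonneg)
    then have "\<forall>i<m. d i = 0" by (subst (asm) sum_nonneg_eq_0_iff) auto
    then show ?thesis using r(2,3) by (auto simp: d_def intro!: bexI[of _ x])
  qed
  then show ?thesis by (rule that)
qed

text \<open>The representing point is read off from the values of \<open>\<Phi>\<close> on the
  coordinate functionals, hence does not depend on \<open>f\<close>. Helly points matching
  \<open>f\<close> and the first \<open>k\<close> coordinates converge to it coordinatewise, and
  therefore weakly.\<close>

lemma good_reflexive: "reflexive_str (space_of V N)"
  unfolding reflexive_str_def
proof
  note sn = good_sn[OF g]
  let ?D = "dual_set (space_of V N)"
  have dD: "f \<in> ?D \<longleftrightarrow> blf V N f \<and> (\<forall>x. x \<notin> V \<longrightarrow> f x = 0)" for f by (auto simp: dual_set_def)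
  fix \<Phi> assume \<Phi>: "\<Phi> \<in> dual_set (dual_space (space_of V N))"
  obtain C where C: "\<And>(m::nat) q. (\<And>i. i < m \<Longrightarrow> q i \<in> ?D) \<Longrightarrow> \<exists>x\<in>V. N x \<le> C \<and> (\<forall>i<m. q i x = \<Phi> (q i))"
    using dn_helly[OF \<Phi>] by metis
  define c where "c = (\<lambda>(i::nat) x. if x \<in> V then x i else 0 :: real)"
  have c: "c i \<in> ?D" for i
  proof -
    obtain K where "\<forall>x\<in>V. \<bar>x i\<bar> \<le> K * N x" using good_coord[OF g] by blast
    then show ?thesis unfolding dD blf_def c_def using sn_mem[OF sn] by auto
  qed
  define x where "x = (\<lambda>i. \<Phi> (c i))"
  have key: "x \<in> V \<and> \<Phi> f = f x" if f: "f \<in> ?D" for f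
  proof -
    have "\<exists>y. y \<in> V \<and> N y \<le> C \<and> f y = \<Phi> f \<and> (\<forall>i<k. y i = x i)" for k
    proof -
      \<comment> \<open>Functional number 0 is \<open>f\<close>, and number \<open>Suc j\<close> is
        the \<open>j\<close>-th coordinate.\<close>
      have "\<exists>y\<in>V. N y \<le> C \<and> (\<forall>i<Suc k. (case i of 0 \<Rightarrow> f | Suc j \<Rightarrow> c j) y = \<Phi> (case i of 0 \<Rightarrow> f | Suc j \<Rightarrow> c j))"
        by (rule C) (auto split: nat.split simp: f c)
      then obtain y where y: "y \<in> V" "N y \<le> C"
        "\<And>i. i < Suc k \<Longrightarrow> (case i of 0 \<Rightarrow> f | Suc j \<Rightarrow> c j) y = \<Phi> (case i of 0 \<Rightarrow> f | Suc j \<Rightarrow> c j)" by blast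
      have "y i = x i" if "i < k" for i using y(3)[of "Suc i"] that y(1) by (simp add: c_def x_def)
      then show ?thesis using y(3)[of 0] y by auto
    qed
    then obtain s where s: "\<And>k. s k \<in> V" "\<And>k. N (s k) \<le> C" "\<And>k. f (s k) = \<Phi> f" "\<And>k i. i < k \<Longrightarrow> s k i = x i" by metis
    have lim: "(\<lambda>k. s k i) \<longlonglongrightarrow> x i" for i
      by (rule tendsto_eventually) (use s(4) in \<open>auto simp: eventually_sequentially intro!: exI[of _ "Suc i"]\<close>)
    note w = weak_limit[OF good_weak[OF g] s(1,2) lim]
    have "(\<lambda>k. \<Phi> f) \<longlonglongrightarrow> f x" using w(2)[of f] f s(3) by (simp add: dD)
    then show ?thesis using w(1) by (simp add: LIMSEQ_const_iff)
  qed
  show "\<exists>x\<in>carr (space_of V N). \<forall>f\<in>?D. \<Phi> f = f x"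
    using key key[OF c[of 0]] by auto
qed

end

section \<open>Gauges, squares and block coordinates\<close>

definition minkowski :: "'v::real_vector set \<Rightarrow> 'v \<Rightarrow> real" where
  "minkowski K z = Inf {s. s > 0 \<and> (1 / s) *\<^sub>R z \<in> K}"

text \<open>Closedness and boundedness are asked for along rays, so they can be checked on the
  inequalities defining the set without any topology on \<open>V\<close>.\<close>

context
  fixes V K :: "'v::real_vector set"
  assumes V: "subspace V" and KV: "K \<subseteq> V"
    and conv: "\<And>x y u. x \<in> K \<Longrightarrow> y \<in> K \<Longrightarrow> 0 \<le> u \<Longrightarrow> u \<le> 1 \<Longrightarrow> u *\<^sub>R x + (1 - u) *\<^sub>R y \<in> K"
    and sym: "\<And>x. x \<in> K \<Longrightarrow> - x \<in> K"
    and absorb: "\<And>z. z \<in> V \<Longrightarrow> \<exists>s>0. s *\<^sub>R z \<in> K"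
    and closed: "\<And>z. z \<in> V \<Longrightarrow> (\<And>s. 0 < s \<Longrightarrow> s < 1 \<Longrightarrow> s *\<^sub>R z \<in> K) \<Longrightarrow> z \<in> K"
    and bounded: "\<And>z. z \<in> V \<Longrightarrow> (\<And>s. 0 < s \<Longrightarrow> s *\<^sub>R z \<in> K) \<Longrightarrow> z = 0"
begin

lemma minkowski_zero_mem: "0 \<in> K"
proof -
  obtain s where "s *\<^sub>R 0 \<in> K" using absorb[of 0] subspace_0[OF V] by blast
  then show ?thesis by simp
qed

lemma minkowski_star: "x \<in> K \<Longrightarrow> 0 \<le> u \<Longrightarrow> u \<le> 1 \<Longrightarrow> u *\<^sub>R x \<in> K"
  using conv[of x 0 u] minkowski_zero_mem by simp

lemma minkowski_bdd: "bdd_below {s. s > 0 \<and> (1 / s) *\<^sub>R z \<in> K}"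
  by (rule bdd_belowI[of _ 0]) auto

lemma minkowski_ne: "z \<in> V \<Longrightarrow> {s. s > 0 \<and> (1 / s) *\<^sub>R z \<in> K} \<noteq> {}"
proof -
  assume "z \<in> V"
  then obtain s where "s > 0" "s *\<^sub>R z \<in> K" using absorb by blast
  then have "1 / s \<in> {s. s > 0 \<and> (1 / s) *\<^sub>R z \<in> K}" by simp
  then show ?thesis by blast
qed

lemma minkowski_leI: "s > 0 \<Longrightarrow> (1 / s) *\<^sub>R z \<in> K \<Longrightarrow> minkowski K z \<le> s"
  unfolding minkowski_def by (rule cInf_lower[OF _ minkowski_bdd]) simp

lemma minkowski_nonneg: "z \<in> V \<Longrightarrow> 0 \<le> minkowski K z"
  unfolding minkowski_def by (rule cInf_greatest[OF minkowski_ne]) auto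

lemma minkowski_lessD: assumes z: "z \<in> V" and s: "minkowski K z < s" shows "s > 0" "(1 / s) *\<^sub>R z \<in> K"
proof -
  obtain t where t: "t > 0" "(1 / t) *\<^sub>R z \<in> K" "t < s"
    using cInf_lessD[OF minkowski_ne[OF z] s[unfolded minkowski_def]] by auto
  then show "s > 0" by simp
  have "(t / s) *\<^sub>R ((1 / t) *\<^sub>R z) \<in> K" by (rule minkowski_star[OF t(2)]) (use t in auto)
  moreover have "t / s * (1 / t) = 1 / s" using t by simp
  ultimately show "(1 / s) *\<^sub>R z \<in> K" by (simp only: scaleR_scaleR)
qed

lemma minkowski_le1: assumes z: "z \<in> V" shows "minkowski K z \<le> 1 \<longleftrightarrow> z \<in> K"
proof
  assume l: "minkowski K z \<le> 1"
  show "z \<in> K"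
  proof (rule closed[OF z])
    fix s :: real assume "0 < s" "s < 1"
    then have "1 < 1 / s" by simp
    then have "minkowski K z < 1 / s" using l by linarith
    from minkowski_lessD(2)[OF z this] show "s *\<^sub>R z \<in> K" by simp
  qed
qed (rule minkowski_leI, simp_all)

lemma minkowski_scale_le: assumes z: "z \<in> V" and c: "c > 0" shows "minkowski K (c *\<^sub>R z) \<le> c * minkowski K z"
proof (rule field_le_epsilon)
  fix e :: real assume e: "e > 0"
  let ?s = "minkowski K z + e / c"
  have s: "?s > 0" "(1 / ?s) *\<^sub>R z \<in> K" using minkowski_lessD[OF z, of ?s] e c by auto
  have "minkowski K (c *\<^sub>R z) \<le> c * ?s" using s c by (intro minkowski_leI) auto
  then show "minkowski K (c *\<^sub>R z) \<le> c * minkowski K z + e" using c by (simp add: distrib_left)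
qed

lemma minkowski_norm: "norm_on V (minkowski K)"
  unfolding norm_on_def seminorm_on_def
proof (intro conjI allI ballI impI V)
  fix z assume z: "z \<in> V"
  have pos: "minkowski K (c *\<^sub>R z) = c * minkowski K z" if c: "c > 0" for c
  proof (rule antisym)
    have "minkowski K ((1 / c) *\<^sub>R (c *\<^sub>R z)) \<le> 1 / c * minkowski K (c *\<^sub>R z)"
      using z c V by (intro minkowski_scale_le) (auto simp: subspace_scale)
    then show "c * minkowski K z \<le> minkowski K (c *\<^sub>R z)" using c by (simp add: field_simps)
  qed (rule minkowski_scale_le[OF z c])
  have zero: "minkowski K 0 = 0"
  proof (rule antisym)
    show "minkowski K 0 \<le> 0"
    proof (rule field_le_epsilon)
      fix e :: real assume "e > 0"
      then show "minkowski K 0 \<le> 0 + e" using minkowski_zero_mem by (simp add: minkowski_leI)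
    qed
  qed (rule minkowski_nonneg[OF subspace_0[OF V]])
  have "- x \<in> K \<longleftrightarrow> x \<in> K" for x using sym[of x] sym[of "- x"] by auto
  then have neg: "minkowski K (- w) = minkowski K w" for w by (simp add: minkowski_def)
  show "minkowski K (c *\<^sub>R z) = \<bar>c\<bar> * minkowski K z" for c
  proof (cases "c = 0")
    case False
    then show ?thesis
      using pos[of c] pos[of "- c"] neg[of "c *\<^sub>R z"] by (cases "c > 0") auto
  qed (simp add: zero)
  show "z = 0" if "minkowski K z = 0"
  proof (rule bounded[OF z])
    fix s :: real assume "0 < s"
    then show "s *\<^sub>R z \<in> K" using minkowski_lessD(2)[OF z, of "1 / s"] that by simp
  qed
  fix y assume y: "y \<in> V"
  show "minkowski K (z + y) \<le> minkowski K z + minkowski K y"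
  proof (rule field_le_epsilon)
    fix e :: real assume e: "e > 0"
    define s t where "s = minkowski K z + e / 2" and "t = minkowski K y + e / 2"
    have s: "s > 0" "(1 / s) *\<^sub>R z \<in> K" and t: "t > 0" "(1 / t) *\<^sub>R y \<in> K"
      using minkowski_lessD[OF z, of s] minkowski_lessD[OF y, of t] e by (auto simp: s_def t_def)
    have "(s / (s + t)) *\<^sub>R ((1 / s) *\<^sub>R z) + (1 - s / (s + t)) *\<^sub>R ((1 / t) *\<^sub>R y) \<in> K"
      using s t by (intro conv) auto
    moreover have "1 - s / (s + t) = t / (s + t)" using s t by (simp add: field_simps)
    ultimately have "(1 / (s + t)) *\<^sub>R (z + y) \<in> K" using s t by (simp add: scaleR_add_right)
    then have "minkowski K (z + y) \<le> s + t" using s t by (intro minkowski_leI) auto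
    then show "minkowski K (z + y) \<le> minkowski K z + minkowski K y + e" by (simp add: s_def t_def)
  qed
qed

end

text \<open>Implicit differentiation: near \<open>z\<close> the unit ball of \<open>M\<close>
  contains the set \<open>P \<le> 1\<close>, and \<open>D z > 0\<close> says that the ray crosses
  its boundary transversally. Rescaling gives the upper estimate, convexity of \<open>M\<close> the
  lower one.\<close>

lemma minkowski_fdiff:
  fixes V :: "'v::real_vector set"
  assumes sn: "seminorm_on V \<nu>" and sM: "seminorm_on V M" and M\<nu>: "\<And>x. x \<in> V \<Longrightarrow> M x \<le> C * \<nu> x"
    and z: "z \<in> V" "M z = 1" and P: "fdiff V \<nu> P z D" "P z = 1" "D z > 0"
    and loc: "d0 > 0" "\<And>w. w \<in> V \<Longrightarrow> \<nu> (w - z) < d0 \<Longrightarrow> P w \<le> 1 \<Longrightarrow> M w \<le> 1"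
  shows "fdiff V \<nu> M z (\<lambda>h. D h / D z)"
proof -
  have D: "blf V \<nu> D" using fdiff_blf[OF sn P(1)] .
  obtain K where K: "K > 0" "\<And>x. x \<in> V \<Longrightarrow> \<bar>D x\<bar> \<le> K * \<nu> x" using blf_bound[OF sn D] by blast
  have upper: "\<exists>d>0. \<forall>h\<in>V. \<nu> h < d \<longrightarrow> M (z + h) \<le> 1 + D h / D z + e * \<nu> h" if e: "e > 0" for e
  proof -
    \<comment> \<open>\<open>K1 * \<nu> h\<close> bounds the displacement from \<open>z\<close>
      after rescaling \<open>z + h\<close>; the factor 2 bounds \<open>1 / s\<close>. The constant
      \<open>e1\<close> is chosen so that the remainder of \<open>P\<close> is covered by the
      guaranteed drop of its linear part.\<close>
    define K1 where "K1 = 2 * (1 + (K / D z + e) * \<nu> z)"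
    have nz: "\<nu> z \<ge> 0" using sn_nonneg[OF sn z(1)] .
    have K1: "K1 > 0" using K e P(3) nz unfolding K1_def by (intro mult_pos_pos add_pos_nonneg mult_nonneg_nonneg) auto
    define e1 where "e1 = e * D z / (2 * K1)"
    have e1: "e1 > 0" using e P(3) K1 by (simp add: e1_def)
    obtain d1 where d1: "d1 > 0" "\<And>h. h \<in> V \<Longrightarrow> \<nu> h < d1 \<Longrightarrow> \<bar>P (z + h) - P z - D h\<bar> \<le> e1 * \<nu> h"
      using fdiffE[OF sn P(1) e1] by blast
    define d2 where "d2 = min d1 d0 / K1"
    define d3 where "d3 = 1 / (2 * (K / D z + e))"
    have Ke: "K / D z + e > 0" using K e P(3) by (simp add: add_pos_pos)
    have "M (z + h) \<le> 1 + D h / D z + e * \<nu> h" if h: "h \<in> V" and hd: "\<nu> h < min d2 d3" for h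
    proof -
      have nh: "\<nu> h \<ge> 0" using sn_nonneg[OF sn h] .
      \<comment> \<open>Slightly more than the first-order prediction of \<open>M (z + h)\<close>:
        dividing by \<open>s\<close> lands in \<open>P \<le> 1\<close>, where
        \<open>M \<le> 1\<close> is known.\<close>
      define s where "s = 1 + D h / D z + e * \<nu> h"
      have "\<bar>D h / D z\<bar> \<le> K / D z * \<nu> h" using K(2)[OF h] P(3) by (simp add: field_simps abs_mult)
      moreover have "s - 1 = D h / D z + e * \<nu> h" "0 \<le> e * \<nu> h" using e nh by (simp_all add: s_def)
      ultimately have s1: "\<bar>s - 1\<bar> \<le> (K / D z + e) * \<nu> h" unfolding distrib_right by linarith
      also have "\<dots> \<le> (K / D z + e) * d3" using hd Ke by (intro mult_left_mono) auto
      also have "\<dots> = 1 / 2" using Ke by (simp add: d3_def)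
      finally have "\<bar>s - 1\<bar> \<le> 1 / 2" .
      then have s2: "s \<ge> 1 / 2" by linarith
      let ?h = "(1 / s) *\<^sub>R (h - (s - 1) *\<^sub>R z)"
      let ?w = "(1 / s) *\<^sub>R (z + h)"
      have hV: "?h \<in> V" "?w \<in> V" using sn_mem[OF sn] h z by auto
      have w: "?w = z + ?h"
      proof -
        have "z + ?h = (1 / s) *\<^sub>R (s *\<^sub>R z + (h - (s - 1) *\<^sub>R z))" using s2 by (simp add: scaleR_add_right)
        also have "s *\<^sub>R z + (h - (s - 1) *\<^sub>R z) = z + h" by (simp add: algebra_simps)
        finally show ?thesis by simp
      qed
      have "\<nu> ?h = \<nu> (h - (s - 1) *\<^sub>R z) / s" using sn_scale[OF sn, of "h - (s - 1) *\<^sub>R z" "1 / s"] sn_mem[OF sn] h z s2 by simp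
      also have "\<dots> \<le> \<nu> (h - (s - 1) *\<^sub>R z) * 2"
        using s2 sn_nonneg[OF sn, of "h - (s - 1) *\<^sub>R z"] sn_mem[OF sn] h z
        by (simp add: divide_le_eq mult_le_cancel_left1 mult.assoc)
      also have "\<nu> (h - (s - 1) *\<^sub>R z) \<le> \<nu> h + \<bar>s - 1\<bar> * \<nu> z"
        using sn_diff[OF sn h, of "(s - 1) *\<^sub>R z"] sn_scale[OF sn z(1)] sn_mem[OF sn] z by simp
      also have "\<bar>s - 1\<bar> * \<nu> z \<le> (K / D z + e) * \<nu> h * \<nu> z" using s1 nz by (rule mult_right_mono)
      finally have nb: "\<nu> ?h \<le> K1 * \<nu> h" by (simp add: K1_def algebra_simps)
      also have "\<dots> < K1 * d2" using hd K1 by simp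
      finally have nb2: "\<nu> ?h < d1" "\<nu> ?h < d0" using K1 by (auto simp: d2_def)
      have "D ?h = (D h - (s - 1) * D z) / s"
        using blf_scale[OF sn D, of "h - (s - 1) *\<^sub>R z" "1 / s"] blf_diff[OF sn D h, of "(s - 1) *\<^sub>R z"]
          blf_scale[OF sn D z(1)] sn_mem[OF sn] h z by simp
      also have "\<dots> = - (e * \<nu> h * D z) / s" using P(3) by (simp add: s_def field_simps)
      finally have Dh: "D ?h = - (e * \<nu> h * D z) / s" .
      have sle: "s \<le> 2" using s1 \<open>(K / D z + e) * \<nu> h \<le> (K / D z + e) * d3\<close> \<open>(K / D z + e) * d3 = 1 / 2\<close> by linarith
      have "(e * \<nu> h * D z) / 2 \<le> (e * \<nu> h * D z) / s" using s2 sle e nh P(3) by (intro divide_left_mono) auto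
      then have Dle: "D ?h \<le> - (e * \<nu> h * D z) / 2" using Dh by simp
      have "P ?w \<le> P z + D ?h + e1 * \<nu> ?h" using d1(2)[OF hV(1) nb2(1)] unfolding w by (simp add: abs_le_iff)
      also have "e1 * \<nu> ?h \<le> e1 * (K1 * \<nu> h)" using nb e1 by (intro mult_left_mono) auto
      also have "e1 * (K1 * \<nu> h) = e * \<nu> h * D z / 2" using K1 by (simp add: e1_def)
      finally have "P ?w \<le> 1" using Dle P(2) by simp
      then have "M ?w \<le> 1" using loc(2)[OF hV(2)] nb2(2) unfolding w by simp
      moreover have "M ?w = M (z + h) / s" using sn_scale[OF sM sn_mem(2)[OF sn z(1) h], of "1 / s"] s2 by simp
      ultimately have "M (z + h) / s \<le> 1" by simp
      then have "M (z + h) \<le> s" using s2 by (simp add: divide_le_eq_1)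
      then show ?thesis by (simp add: s_def)
    qed
    then show ?thesis using d1 K1 Ke loc(1) by (intro exI[of _ "min d2 d3"]) (auto simp: d2_def d3_def)
  qed
  show ?thesis unfolding fdiff_def
  proof (intro conjI allI impI)
    show "blf V \<nu> (\<lambda>h. D h / D z)" using blf_cmul[OF sn D, of "1 / D z"] by simp
    fix e :: real assume e: "e > 0"
    obtain d where d: "d > 0" "\<And>h. h \<in> V \<Longrightarrow> \<nu> h < d \<Longrightarrow> M (z + h) \<le> 1 + D h / D z + e * \<nu> h" using upper[OF e] by blast
    have "\<bar>M (z + h) - M z - D h / D z\<bar> \<le> e * \<nu> h" if h: "h \<in> V" "\<nu> h < d" for h
    proof -
      have m: "z + h \<in> V" "z - h \<in> V" "- h \<in> V" using sn_mem[OF sn] h z by auto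
      \<comment> \<open>Convexity turns the upper bound at \<open>- h\<close> into the lower bound
        at \<open>h\<close>.\<close>
      have "M (z - h) \<le> 1 - D h / D z + e * \<nu> h"
        using d(2)[OF m(3)] sn_neg[OF sn h(1)] h(2) blf_neg[OF sn D h(1)] by simp
      moreover have "M ((z + h) + (z - h)) = 2" using sn_scale[OF sM z(1), of 2] z(2) by (simp add: scaleR_2)
      moreover have "M ((z + h) + (z - h)) \<le> M (z + h) + M (z - h)" by (rule sn_tri[OF sM m(1,2)])
      ultimately show ?thesis using d(2)[OF h] z(2) by (simp add: abs_le_iff)
    qed
    then show "\<exists>d>0. \<forall>h\<in>V. \<nu> h < d \<longrightarrow> \<bar>M (z + h) - M z - D h / D z\<bar> \<le> e * \<nu> h" using d(1) by blast
  qed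
qed

section \<open>Sums of squares, positive parts and even powers\<close>

lemma seminorm_sqrt_sum:
  assumes p: "seminorm_on V p" and q: "seminorm_on V q"
  shows "seminorm_on V (\<lambda>z. sqrt ((p z)\<^sup>2 + (q z)\<^sup>2))"
  unfolding seminorm_on_def
proof (intro conjI allI ballI)
  show "subspace V" using p by (simp add: seminorm_on_def)
  fix z assume z: "z \<in> V"
  show "sqrt ((p (c *\<^sub>R z))\<^sup>2 + (q (c *\<^sub>R z))\<^sup>2) = \<bar>c\<bar> * sqrt ((p z)\<^sup>2 + (q z)\<^sup>2)" for c
    using sn_scale[OF p z, of c] sn_scale[OF q z, of c]
    by (simp add: power_mult_distrib distrib_left[symmetric] real_sqrt_mult del: real_sqrt_eq_iff)
  fix y assume y: "y \<in> V"
  have "sqrt ((p (z + y))\<^sup>2 + (q (z + y))\<^sup>2) \<le> sqrt ((p z + p y)\<^sup>2 + (q z + q y)\<^sup>2)"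
    using sn_tri[OF p z y] sn_tri[OF q z y] sn_nonneg[OF p sn_mem(2)[OF p z y]] sn_nonneg[OF q sn_mem(2)[OF p z y]]
    by (intro real_sqrt_le_mono add_mono power_mono) auto
  also have "\<dots> \<le> sqrt ((p z)\<^sup>2 + (q z)\<^sup>2) + sqrt ((p y)\<^sup>2 + (q y)\<^sup>2)"
    by (rule real_sqrt_sum_squares_triangle_ineq)
  finally show "sqrt ((p (z + y))\<^sup>2 + (q (z + y))\<^sup>2) \<le> sqrt ((p z)\<^sup>2 + (q z)\<^sup>2) + sqrt ((p y)\<^sup>2 + (q y)\<^sup>2)" .
qed

lemma l2_triangle:
  fixes a b :: "nat \<Rightarrow> real"
  assumes a: "summable (\<lambda>c. (a c)\<^sup>2)" and b: "summable (\<lambda>c. (b c)\<^sup>2)"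
  shows "summable (\<lambda>c. (a c + b c)\<^sup>2)" "sqrt (\<Sum>c. (a c + b c)\<^sup>2) \<le> sqrt (\<Sum>c. (a c)\<^sup>2) + sqrt (\<Sum>c. (b c)\<^sup>2)"
proof -
  let ?R = "sqrt (\<Sum>c. (a c)\<^sup>2) + sqrt (\<Sum>c. (b c)\<^sup>2)"
  have R: "?R \<ge> 0" using a b by (simp add: suminf_nonneg)
  have part: "(\<Sum>c<n. (a c + b c)\<^sup>2) \<le> ?R\<^sup>2" for n
  proof -
    have "sqrt (\<Sum>c<n. (a c + b c)\<^sup>2) \<le> sqrt (\<Sum>c<n. (a c)\<^sup>2) + sqrt (\<Sum>c<n. (b c)\<^sup>2)"
      using L2_set_triangle_ineq[of a b "{..<n}"] by (simp add: L2_set_def)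
    also have "\<dots> \<le> ?R" using a b by (intro add_mono real_sqrt_le_mono sum_le_suminf) auto
    finally show ?thesis using R by (simp add: real_le_lsqrt sqrt_le_D)
  qed
  show s: "summable (\<lambda>c. (a c + b c)\<^sup>2)"
    by (rule bounded_imp_summable[where B="?R\<^sup>2"]) (use part[of "Suc _"] in \<open>auto simp: lessThan_Suc_atMost\<close>)
  have "(\<Sum>c. (a c + b c)\<^sup>2) \<le> ?R\<^sup>2" by (rule suminf_le_const[OF s part])
  then show "sqrt (\<Sum>c. (a c + b c)\<^sup>2) \<le> ?R" using R by (simp add: real_le_lsqrt)
qed

lemma DERIV_pos_part_square: "((\<lambda>s::real. (max 0 s)\<^sup>2) has_real_derivative 2 * max 0 x) (at x)"
proof -
  consider "x < 0" | "x > 0" | "x = 0" by linarith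
  then show ?thesis
  proof cases
    case 1
    have "((\<lambda>s::real. 0) has_real_derivative 2 * max 0 x) (at x)" using 1 by simp
    then show ?thesis by (rule has_field_derivative_transform_within_open[where S="{..<0}"]) (use 1 in auto)
  next
    case 2
    have "((\<lambda>s::real. s\<^sup>2) has_real_derivative 2 * max 0 x) (at x)" using 2 by (auto intro!: derivative_eq_intros)
    then show ?thesis by (rule has_field_derivative_transform_within_open[where S="{0<..}"]) (use 2 in auto)
  next
    case 3
    have "((\<lambda>h. (max 0 (0 + h))\<^sup>2 / h) \<longlongrightarrow> 0) (at (0::real))"
    proof (rule Lim_null_comparison)
      show "\<forall>\<^sub>F h in at (0::real). norm ((max 0 (0 + h))\<^sup>2 / h) \<le> \<bar>h\<bar>"
        by (intro always_eventually allI) (auto simp: max_def power2_eq_square)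
    qed (auto intro!: tendsto_eq_intros)
    then show ?thesis using 3 by (simp add: DERIV_def)
  qed
qed

lemma pos_part_square_mono: "s \<le> t \<Longrightarrow> (max 0 s)\<^sup>2 \<le> (max 0 (t::real))\<^sup>2"
  by (intro power_mono) auto

lemma power2_convex_ineq: fixes s t u :: real assumes "0 \<le> u" "u \<le> 1"
  shows "(u * s + (1 - u) * t)\<^sup>2 \<le> u * s\<^sup>2 + (1 - u) * t\<^sup>2"
proof -
  have "u * s\<^sup>2 + (1 - u) * t\<^sup>2 - (u * s + (1 - u) * t)\<^sup>2 = u * (1 - u) * (s - t)\<^sup>2" by (simp add: power2_eq_square algebra_simps)
  moreover have "0 \<le> u * (1 - u) * (s - t)\<^sup>2" using assms by simp
  ultimately show ?thesis by linarith
qed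

lemma pos_part_square_convex: fixes s t u :: real assumes u: "0 \<le> u" "u \<le> 1"
  shows "(max 0 (u * s + (1 - u) * t))\<^sup>2 \<le> u * (max 0 s)\<^sup>2 + (1 - u) * (max 0 t)\<^sup>2"
proof -
  have "u * s + (1 - u) * t \<le> u * max 0 s + (1 - u) * max 0 t" using u by (intro add_mono mult_left_mono) auto
  then have "max 0 (u * s + (1 - u) * t) \<le> u * max 0 s + (1 - u) * max 0 t" using u by simp
  then have "(max 0 (u * s + (1 - u) * t))\<^sup>2 \<le> (u * max 0 s + (1 - u) * max 0 t)\<^sup>2" by (intro power_mono) auto
  also have "\<dots> \<le> u * (max 0 s)\<^sup>2 + (1 - u) * (max 0 t)\<^sup>2" by (rule power2_convex_ineq[OF u])
  finally show ?thesis .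
qed

text \<open>Here \<open>m\<close> stands for the value of a convex function at the midpoint of two
  points with values \<open>s\<close> and \<open>t\<close>. Positivity of \<open>m\<close> keeps
  away from the flat part of the squared positive part, where equality would say nothing.\<close>

lemma pos_part_square_strict:
  fixes s t m :: real
  assumes m: "m \<le> (s + t) / 2" and pos: "0 < m" and eq: "2 * (max 0 m)\<^sup>2 \<ge> (max 0 s)\<^sup>2 + (max 0 t)\<^sup>2"
  shows "s = t" "m = s"
proof -
  let ?s = "max 0 s" and ?t = "max 0 t"
  have "2 * m \<le> ?s + ?t" using m by auto
  then have "(2 * m)\<^sup>2 \<le> (?s + ?t)\<^sup>2" using pos by (intro power_mono) auto
  moreover have "2 * m\<^sup>2 \<ge> ?s\<^sup>2 + ?t\<^sup>2" using eq pos by simp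
  ultimately have "(?s - ?t)\<^sup>2 \<le> 0" by (simp add: power2_eq_square algebra_simps)
  then have e: "?s = ?t" by simp
  then have "?s > 0" using m pos by (auto simp: max_def split: if_splits)
  then show st: "s = t" using e by (auto simp: max_def split: if_splits)
  have "max 0 m = m" "max 0 s = s" using pos \<open>?s > 0\<close> by (auto simp: max_def split: if_splits)
  then have "m\<^sup>2 \<ge> s\<^sup>2" using eq st by simp
  then have "m \<ge> s" by (rule power2_le_imp_le) (use pos in simp)
  then show "m = s" using m st by simp
qed

lemma even_power_convex: fixes s t u :: real assumes u: "0 \<le> u" "u \<le> 1"
  shows "(u * s + (1 - u) * t) ^ (2 * q) \<le> u * s ^ (2 * q) + (1 - u) * t ^ (2 * q)"
proof -
  have "convex_on UNIV (\<lambda>x::real. x ^ (2 * q))" by (rule convex_power_even) simp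
  from convex_onD[OF this, of "1 - u" s t] u show ?thesis by simp
qed

text \<open>Splitting the power into a square followed by a \<open>q\<close>-th power reduces
  equality to the case of squares.\<close>

lemma even_power_strict: fixes s t :: real assumes q: "q > 0"
  and eq: "2 * ((s + t) / 2) ^ (2 * q) \<ge> s ^ (2 * q) + t ^ (2 * q)" shows "s = t"
proof -
  have 1: "((s + t) / 2)\<^sup>2 \<le> (s\<^sup>2 + t\<^sup>2) / 2" using power2_convex_ineq[of "1/2" s t] by (simp add: field_simps)
  have 2: "((s\<^sup>2 + t\<^sup>2) / 2) ^ q \<le> ((s\<^sup>2) ^ q + (t\<^sup>2) ^ q) / 2"
  proof -
    have "convex_on {0..} (\<lambda>x::real. x ^ q)" using convex_power_odd[of q] convex_on_subset[OF convex_power_even[of q]] by (cases "even q") auto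
    from convex_onD[OF this, of "1/2" "s\<^sup>2" "t\<^sup>2"] show ?thesis by (simp add: field_simps)
  qed
  have "((s\<^sup>2) ^ q + (t\<^sup>2) ^ q) / 2 \<le> (((s + t) / 2)\<^sup>2) ^ q" using eq by (simp add: power_mult)
  with 2 have "((s\<^sup>2 + t\<^sup>2) / 2) ^ q \<le> (((s + t) / 2)\<^sup>2) ^ q" by simp
  then have "(s\<^sup>2 + t\<^sup>2) / 2 \<le> ((s + t) / 2)\<^sup>2" using q by (subst (asm) power_mono_iff) auto
  then have "(s - t)\<^sup>2 \<le> 0" by (simp add: power2_eq_square field_simps)
  then show ?thesis by simp
qed

text \<open>The standard device for rotundity: these defects are nonnegative, add up when squared
  norms are added, and control differences of norms.\<close>

lemma parallelogram_defect:
  fixes p pk ps :: real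
  assumes "0 \<le> ps" "ps \<le> p + pk" shows "(p - pk)\<^sup>2 \<le> 2 * p\<^sup>2 + 2 * pk\<^sup>2 - ps\<^sup>2"
proof -
  have "ps\<^sup>2 \<le> (p + pk)\<^sup>2" using assms by (intro power_mono)
  then show ?thesis by (simp add: power2_eq_square algebra_simps)
qed

text \<open>Turns a vanishing defect into the two limits that \<open>lur_on\<close> asks
  for.\<close>

lemma defect_limit:
  fixes p :: real
  assumes "\<And>k. 0 \<le> ps k" "\<And>k. ps k \<le> p + pk k" "0 \<le> p"
    and lim: "(\<lambda>k. 2 * p\<^sup>2 + 2 * (pk k)\<^sup>2 - (ps k)\<^sup>2) \<longlonglongrightarrow> 0"
  shows "pk \<longlonglongrightarrow> p" "ps \<longlonglongrightarrow> 2 * p"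
proof -
  have "(\<lambda>k. (p - pk k)\<^sup>2) \<longlonglongrightarrow> 0"
    by (rule tendsto_sandwich[OF _ _ tendsto_const lim]) (use parallelogram_defect assms in auto)
  then have "(\<lambda>k. sqrt ((p - pk k)\<^sup>2)) \<longlonglongrightarrow> sqrt 0" by (rule tendsto_real_sqrt)
  then have "(\<lambda>k. p - pk k) \<longlonglongrightarrow> 0" by (simp add: tendsto_rabs_zero_iff)
  from tendsto_diff[OF tendsto_const this, of p] show pk: "pk \<longlonglongrightarrow> p" by simp
  have "(\<lambda>k. (2 * p\<^sup>2 + 2 * (pk k)\<^sup>2) - (2 * p\<^sup>2 + 2 * (pk k)\<^sup>2 - (ps k)\<^sup>2)) \<longlonglongrightarrow> (2 * p\<^sup>2 + 2 * p\<^sup>2) - 0"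
    by (intro tendsto_intros lim pk)
  then have "(\<lambda>k. (ps k)\<^sup>2) \<longlonglongrightarrow> (2 * p)\<^sup>2" by (simp add: power_mult_distrib)
  then have "(\<lambda>k. sqrt ((ps k)\<^sup>2)) \<longlonglongrightarrow> sqrt ((2 * p)\<^sup>2)" by (rule tendsto_real_sqrt)
  moreover have "sqrt ((ps k)\<^sup>2) = ps k" "sqrt ((2 * p)\<^sup>2) = 2 * p" for k
    using assms(1,3) by (auto intro: real_sqrt_unique)
  ultimately show "ps \<longlonglongrightarrow> 2 * p" by (simp only:)
qed

section \<open>Rows of a sequence and finite sup norms\<close>

definition slice :: "nat \<Rightarrow> (nat \<Rightarrow> real) \<Rightarrow> nat \<Rightarrow> real" where
  "slice c z = (\<lambda>i. z (prod_encode (c, i)))"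

definition put :: "nat \<Rightarrow> (nat \<Rightarrow> real) \<Rightarrow> nat \<Rightarrow> real" where
  "put c y = (\<lambda>j. if fst (prod_decode j) = c then y (snd (prod_decode j)) else 0)"

lemma slice_put [simp]: "slice c (put d y) = (if c = d then y else 0)"
  by (auto simp: slice_def put_def fun_eq_iff)

lemma slice_linear [simp]: "slice c (x + y) = slice c x + slice c y" "slice c (x - y) = slice c x - slice c y"
  "slice c (t *\<^sub>R x) = t *\<^sub>R slice c x" "slice c 0 = 0" "slice c (- x) = - slice c x"
  by (auto simp: slice_def fun_eq_iff)

lemma put_linear [simp]: "put c (x + y) = put c x + put c y" "put c (x - y) = put c x - put c y"
  "put c (t *\<^sub>R x) = t *\<^sub>R put c x" "put c 0 = 0"
  by (auto simp: put_def fun_eq_iff)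

lemma slice_ext: "(\<And>c. slice c x = slice c y) \<Longrightarrow> x = y"
  by (metis (no_types) ext prod_decode_inverse slice_def surj_pair)

definition msup :: "nat \<Rightarrow> (nat \<Rightarrow> real) \<Rightarrow> real" where
  "msup k v = Max (insert 0 ((\<lambda>i. \<bar>v i\<bar>) ` {..<k}))"

lemma msup_upper: "i < k \<Longrightarrow> \<bar>v i\<bar> \<le> msup k v" and msup_nonneg: "0 \<le> msup k v"
  by (auto simp: msup_def)

lemma msup_least: "0 \<le> t \<Longrightarrow> (\<And>i. i < k \<Longrightarrow> \<bar>v i\<bar> \<le> t) \<Longrightarrow> msup k v \<le> t"
  by (auto simp: msup_def)

lemma msup_mono: "k \<le> k' \<Longrightarrow> msup k v \<le> msup k' v"
  by (rule msup_least) (auto intro: msup_nonneg msup_upper)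

lemma msup_add: "msup k (v + w) \<le> msup k v + msup k w"
proof (rule msup_least)
  show "\<bar>(v + w) i\<bar> \<le> msup k v + msup k w" if "i < k" for i
    using msup_upper[OF that, of v] msup_upper[OF that, of w] by (simp add: abs_le_iff)
qed (simp add: msup_nonneg)

lemma msup_scale: "msup k (c *\<^sub>R v) = \<bar>c\<bar> * msup k v"
proof (rule antisym)
  show "msup k (c *\<^sub>R v) \<le> \<bar>c\<bar> * msup k v"
    by (rule msup_least) (auto simp: msup_nonneg abs_mult intro!: mult_left_mono msup_upper)
  show "\<bar>c\<bar> * msup k v \<le> msup k (c *\<^sub>R v)"
  proof (cases "c = 0")
    case False
    have "msup k v \<le> msup k (c *\<^sub>R v) / \<bar>c\<bar>"
    proof (rule msup_least)
      show "\<bar>v i\<bar> \<le> msup k (c *\<^sub>R v) / \<bar>c\<bar>" if "i < k" for i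
        using msup_upper[OF that, of "c *\<^sub>R v"] False by (simp add: abs_mult field_simps)
    qed (simp add: msup_nonneg)
    then show ?thesis using False by (simp add: field_simps)
  qed (simp add: msup_nonneg)
qed

definition supported :: "nat \<Rightarrow> (nat \<Rightarrow> real) set" where
  "supported k = {v. \<forall>i\<ge>k. v i = 0}"

lemma subspace_supported: "subspace (supported k)"
  by (auto simp: subspace_def supported_def)

lemma msup_eq_0: "v \<in> supported k \<Longrightarrow> msup k v = 0 \<Longrightarrow> v = 0"
proof (rule ext)
  fix i assume "v \<in> supported k" "msup k v = 0"
  then show "v i = 0 i" using msup_upper[of i k v] by (cases "i < k") (auto simp: supported_def)
qed

section \<open>Amalgamating countably many good spaces\<close>

text \<open>Comparison on the unit ball by scaling. Since \<open>p z\<close> may vanish,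
  \<open>z\<close> is divided by a slightly larger \<open>t\<close>, whose surplus costs at most
  \<open>e\<close>.\<close>

lemma seminorm_le_from_unit:
  fixes V :: "'v::real_vector set"
  assumes p: "seminorm_on V p" and pq: "seminorm_on V p'" and u: "\<And>z. z \<in> V \<Longrightarrow> p z \<le> 1 \<Longrightarrow> p' z \<le> C" and z: "z \<in> V"
  shows "p' z \<le> C * p z"
proof (rule field_le_epsilon)
  fix e :: real assume e: "e > 0"
  have C: "C \<ge> 0" using u[OF sn_mem(1)[OF p]] sn_zero[OF p] sn_zero[OF pq] by simp
  define t where "t = p z + e / (C + 1)"
  have t: "t > 0" using sn_nonneg[OF p z] e C by (simp add: t_def add_nonneg_pos)
  have "p ((1 / t) *\<^sub>R z) \<le> 1" using sn_scale[OF p z, of "1 / t"] t e C by (simp add: t_def)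
  from u[OF sn_mem(3)[OF p z] this] have "p' z \<le> C * t" using sn_scale[OF pq z, of "1 / t"] t by (simp add: field_simps)
  also have "\<dots> \<le> C * p z + e"
  proof -
    have "C * (e / (C + 1)) \<le> e" using C e by (simp add: field_simps)
    then show ?thesis by (simp add: t_def distrib_left)
  qed
  finally show "p' z \<le> C * p z + e" .
qed

text \<open>Row \<open>0\<close> of a sequence carries \<open>k\<close> common coordinates, and row \<open>c + 1\<close> an element of the \<open>c\<close>-th
  space, which itself carries \<open>k'\<close> common coordinates in its row \<open>0\<close>; \<open>r\<close> tells which old coordinate
  approximates each new one. Indices outside \<open>I\<close> are fillers with the zero space.\<close>

locale amalgam =
  fixes Vc :: "nat \<Rightarrow> (nat \<Rightarrow> real) set" and b :: "nat \<Rightarrow> (nat \<Rightarrow> real) \<Rightarrow> real"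
    and I :: "nat set" and k k' :: nat and r :: "nat \<Rightarrow> nat" and A' B' B \<theta> \<delta> \<gamma> :: real and q :: nat
  assumes good: "\<And>c. good (Vc c) (b c)"
    and lower: "\<And>c y. y \<in> Vc c \<Longrightarrow> B' * msup k' (slice 0 y) \<le> b c y"
    and upper: "\<And>c w. c \<in> I \<Longrightarrow> w \<in> supported k' \<Longrightarrow> put 0 w \<in> Vc c \<and> b c (put 0 w) \<le> A' * msup k' w"
    and triv: "\<And>c. c \<notin> I \<Longrightarrow> Vc c \<subseteq> {0}"
    and kk: "k \<le> k'" and r_less: "\<And>j. j < k' \<Longrightarrow> r j < k" and r_id: "\<And>j. j < k \<Longrightarrow> r j = j"
    and pos: "0 < B" "B < B'" "B' < A'" "0 < \<theta>" "\<theta> < 1" "0 < \<delta>" "0 < \<gamma>" "0 < q"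
    and kq: "real k * (B * (1 + \<gamma>) * sqrt (1 + \<delta>)) ^ (2 * q) \<le> B' ^ (2 * q)"
begin

text \<open>The factor \<open>1 + \<gamma>\<close> pays for \<open>K\<close> forcing only
  \<open>lam \<le> 1 + \<gamma>\<close>, and \<open>sqrt (1 + \<delta>)\<close> pays for the
  normalisation in \<open>N\<close>; what remains is the lower bound \<open>B\<close>.\<close>

definition "a = B * (1 + \<gamma>) * sqrt (1 + \<delta>)"

definition "ext w = (\<lambda>j. if j < k' then w (r j) else 0 :: real)" for w

definition "T c w = (if c \<in> I then put 0 (ext w) else 0)" for c w

text \<open>The gauge \<open>M\<close> of the set \<open>K\<close> below is controlled by the common coordinates and the values \<open>b c (L c z)\<close>. The map
  \<open>L c\<close> inverts the embedding \<open>J c\<close> of the \<open>c\<close>-th space; on the other embedded spaces it only sees the common part,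
  with norm below \<open>\<theta>\<close> on \<open>K\<close>. Since \<open>b c (L c z) \<le> \<theta>\<close> costs nothing in \<open>Ps\<close>, only finitely many terms are active
  near a given point, which gives smoothness.\<close>

definition "L c z = slice (Suc c) z + (\<theta> * B / A') *\<^sub>R T c (slice 0 z - slice 0 (slice (Suc c) z))" for c z

definition "V = {z. slice 0 z \<in> supported k \<and> (\<forall>c. slice (Suc c) z \<in> Vc c) \<and> summable (\<lambda>c. (b c (slice (Suc c) z))\<^sup>2)}"

definition "l z = sqrt (\<Sum>c. (b c (slice (Suc c) z))\<^sup>2)" for z

definition "\<nu> z = msup k (slice 0 z) + l z" for z

text \<open>For large \<open>q\<close> the set where this is at most 1 is nearly the ball of the sup
  norm with radius \<open>1 / a\<close>, but with a smooth and strictly convex boundary.\<close>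

definition "lam w = (\<Sum>i<k. (a * w i) ^ (2 * q))" for w :: "nat \<Rightarrow> real"

text \<open>The denominators are chosen so that \<open>lam = 1 + \<gamma>\<close> alone, or a single
  value \<open>b c (L c z) = 1\<close> alone, exhausts the budget 1. Bounding all partial sums in
  \<open>K\<close> avoids any appeal to summability.\<close>

definition "Ps m z = (max 0 (lam (slice 0 z) - 1))\<^sup>2 / \<gamma>\<^sup>2 + (\<Sum>c<m. (max 0 (b c (L c z) - \<theta>))\<^sup>2 / (1 - \<theta>)\<^sup>2)" for m z

definition "K = {z \<in> V. \<forall>m. Ps m z \<le> 1}"

definition "M = minkowski K"

text \<open>On the copy of the \<open>c\<close>-th space both \<open>M\<close> and \<open>l\<close>
  reproduce \<open>b c\<close>, so this weighted quadratic mean does as well;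
  \<open>\<delta>\<close> is the weight of the part that makes the rows rotund.\<close>

definition "N z = sqrt ((M z)\<^sup>2 + (sqrt \<delta> * l z)\<^sup>2) / sqrt (1 + \<delta>)" for z

section \<open>Linear structure and elementary bounds\<close>

lemma bsn: "seminorm_on (Vc c) (b c)" by (rule good_sn[OF good])

lemma b_eq_0: "y \<in> Vc c \<Longrightarrow> b c y = 0 \<Longrightarrow> y = 0"
  using good_norm[OF good, of c] by (auto simp: norm_on_def)

lemmas bmem = sn_mem[OF bsn]

lemma bnonneg: "y \<in> Vc c \<Longrightarrow> 0 \<le> b c y" by (rule sn_nonneg[OF bsn])

lemma apos: "a > 0" using pos by (simp add: a_def)

lemma ext_linear: "ext (x + y) = ext x + ext y" "ext (x - y) = ext x - ext y" "ext (s *\<^sub>R x) = s *\<^sub>R ext x" "ext 0 = 0"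
  by (auto simp: ext_def fun_eq_iff)

lemma ext_supported: "ext w \<in> supported k'" by (simp add: ext_def supported_def)

lemma msup_ext: "msup k' (ext w) \<le> msup k w"
  by (rule msup_least) (auto simp: ext_def msup_nonneg intro: msup_upper r_less)

lemma T_linear: "T c (x + y) = T c x + T c y" "T c (x - y) = T c x - T c y" "T c (s *\<^sub>R x) = s *\<^sub>R T c x" "T c 0 = 0"
  by (simp_all add: T_def ext_linear)

lemma T_neg: "T c (- x) = - T c x"
  using T_linear(2)[of c 0 x] T_linear(4)[of c] by simp

lemma T_mem: "T c w \<in> Vc c" and T_bound: "b c (T c w) \<le> A' * msup k w"
proof -
  have A: "A' * msup k' (ext w) \<le> A' * msup k w" using msup_ext pos by (intro mult_left_mono) auto
  show "T c w \<in> Vc c" using upper[OF _ ext_supported] bmem(1) by (simp add: T_def)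
  show "b c (T c w) \<le> A' * msup k w"
    using order_trans[OF conjunct2[OF upper[OF _ ext_supported]] A] sn_zero[OF bsn, of c] pos msup_nonneg[of k w] by (auto simp: T_def)
qed

lemma VD: "z \<in> V \<Longrightarrow> slice 0 z \<in> supported k" "z \<in> V \<Longrightarrow> slice (Suc c) z \<in> Vc c"
  "z \<in> V \<Longrightarrow> summable (\<lambda>c. (b c (slice (Suc c) z))\<^sup>2)"
  by (auto simp: V_def)

lemma V_add: assumes z: "z \<in> V" and w: "w \<in> V" shows "z + w \<in> V" "l (z + w) \<le> l z + l w"
proof -
  note t = l2_triangle[OF VD(3)[OF z] VD(3)[OF w]]
  have le: "(b c (slice (Suc c) (z + w)))\<^sup>2 \<le> (b c (slice (Suc c) z) + b c (slice (Suc c) w))\<^sup>2" for c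
    using sn_tri[OF bsn VD(2)[OF z] VD(2)[OF w]] bnonneg[OF bmem(2)[OF VD(2)[OF z] VD(2)[OF w]]]
    by (intro power_mono) auto
  have s: "summable (\<lambda>c. (b c (slice (Suc c) (z + w)))\<^sup>2)"
    by (rule summable_comparison_test'[OF t(1), of 0]) (use le in simp)
  show "z + w \<in> V" using s VD(1,2)[OF z] VD(1,2)[OF w] bmem(2) subspace_add[OF subspace_supported]
    by (simp add: V_def)
  have "l (z + w) \<le> sqrt (\<Sum>c. (b c (slice (Suc c) z) + b c (slice (Suc c) w))\<^sup>2)"
    unfolding l_def by (intro real_sqrt_le_mono suminf_le le s t(1))
  then show "l (z + w) \<le> l z + l w" using t(2) unfolding l_def by linarith
qed

lemma V_scale: assumes z: "z \<in> V" shows "t *\<^sub>R z \<in> V" "l (t *\<^sub>R z) = \<bar>t\<bar> * l z"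
proof -
  have e: "(b c (slice (Suc c) (t *\<^sub>R z)))\<^sup>2 = t\<^sup>2 * (b c (slice (Suc c) z))\<^sup>2" for c
    using sn_scale[OF bsn VD(2)[OF z], of c t] by (simp add: power_mult_distrib)
  show "t *\<^sub>R z \<in> V" unfolding V_def using e VD[OF z] bmem(3) subspace_scale[OF subspace_supported]
    by (auto simp del: slice_linear intro: summable_mult) (simp_all add: bmem(3) subspace_scale[OF subspace_supported])
  show "l (t *\<^sub>R z) = \<bar>t\<bar> * l z" unfolding l_def e
    by (simp add: suminf_mult[OF VD(3)[OF z]] real_sqrt_mult)
qed

lemma V_zero: "0 \<in> V" "l 0 = 0"
proof -
  have "b c 0 = 0" for c by (rule sn_zero[OF bsn])
  then show "0 \<in> V" "l 0 = 0" using bmem(1) subspace_0[OF subspace_supported] by (simp_all add: V_def l_def)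
qed

lemma Vsub: "subspace V" using V_zero(1) V_add(1) V_scale(1) by (simp add: subspace_def)

lemma lsn: "seminorm_on V l" using Vsub V_add(2) V_scale(2) by (simp add: seminorm_on_def)

lemmas Vmem = sn_mem[OF lsn]

lemma \<nu>sn: "seminorm_on V \<nu>"
  unfolding seminorm_on_def \<nu>_def
proof (intro conjI allI ballI Vsub)
  show "msup k (slice 0 (c *\<^sub>R x)) + l (c *\<^sub>R x) = \<bar>c\<bar> * (msup k (slice 0 x) + l x)" if "x \<in> V" for c x
    using V_scale(2)[OF that] by (simp add: msup_scale distrib_left)
  show "msup k (slice 0 (x + y)) + l (x + y) \<le> msup k (slice 0 x) + l x + (msup k (slice 0 y) + l y)" if "x \<in> V" "y \<in> V" for x y
    using V_add(2)[OF that] msup_add[of k "slice 0 x" "slice 0 y"] by simp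
qed

lemma lnonneg: "z \<in> V \<Longrightarrow> 0 \<le> l z" by (rule sn_nonneg[OF lsn])

lemma l_square: "z \<in> V \<Longrightarrow> (l z)\<^sup>2 = (\<Sum>c. (b c (slice (Suc c) z))\<^sup>2)"
  unfolding l_def by (simp add: suminf_nonneg VD(3))

lemma b_le_l: assumes z: "z \<in> V" shows "b c (slice (Suc c) z) \<le> l z"
proof -
  have "(\<Sum>i\<in>{c}. (b i (slice (Suc i) z))\<^sup>2) \<le> (\<Sum>c. (b c (slice (Suc c) z))\<^sup>2)"
    by (rule sum_le_suminf[OF VD(3)[OF z]]) auto
  then show ?thesis unfolding l_def by (simp add: real_le_rsqrt)
qed

lemma b_tendsto_0: assumes z: "z \<in> V" shows "(\<lambda>c. b c (slice (Suc c) z)) \<longlonglongrightarrow> 0"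
proof -
  have "(\<lambda>c. sqrt ((b c (slice (Suc c) z))\<^sup>2)) \<longlonglongrightarrow> sqrt 0"
    by (intro tendsto_real_sqrt summable_LIMSEQ_zero[OF VD(3)[OF z]])
  then show ?thesis using bnonneg[OF VD(2)[OF z]] by simp
qed

lemma L_linear: "L c (x + y) = L c x + L c y" "L c (x - y) = L c x - L c y" "L c (s *\<^sub>R x) = s *\<^sub>R L c x" "L c 0 = 0"
  by (simp_all add: L_def T_linear algebra_simps)

lemma L_neg: "L c (- x) = - L c x" using L_linear(2)[of c 0 x] L_linear(4) by simp

lemma L_mem: "z \<in> V \<Longrightarrow> L c z \<in> Vc c" unfolding L_def by (intro bmem VD T_mem)

text \<open>The correction inside \<open>L c\<close> shrinks by the factor
  \<open>\<theta> * B / B'\<close>, which is below 1 by \<open>\<theta>B\<close>. So a row can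
  cancel its own correction only if it is zero, which is the point behind
  \<open>K_bounded\<close>.\<close>

lemma T_bound': assumes y: "y \<in> Vc c" shows "(\<theta> * B / A') * b c (T c (slice 0 y)) \<le> (\<theta> * B / B') * b c y"
proof -
  have "(\<theta> * B / A') * b c (T c (slice 0 y)) \<le> (\<theta> * B / A') * (A' * msup k (slice 0 y))"
    using T_bound pos by (intro mult_left_mono) auto
  also have "\<dots> = \<theta> * B * msup k (slice 0 y)" using pos by simp
  also have "\<dots> \<le> \<theta> * B * (b c y / B')"
  proof -
    have "msup k (slice 0 y) \<le> msup k' (slice 0 y)" by (rule msup_mono[OF kk])
    also have "\<dots> \<le> b c y / B'" using lower[OF y] pos by (simp add: field_simps)
    finally show ?thesis using pos by (intro mult_left_mono) auto
  qed
  finally show ?thesis by simp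
qed

lemma \<theta>B: "0 < \<theta> * B / B'" "\<theta> * B / B' < 1"
proof -
  have "\<theta> * B < 1 * B" by (rule mult_strict_right_mono) (use pos in auto)
  then have "\<theta> * B < B'" using pos by linarith
  then show "\<theta> * B / B' < 1" using pos by (simp add: pos_divide_less_eq)
  show "0 < \<theta> * B / B'" using pos by simp
qed

text \<open>Row and common part contribute separately, the common part with a factor that keeps it
  below the threshold on \<open>K\<close>; this is what isolates finitely many active terms.\<close>

lemma L_bound: assumes z: "z \<in> V"
  shows "b c (L c z) \<le> 2 * b c (slice (Suc c) z) + \<theta> * B * msup k (slice 0 z)"
proof -
  let ?y = "slice (Suc c) z"
  define t where "t = \<theta> * B / A'"
  have y: "?y \<in> Vc c" using VD(2)[OF z] .
  have t: "t \<ge> 0" using pos by (simp add: t_def)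
  have "L c z = ?y + (t *\<^sub>R T c (slice 0 z) - t *\<^sub>R T c (slice 0 ?y))" by (simp add: L_def t_def T_linear scaleR_diff_right)
  then have "b c (L c z) \<le> b c ?y + b c (t *\<^sub>R T c (slice 0 z) - t *\<^sub>R T c (slice 0 ?y))"
    using sn_tri[OF bsn y] bmem T_mem by metis
  also have "b c (t *\<^sub>R T c (slice 0 z) - t *\<^sub>R T c (slice 0 ?y)) \<le> b c (t *\<^sub>R T c (slice 0 z)) + b c (t *\<^sub>R T c (slice 0 ?y))"
    by (intro sn_diff[OF bsn] bmem T_mem)
  also have "b c (t *\<^sub>R T c (slice 0 z)) = t * b c (T c (slice 0 z))" using sn_scale[OF bsn T_mem] t by simp
  also have "\<dots> \<le> t * (A' * msup k (slice 0 z))" using T_bound t by (rule mult_left_mono)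
  also have "\<dots> = \<theta> * B * msup k (slice 0 z)" using pos by (simp add: t_def)
  also have "b c (t *\<^sub>R T c (slice 0 ?y)) = t * b c (T c (slice 0 ?y))" using sn_scale[OF bsn T_mem] t by simp
  also have "\<dots> \<le> (\<theta> * B / B') * b c ?y" unfolding t_def by (rule T_bound'[OF y])
  also have "\<dots> \<le> 1 * b c ?y" using \<theta>B bnonneg[OF y] by (intro mult_right_mono) auto
  finally show ?thesis by simp
qed

lemma L_\<nu>: assumes z: "z \<in> V" shows "b c (L c z) \<le> (2 + \<theta> * B) * \<nu> z"
proof -
  have "b c (L c z) \<le> 2 * l z + \<theta> * B * msup k (slice 0 z)" using L_bound[OF z, of c] b_le_l[OF z, of c] by simp
  also have "\<dots> \<le> (2 + \<theta> * B) * l z + (2 + \<theta> * B) * msup k (slice 0 z)"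
    using lnonneg[OF z] msup_nonneg[of k "slice 0 z"] pos by (intro add_mono mult_right_mono) auto
  finally show ?thesis by (simp add: \<nu>_def distrib_left add.commute)
qed

section \<open>Convexity and geometry of the set \<open>K\<close>\<close>

lemma lam_scale: "lam (s *\<^sub>R w) = s ^ (2 * q) * lam w"
  by (simp add: lam_def sum_distrib_left power_mult_distrib mult_ac)

lemma lam_convex: assumes "0 \<le> u" "u \<le> 1" shows "lam (u *\<^sub>R x + (1 - u) *\<^sub>R y) \<le> u * lam x + (1 - u) * lam y"
proof -
  have "(a * (u * x i + (1 - u) * y i)) ^ (2 * q) \<le> u * (a * x i) ^ (2 * q) + (1 - u) * (a * y i) ^ (2 * q)" for i
    using even_power_convex[OF assms, of "a * x i" "a * y i" q] by (simp add: algebra_simps)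
  then have "lam (u *\<^sub>R x + (1 - u) *\<^sub>R y) \<le> (\<Sum>i<k. u * (a * x i) ^ (2 * q) + (1 - u) * (a * y i) ^ (2 * q))"
    unfolding lam_def by (intro sum_mono) simp
  then show ?thesis by (simp add: lam_def sum.distrib sum_distrib_left)
qed

lemma bL_convex: assumes "0 \<le> u" "u \<le> 1" "x \<in> V" "y \<in> V"
  shows "b c (L c (u *\<^sub>R x + (1 - u) *\<^sub>R y)) \<le> u * b c (L c x) + (1 - u) * b c (L c y)"
proof -
  have "b c (u *\<^sub>R L c x + (1 - u) *\<^sub>R L c y) \<le> b c (u *\<^sub>R L c x) + b c ((1 - u) *\<^sub>R L c y)"
    by (intro sn_tri[OF bsn] bmem L_mem assms)
  then show ?thesis using sn_scale[OF bsn L_mem[OF assms(3)]] sn_scale[OF bsn L_mem[OF assms(4)]] assms(1,2)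
    by (simp add: L_linear)
qed

lemma lam_term_convex: assumes u: "0 \<le> u" "u \<le> 1"
  shows "(max 0 (lam (u *\<^sub>R x + (1 - u) *\<^sub>R y) - 1))\<^sup>2 \<le> u * (max 0 (lam x - 1))\<^sup>2 + (1 - u) * (max 0 (lam y - 1))\<^sup>2"
proof -
  have "lam (u *\<^sub>R x + (1 - u) *\<^sub>R y) - 1 \<le> u * (lam x - 1) + (1 - u) * (lam y - 1)"
    using lam_convex[OF u, of x y] by (simp add: algebra_simps)
  from pos_part_square_mono[OF this] show ?thesis using pos_part_square_convex[OF u] by (rule order_trans)
qed

lemma bL_term_convex: assumes u: "0 \<le> u" "u \<le> 1" and xy: "x \<in> V" "y \<in> V"
  shows "(max 0 (b c (L c (u *\<^sub>R x + (1 - u) *\<^sub>R y)) - \<theta>))\<^sup>2 \<le>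
    u * (max 0 (b c (L c x) - \<theta>))\<^sup>2 + (1 - u) * (max 0 (b c (L c y) - \<theta>))\<^sup>2"
proof -
  have "b c (L c (u *\<^sub>R x + (1 - u) *\<^sub>R y)) - \<theta> \<le> u * (b c (L c x) - \<theta>) + (1 - u) * (b c (L c y) - \<theta>)"
    using bL_convex[OF u xy, of c] by (simp add: algebra_simps)
  from pos_part_square_mono[OF this] show ?thesis using pos_part_square_convex[OF u] by (rule order_trans)
qed

lemma Ps_convex: assumes u: "0 \<le> u" "u \<le> 1" and xy: "x \<in> V" "y \<in> V"
  shows "Ps m (u *\<^sub>R x + (1 - u) *\<^sub>R y) \<le> u * Ps m x + (1 - u) * Ps m y"
proof -
  have "Ps m (u *\<^sub>R x + (1 - u) *\<^sub>R y) \<le>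
     (u * (max 0 (lam (slice 0 x) - 1))\<^sup>2 + (1 - u) * (max 0 (lam (slice 0 y) - 1))\<^sup>2) / \<gamma>\<^sup>2 +
     (\<Sum>c<m. (u * (max 0 (b c (L c x) - \<theta>))\<^sup>2 + (1 - u) * (max 0 (b c (L c y) - \<theta>))\<^sup>2) / (1 - \<theta>)\<^sup>2)"
    unfolding Ps_def slice_linear
    by (intro add_mono sum_mono divide_right_mono lam_term_convex bL_term_convex u xy) auto
  also have "\<dots> = u * Ps m x + (1 - u) * Ps m y"
    by (simp add: Ps_def sum.distrib sum_distrib_left add_divide_distrib distrib_left)
  finally show ?thesis .
qed

lemma Ps_zero: "Ps m 0 = 0"
proof -
  have "lam 0 = 0" using pos(8) by (simp add: lam_def)
  then show ?thesis using pos sn_zero[OF bsn] by (simp add: Ps_def L_linear)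
qed

lemma Ps_neg: assumes "z \<in> V" shows "Ps m (- z) = Ps m z"
proof -
  have "lam (- w) = lam w" for w by (simp add: lam_def)
  then show ?thesis using sn_neg[OF bsn L_mem[OF assms]] by (simp add: Ps_def L_neg)
qed

lemma Ps_mono: "m \<le> m' \<Longrightarrow> Ps m z \<le> Ps m' z"
  unfolding Ps_def by (intro add_mono order_refl sum_mono2) auto

lemma Ps_ray: assumes "z \<in> V" "s \<ge> 0"
  shows "Ps m (s *\<^sub>R z) = (max 0 (s ^ (2 * q) * lam (slice 0 z) - 1))\<^sup>2 / \<gamma>\<^sup>2 + (\<Sum>c<m. (max 0 (s * b c (L c z) - \<theta>))\<^sup>2 / (1 - \<theta>)\<^sup>2)"
  using sn_scale[OF bsn L_mem[OF assms(1)]] assms(2) by (simp add: Ps_def L_linear lam_scale)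

text \<open>Only the \<open>lam\<close> term matters. Passing from \<open>1 + \<gamma>\<close> to
  \<open>(1 + \<gamma>) ^ (2 * q)\<close> is wasteful but spares taking roots, and the factor
  \<open>1 + \<gamma>\<close> then cancels against the one in \<open>a\<close>.\<close>

lemma K_msup: assumes z: "z \<in> K" shows "B * sqrt (1 + \<delta>) * msup k (slice 0 z) \<le> 1"
proof -
  have c: "B * sqrt (1 + \<delta>) > 0" using pos by simp
  have "Ps 0 z \<le> 1" using z by (simp add: K_def)
  then have "(max 0 (lam (slice 0 z) - 1))\<^sup>2 \<le> \<gamma>\<^sup>2" using pos by (simp add: Ps_def)
  then have "max 0 (lam (slice 0 z) - 1) \<le> \<gamma>" by (rule power2_le_imp_le) (use pos in simp)
  then have lam: "lam (slice 0 z) \<le> 1 + \<gamma>" by simp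
  have "\<bar>slice 0 z i\<bar> \<le> 1 / (B * sqrt (1 + \<delta>))" if i: "i < k" for i
  proof -
    have "(a * slice 0 z i) ^ (2 * q) \<le> lam (slice 0 z)"
      unfolding lam_def by (rule member_le_sum) (use i in auto)
    also have "\<dots> \<le> (1 + \<gamma>) ^ 1" using lam by simp
    also have "\<dots> \<le> (1 + \<gamma>) ^ (2 * q)" using pos by (intro power_increasing) auto
    finally have "\<bar>a * slice 0 z i\<bar> ^ (2 * q) \<le> (1 + \<gamma>) ^ (2 * q)" by (simp add: power_even_abs)
    then have "\<bar>a * slice 0 z i\<bar> \<le> 1 + \<gamma>" using pos by (subst (asm) power_mono_iff) auto
    then have "(1 + \<gamma>) * (B * sqrt (1 + \<delta>) * \<bar>slice 0 z i\<bar>) \<le> (1 + \<gamma>) * 1"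
      using pos by (simp add: a_def abs_mult mult_ac)
    then have "B * sqrt (1 + \<delta>) * \<bar>slice 0 z i\<bar> \<le> 1" using pos by (subst (asm) mult_le_cancel_left_pos) auto
    then show ?thesis using c by (simp add: field_simps)
  qed
  then have "msup k (slice 0 z) \<le> 1 / (B * sqrt (1 + \<delta>))" using c by (intro msup_least) auto
  then show ?thesis using c by (simp add: field_simps)
qed

text \<open>Replacing a maximum by a sum of \<open>k\<close> powers costs the factor
  \<open>k\<close>, which \<open>kq\<close> absorbs in the gap between \<open>a\<close> and
  \<open>B'\<close>.\<close>

lemma lam_le: assumes "B' * msup k w \<le> 1" shows "lam w \<le> 1"
proof -
  have "(a * w i) ^ (2 * q) \<le> (a * msup k w) ^ (2 * q)" if "i < k" for i
  proof -
    have "\<bar>a * w i\<bar> \<le> a * msup k w" using msup_upper[OF that, of w] apos by (simp add: abs_mult)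
    then have "\<bar>a * w i\<bar> ^ (2 * q) \<le> (a * msup k w) ^ (2 * q)" by (intro power_mono) auto
    then show ?thesis by (simp add: power_even_abs)
  qed
  then have "lam w \<le> (\<Sum>i<k. (a * msup k w) ^ (2 * q))" unfolding lam_def by (intro sum_mono) auto
  also have "\<dots> = (real k * a ^ (2 * q)) * msup k w ^ (2 * q)" by (simp add: power_mult_distrib)
  also have "\<dots> \<le> B' ^ (2 * q) * msup k w ^ (2 * q)" using kq by (intro mult_right_mono) (auto simp: a_def)
  also have "\<dots> = (B' * msup k w) ^ (2 * q)" by (simp add: power_mult_distrib)
  also have "\<dots> \<le> 1" using assms pos msup_nonneg by (intro power_le_one) auto
  finally show ?thesis .
qed

lemma K_sufficient: assumes "z \<in> V" "B' * msup k (slice 0 z) \<le> 1" "\<And>c. b c (L c z) \<le> \<theta>" shows "z \<in> K"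
proof -
  have "max 0 (b c (L c z) - \<theta>) = 0" for c using assms(3)[of c] by simp
  moreover have "max 0 (lam (slice 0 z) - 1) = 0" using lam_le[OF assms(2)] by simp
  ultimately show ?thesis using assms(1) by (simp add: K_def Ps_def)
qed

lemma K_small: assumes z: "z \<in> V" and s: "(2 + \<theta> * B + B') / \<theta> * \<nu> z \<le> 1" shows "z \<in> K"
proof (rule K_sufficient[OF z])
  have \<nu>0: "\<nu> z \<ge> 0" by (rule sn_nonneg[OF \<nu>sn z])
  have s': "(2 + \<theta> * B + B') * \<nu> z \<le> \<theta>" using s pos by (simp add: field_simps)
  have s1: "(2 + \<theta> * B) * \<nu> z + B' * \<nu> z \<le> \<theta>" using s' by (simp add: algebra_simps)
  have p: "0 \<le> (2 + \<theta> * B) * \<nu> z" "0 \<le> B' * \<nu> z" using \<nu>0 pos by (intro mult_nonneg_nonneg; simp)+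
  have "B' * msup k (slice 0 z) \<le> B' * \<nu> z" using pos lnonneg[OF z] by (intro mult_left_mono) (auto simp: \<nu>_def)
  then show "B' * msup k (slice 0 z) \<le> 1" using s1 p pos by linarith
  show "b c (L c z) \<le> \<theta>" for c using L_\<nu>[OF z, of c] s1 p by linarith
qed

text \<open>On a whole ray in \<open>K\<close> the common part and all \<open>b c (L c z)\<close>
  must vanish. Then each row equals its own correction, which would be strictly shorter unless the
  row is zero.\<close>

lemma K_bounded: assumes z: "z \<in> V" and s: "\<And>s. 0 < s \<Longrightarrow> s *\<^sub>R z \<in> K" shows "z = 0"
proof -
  have unbounded: "x \<le> 0" if "\<And>s::real. s > 0 \<Longrightarrow> s * x \<le> 2" for x :: real
  proof (rule ccontr)
    assume "\<not> x \<le> 0"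
    then show False using that[of "3 / x"] by simp
  qed
  have "B * sqrt (1 + \<delta>) * msup k (slice 0 z) \<le> 0"
  proof (rule unbounded)
    fix t :: real assume "t > 0"
    then show "t * (B * sqrt (1 + \<delta>) * msup k (slice 0 z)) \<le> 2" using K_msup[OF s, of t] by (simp add: msup_scale mult_ac)
  qed
  then have "msup k (slice 0 z) = 0" using pos msup_nonneg[of k "slice 0 z"] by (simp add: mult_le_0_iff)
  then have v: "slice 0 z = 0" using msup_eq_0[OF VD(1)[OF z]] by simp
  have y: "slice (Suc c) z = 0" for c
  proof -
    have "b c (L c z) \<le> 0"
    proof (rule unbounded)
      fix t :: real assume t: "t > 0"
      have "Ps (Suc c) (t *\<^sub>R z) \<le> 1" using s[OF t] by (simp add: K_def)
      moreover have "(max 0 (t * b c (L c z) - \<theta>))\<^sup>2 / (1 - \<theta>)\<^sup>2 \<le> Ps (Suc c) (t *\<^sub>R z)"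
        unfolding Ps_ray[OF z less_imp_le[OF t]] by (auto simp: sum_nonneg)
      ultimately have "(max 0 (t * b c (L c z) - \<theta>))\<^sup>2 / (1 - \<theta>)\<^sup>2 \<le> 1" by linarith
      then have "(max 0 (t * b c (L c z) - \<theta>))\<^sup>2 \<le> (1 - \<theta>)\<^sup>2" by (subst (asm) divide_le_eq_1_pos) (use pos in auto)
      then have "max 0 (t * b c (L c z) - \<theta>) \<le> 1 - \<theta>" by (rule power2_le_imp_le) (use pos in simp)
      then show "t * b c (L c z) \<le> 2" by simp
    qed
    then have "b c (L c z) = 0" using bnonneg[OF L_mem[OF z]] by (intro antisym)
    then have L0: "L c z = 0" by (rule b_eq_0[OF L_mem[OF z]])
    let ?y = "slice (Suc c) z" let ?t = "\<theta> * B / A'"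
    have "?y = ?t *\<^sub>R T c (slice 0 ?y)" using L0 v by (simp add: L_def T_neg)
    then have "b c ?y = ?t * b c (T c (slice 0 ?y))" using sn_scale[OF bsn T_mem, of c ?t] pos by (metis abs_of_pos divide_pos_pos mult_pos_pos less_trans)
    then have "b c ?y \<le> (\<theta> * B / B') * b c ?y" using T_bound'[OF VD(2)[OF z], of c] by linarith
    then have "b c ?y \<le> 0" using \<theta>B bnonneg[OF VD(2)[OF z, of c]] by (metis mult.commute mult_less_cancel_left2 not_le)
    then have "b c ?y = 0" using bnonneg[OF VD(2)[OF z]] by (intro antisym)
    then show ?thesis by (rule b_eq_0[OF VD(2)[OF z]])
  qed
  show ?thesis
  proof (rule slice_ext)
    show "slice c z = slice c 0" for c using v y by (cases c) auto
  qed
qed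

text \<open>Every \<open>Ps m\<close> is continuous along a ray.\<close>

lemma K_closed: assumes z: "z \<in> V" and s: "\<And>s. 0 < s \<Longrightarrow> s < 1 \<Longrightarrow> s *\<^sub>R z \<in> K" shows "z \<in> K"
proof -
  have "Ps m z \<le> 1" for m
  proof -
    define f where "f = (\<lambda>s::real. (max 0 (s ^ (2 * q) * lam (slice 0 z) - 1))\<^sup>2 / \<gamma>\<^sup>2 + (\<Sum>c<m. (max 0 (s * b c (L c z) - \<theta>))\<^sup>2 / (1 - \<theta>)\<^sup>2))"
    have f: "Ps m (s *\<^sub>R z) = f s" if "s \<ge> 0" for s using Ps_ray[OF z that] by (simp add: f_def)
    have "(\<lambda>n. f (1 - inverse (real (Suc (Suc n))))) \<longlonglongrightarrow> f (1 - 0)"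
    proof (rule isCont_tendsto_compose[of _ f])
      have "continuous_on UNIV f" unfolding f_def using pos by (intro continuous_intros) auto
      then show "isCont f (1 - 0)" by (simp add: continuous_on_eq_continuous_at)
      show "(\<lambda>n. 1 - inverse (real (Suc (Suc n)))) \<longlonglongrightarrow> 1 - 0"
        by (intro tendsto_diff tendsto_const LIMSEQ_Suc[OF LIMSEQ_inverse_real_of_nat])
    qed
    then have "f (1 - 0) \<le> 1"
    proof (rule LIMSEQ_le_const2, intro exI[of _ 0] allI impI)
      fix n :: nat
      have "0 < 1 - inverse (real (Suc (Suc n)))" "1 - inverse (real (Suc (Suc n))) < 1" by (auto simp: field_simps)
      from s[OF this] have "Ps m ((1 - inverse (real (Suc (Suc n)))) *\<^sub>R z) \<le> 1" by (simp add: K_def del: of_nat_Suc)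
      then show "f (1 - inverse (real (Suc (Suc n)))) \<le> 1"
        unfolding f[OF less_imp_le[OF \<open>0 < 1 - inverse (real (Suc (Suc n)))\<close>]] .
    qed
    then show ?thesis using f[of 1] by simp
  qed
  then show ?thesis using z by (simp add: K_def)
qed

lemma K_convex: assumes "x \<in> K" "y \<in> K" "0 \<le> u" "u \<le> 1" shows "u *\<^sub>R x + (1 - u) *\<^sub>R y \<in> K"
proof -
  have xy: "x \<in> V" "y \<in> V" "\<And>m. Ps m x \<le> 1" "\<And>m. Ps m y \<le> 1" using assms by (auto simp: K_def)
  have "Ps m (u *\<^sub>R x + (1 - u) *\<^sub>R y) \<le> u * 1 + (1 - u) * 1" for m
    using assms(3,4) xy by (intro order_trans[OF Ps_convex] add_mono mult_left_mono) auto
  then show ?thesis using xy Vmem by (simp add: K_def)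
qed

lemma K_absorb: assumes z: "z \<in> V" shows "\<exists>s>0. s *\<^sub>R z \<in> K"
proof -
  define C where "C = (2 + \<theta> * B + B') / \<theta>"
  have C: "C > 0" using pos by (simp add: C_def add_pos_pos)
  have \<nu>0: "\<nu> z \<ge> 0" by (rule sn_nonneg[OF \<nu>sn z])
  define s where "s = 1 / (C * \<nu> z + 1)"
  have p: "C * \<nu> z + 1 > 0" using C \<nu>0 by (intro add_nonneg_pos mult_nonneg_nonneg) auto
  have s: "s > 0" using p by (simp add: s_def)
  have "C * \<nu> (s *\<^sub>R z) = C * \<nu> z / (C * \<nu> z + 1)" using sn_scale[OF \<nu>sn z, of s] s by (simp add: s_def)
  also have "\<dots> \<le> 1" using p by (simp add: divide_le_eq_1)
  finally have "s *\<^sub>R z \<in> K" using K_small[OF V_scale(1)[OF z]] by (simp add: C_def)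
  then show ?thesis using s by blast
qed

lemma K_sub: "K \<subseteq> V" by (auto simp: K_def)

lemma K_sym: "x \<in> K \<Longrightarrow> - x \<in> K" using Ps_neg[of x] Vmem(5) by (auto simp: K_def)

section \<open>The gauge \<open>M\<close> and the norm \<open>N\<close>\<close>

lemma Mnorm: "norm_on V M"
  unfolding M_def by (rule minkowski_norm[OF Vsub K_sub K_convex K_sym K_absorb K_closed K_bounded])

lemma M_le1: "z \<in> V \<Longrightarrow> M z \<le> 1 \<longleftrightarrow> z \<in> K"
  unfolding M_def by (rule minkowski_le1[OF Vsub K_sub K_convex K_sym K_absorb K_closed K_bounded])

lemmas Msn = norm_on_seminorm[OF Mnorm]

lemma M_le_\<nu>: assumes z: "z \<in> V" shows "M z \<le> (2 + \<theta> * B + B') / \<theta> * \<nu> z"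
proof -
  let ?C = "(2 + \<theta> * B + B') / \<theta>"
  have C: "?C > 0" using pos by (simp add: add_pos_pos)
  have "seminorm_on V (\<lambda>z. ?C * \<nu> z)"
    using \<nu>sn C unfolding seminorm_on_def by (auto simp: distrib_left[symmetric] simp del: times_divide_eq_left)
  from seminorm_le_from_unit[OF this Msn _ z, of 1] show ?thesis using K_small M_le1 by simp
qed

lemma msup_sn: "seminorm_on V (\<lambda>z. msup k (slice 0 z))"
  unfolding seminorm_on_def using Vsub msup_add by (auto simp: msup_scale)

lemma M_msup: assumes z: "z \<in> V" shows "B * sqrt (1 + \<delta>) * msup k (slice 0 z) \<le> M z"
proof -
  have c: "B * sqrt (1 + \<delta>) > 0" using pos by simp
  have "msup k (slice 0 z) \<le> 1 / (B * sqrt (1 + \<delta>)) * M z"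
  proof (rule seminorm_le_from_unit[OF Msn msup_sn _ z])
    fix x assume "x \<in> V" "M x \<le> 1"
    then show "msup k (slice 0 x) \<le> 1 / (B * sqrt (1 + \<delta>))" using K_msup M_le1 c by (simp add: field_simps)
  qed
  then show ?thesis using c by (simp add: field_simps)
qed

lemma Nnorm: "norm_on V N"
proof -
  have "seminorm_on V (\<lambda>z. sqrt \<delta> * l z)"
    using lsn pos unfolding seminorm_on_def by (auto simp: distrib_left[symmetric])
  from seminorm_sqrt_sum[OF Msn this] have s: "seminorm_on V (\<lambda>z. sqrt ((M z)\<^sup>2 + (sqrt \<delta> * l z)\<^sup>2))" .
  have "seminorm_on V N" unfolding seminorm_on_def N_def
  proof (intro conjI allI ballI Vsub)
    fix c x y assume x: "x \<in> V" and y: "y \<in> V"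
    show "sqrt ((M (x + y))\<^sup>2 + (sqrt \<delta> * l (x + y))\<^sup>2) / sqrt (1 + \<delta>)
       \<le> sqrt ((M x)\<^sup>2 + (sqrt \<delta> * l x)\<^sup>2) / sqrt (1 + \<delta>) + sqrt ((M y)\<^sup>2 + (sqrt \<delta> * l y)\<^sup>2) / sqrt (1 + \<delta>)"
      using sn_tri[OF s x y] pos by (simp add: add_divide_distrib[symmetric] divide_right_mono)
  next
    fix c x assume x: "x \<in> V"
    show "sqrt ((M (c *\<^sub>R x))\<^sup>2 + (sqrt \<delta> * l (c *\<^sub>R x))\<^sup>2) / sqrt (1 + \<delta>)
       = \<bar>c\<bar> * (sqrt ((M x)\<^sup>2 + (sqrt \<delta> * l x)\<^sup>2) / sqrt (1 + \<delta>))"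
      by (simp only: sn_scale[OF s x] times_divide_eq_right)
  qed
  moreover have "x = 0" if "x \<in> V" "N x = 0" for x
  proof -
    have "(M x)\<^sup>2 + (sqrt \<delta> * l x)\<^sup>2 = 0" using that(2) pos by (simp add: N_def)
    then have "M x = 0" by (simp add: sum_power2_eq_zero_iff)
    then show ?thesis using Mnorm that(1) by (simp add: norm_on_def)
  qed
  ultimately show ?thesis by (simp add: norm_on_def)
qed

lemmas Nsn = norm_on_seminorm[OF Nnorm]

lemma N_square: "z \<in> V \<Longrightarrow> (1 + \<delta>) * (N z)\<^sup>2 = (M z)\<^sup>2 + \<delta> * (l z)\<^sup>2"
  using pos by (simp add: N_def power_divide power_mult_distrib)

lemma N_ge: assumes z: "z \<in> V" shows "M z \<le> sqrt (1 + \<delta>) * N z" "sqrt \<delta> * l z \<le> sqrt (1 + \<delta>) * N z"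
proof -
  have e: "sqrt (1 + \<delta>) * N z = sqrt ((M z)\<^sup>2 + (sqrt \<delta> * l z)\<^sup>2)" using pos by (simp add: N_def)
  show "M z \<le> sqrt (1 + \<delta>) * N z" unfolding e by (rule real_sqrt_sum_squares_ge1)
  show "sqrt \<delta> * l z \<le> sqrt (1 + \<delta>) * N z" unfolding e by (rule real_sqrt_sum_squares_ge2)
qed

lemma N_le: assumes z: "z \<in> V" shows "N z \<le> M z + sqrt \<delta> * l z"
proof -
  have m: "M z \<ge> 0" "l z \<ge> 0" using sn_nonneg[OF Msn z] lnonneg[OF z] .
  have "N z \<le> sqrt ((M z)\<^sup>2 + (sqrt \<delta> * l z)\<^sup>2)" 
    using divide_left_mono[of 1 "sqrt (1 + \<delta>)" "sqrt ((M z)\<^sup>2 + (sqrt \<delta> * l z)\<^sup>2)"] pos by (simp add: N_def)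
  also have "\<dots> \<le> M z + sqrt \<delta> * l z" by (rule sqrt_sum_squares_le_sum) (use m pos in auto)
  finally show ?thesis .
qed

text \<open>The factor \<open>sqrt (1 + \<delta>)\<close> gained in \<open>K_msup\<close> is spent
  again in \<open>N_ge\<close>.\<close>

lemma N_msup: assumes z: "z \<in> V" shows "B * msup k (slice 0 z) \<le> N z"
proof -
  have "sqrt (1 + \<delta>) * (B * msup k (slice 0 z)) \<le> sqrt (1 + \<delta>) * N z"
    using M_msup[OF z] N_ge(1)[OF z] by (simp add: mult_ac)
  then show ?thesis using pos by (subst (asm) mult_le_cancel_left_pos) auto
qed

definition "C\<nu> = 1 / B + sqrt (1 + \<delta>) / sqrt \<delta>"

lemma \<nu>_le_N: assumes z: "z \<in> V" shows "\<nu> z \<le> C\<nu> * N z"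
proof -
  have "msup k (slice 0 z) \<le> 1 / B * N z" using N_msup[OF z] pos by (simp add: field_simps)
  moreover have "l z \<le> sqrt (1 + \<delta>) / sqrt \<delta> * N z" using N_ge(2)[OF z] pos by (simp add: field_simps)
  ultimately show ?thesis by (simp add: \<nu>_def C\<nu>_def distrib_right)
qed

definition "CN = (2 + \<theta> * B + B') / \<theta> + sqrt \<delta>"

lemma N_le_\<nu>: assumes z: "z \<in> V" shows "N z \<le> CN * \<nu> z"
proof -
  have "sqrt \<delta> * l z \<le> sqrt \<delta> * \<nu> z" using pos msup_nonneg by (intro mult_left_mono) (auto simp: \<nu>_def)
  then show ?thesis using N_le[OF z] M_le_\<nu>[OF z] by (simp add: CN_def distrib_right)
qed

end

lemma l2_cauchy_schwarz:
  fixes f g :: "nat \<Rightarrow> real"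
  assumes f: "summable (\<lambda>c. (f c)\<^sup>2)" and g: "summable (\<lambda>c. (g c)\<^sup>2)"
  shows "summable (\<lambda>c. \<bar>f c\<bar> * \<bar>g c\<bar>)" "(\<Sum>c. \<bar>f c\<bar> * \<bar>g c\<bar>) \<le> sqrt (\<Sum>c. (f c)\<^sup>2) * sqrt (\<Sum>c. (g c)\<^sup>2)"
proof -
  have part: "(\<Sum>c<n. \<bar>f c\<bar> * \<bar>g c\<bar>) \<le> sqrt (\<Sum>c. (f c)\<^sup>2) * sqrt (\<Sum>c. (g c)\<^sup>2)" for n
  proof -
    have "(\<Sum>c<n. \<bar>f c\<bar> * \<bar>g c\<bar>) \<le> sqrt (\<Sum>c<n. (f c)\<^sup>2) * sqrt (\<Sum>c<n. (g c)\<^sup>2)"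
      using L2_set_mult_ineq[of f g "{..<n}"] by (simp add: L2_set_def)
    also have "\<dots> \<le> sqrt (\<Sum>c. (f c)\<^sup>2) * sqrt (\<Sum>c. (g c)\<^sup>2)"
      using f g by (intro mult_mono real_sqrt_le_mono sum_le_suminf) (auto simp: suminf_nonneg sum_nonneg)
    finally show ?thesis .
  qed
  show s: "summable (\<lambda>c. \<bar>f c\<bar> * \<bar>g c\<bar>)"
    by (rule bounded_imp_summable[where B="sqrt (\<Sum>c. (f c)\<^sup>2) * sqrt (\<Sum>c. (g c)\<^sup>2)"])
      (use part[of "Suc _"] in \<open>auto simp: lessThan_Suc_atMost\<close>)
  show "(\<Sum>c. \<bar>f c\<bar> * \<bar>g c\<bar>) \<le> sqrt (\<Sum>c. (f c)\<^sup>2) * sqrt (\<Sum>c. (g c)\<^sup>2)" by (rule suminf_le_const[OF s part])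
qed

lemma abs_suminf_le:
  fixes f :: "nat \<Rightarrow> real"
  assumes g: "summable g" and le: "\<And>n. \<bar>f n\<bar> \<le> g n" shows "\<bar>suminf f\<bar> \<le> suminf g"
proof -
  have s: "summable (\<lambda>n. \<bar>f n\<bar>)" by (rule summable_comparison_test'[OF g, of 0]) (use le in simp)
  have "\<bar>suminf f\<bar> \<le> (\<Sum>n. \<bar>f n\<bar>)" by (rule summable_rabs[OF s])
  also have "\<dots> \<le> suminf g" by (rule suminf_le[OF le s g])
  finally show ?thesis .
qed

section \<open>Frechet smoothness of the amalgamated norm\<close>

context amalgam
begin

text \<open>The rows of \<open>z\<close> tend to zero and the common part stays below the threshold
  by the gap \<open>g\<close>, so late terms vanish on a whole neighbourhood.\<close>

lemma Ps_locally_const: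
  assumes z: "z \<in> V" and v: "B * msup k (slice 0 z) < 1"
  obtains m0 d where "d > 0" "\<And>m w. m0 \<le> m \<Longrightarrow> w \<in> V \<Longrightarrow> \<nu> (w - z) < d \<Longrightarrow> (w \<in> K \<longleftrightarrow> Ps m w \<le> 1)"
proof -
  define g where "g = \<theta> * (1 - B * msup k (slice 0 z))"
  have g: "g > 0" using v pos by (simp add: g_def)
  have g2: "g = \<theta> - \<theta> * B * msup k (slice 0 z)" by (simp add: g_def algebra_simps)
  have "eventually (\<lambda>c. b c (slice (Suc c) z) < g / 4) sequentially"
    using order_tendstoD(2)[OF b_tendsto_0[OF z], of "g / 4"] g by simp
  then obtain m0 where m0: "\<And>c. c \<ge> m0 \<Longrightarrow> b c (slice (Suc c) z) < g / 4" by (auto simp: eventually_sequentially)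
  \<comment> \<open>Half of the gap is spent on the rows of \<open>z\<close>, half on the
    perturbation \<open>w - z\<close>.\<close>
  define d where "d = g / (2 * (2 + \<theta> * B))"
  have C: "2 + \<theta> * B > 0" using pos by (simp add: add_pos_pos)
  have small: "b c (L c w) \<le> \<theta>" if c: "c \<ge> m0" and w: "w \<in> V" "\<nu> (w - z) < d" for c w
  proof -
    have "L c w = L c z + L c (w - z)" by (simp add: L_linear)
    then have "b c (L c w) \<le> b c (L c z) + b c (L c (w - z))"
      using sn_tri[OF bsn L_mem[OF z, of c] L_mem[OF Vmem(4)[OF w(1) z], of c]] by simp
    also have "b c (L c z) \<le> 2 * b c (slice (Suc c) z) + \<theta> * B * msup k (slice 0 z)" by (rule L_bound[OF z])
    also have "b c (L c (w - z)) \<le> (2 + \<theta> * B) * \<nu> (w - z)" by (rule L_\<nu>[OF Vmem(4)[OF w(1) z]])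
    also have "\<dots> \<le> (2 + \<theta> * B) * d" using w C by (intro mult_left_mono) auto
    also have "\<dots> = g / 2" using C unfolding d_def by (metis mult.assoc mult.commute nonzero_mult_divide_mult_cancel_left order_less_irrefl times_divide_eq_right)
    finally show ?thesis using m0[OF c] g2 by linarith
  qed
  show ?thesis
  proof (rule that[of d m0])
    show "d > 0" using g C by (simp add: d_def)
    fix m w assume m: "m0 \<le> m" and w: "w \<in> V" "\<nu> (w - z) < d"
    have "Ps m' w \<le> Ps m w" for m'
    proof (cases "m' \<le> m")
      case False
      have "(\<Sum>c<m'. (max 0 (b c (L c w) - \<theta>))\<^sup>2 / (1 - \<theta>)\<^sup>2) = (\<Sum>c<m. (max 0 (b c (L c w) - \<theta>))\<^sup>2 / (1 - \<theta>)\<^sup>2)"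
      proof (rule sum.mono_neutral_right)
        show "\<forall>i\<in>{..<m'} - {..<m}. (max 0 (b i (L i w) - \<theta>))\<^sup>2 / (1 - \<theta>)\<^sup>2 = 0"
        proof
          fix i assume "i \<in> {..<m'} - {..<m}"
          then have "max 0 (b i (L i w) - \<theta>) = 0" using small[of i w] w m by simp
          then show "(max 0 (b i (L i w) - \<theta>))\<^sup>2 / (1 - \<theta>)\<^sup>2 = 0" by simp
        qed
      qed (use False in auto)
      then show ?thesis by (simp add: Ps_def)
    qed (rule Ps_mono)
    then show "w \<in> K \<longleftrightarrow> Ps m w \<le> 1" using w(1) by (auto simp: K_def intro: order_trans)
  qed
qed

text \<open>Strictness comes from \<open>sqrt (1 + \<delta>) > 1\<close>, built into
  \<open>a\<close>; it opens the gap needed in \<open>Ps_locally_const\<close>.\<close>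

lemma K_msup_less: assumes "z \<in> K" shows "B * msup k (slice 0 z) < 1"
proof (cases "msup k (slice 0 z) = 0")
  case False
  then have "msup k (slice 0 z) > 0" using msup_nonneg[of k "slice 0 z"] by simp
  then have "1 * (B * msup k (slice 0 z)) < sqrt (1 + \<delta>) * (B * msup k (slice 0 z))"
    using pos by (intro mult_strict_right_mono) auto
  then show ?thesis using K_msup[OF assms] by (simp add: mult_ac)
qed simp

lemma fdiff_lam: assumes z: "z \<in> V" shows "\<exists>D. fdiff V \<nu> (\<lambda>z. lam (slice 0 z)) z D"
proof -
  have "\<exists>D. fdiff V \<nu> (\<lambda>z. (a * slice 0 z i) ^ (2 * q)) z D" if i: "i < k" for i
  proof -
    have "blf V \<nu> (\<lambda>z. a * slice 0 z i)"
    proof (rule blfI[OF \<nu>sn, where C=a])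
      fix y assume y: "y \<in> V"
      have "\<bar>slice 0 y i\<bar> \<le> \<nu> y" using msup_upper[OF i, of "slice 0 y"] lnonneg[OF y] by (simp add: \<nu>_def)
      then show "\<bar>a * slice 0 y i\<bar> \<le> a * \<nu> y" using apos by (simp add: abs_mult)
    qed (simp_all add: algebra_simps)
    from fdiff_chain[OF \<nu>sn fdiff_linear[OF \<nu>sn this z], OF DERIV_pow] show ?thesis by blast
  qed
  then have "\<forall>i. \<exists>D. i < k \<longrightarrow> fdiff V \<nu> (\<lambda>z. (a * slice 0 z i) ^ (2 * q)) z D" by blast
  then obtain D where D: "\<And>i. i < k \<Longrightarrow> fdiff V \<nu> (\<lambda>z. (a * slice 0 z i) ^ (2 * q)) z (D i)" by metis
  have "fdiff V \<nu> (\<lambda>z. \<Sum>i<k. (a * slice 0 z i) ^ (2 * q)) z (\<lambda>h. \<Sum>i<k. D i h)"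
    by (rule fdiff_sum[OF \<nu>sn]) (simp_all add: D)
  then show ?thesis unfolding lam_def by blast
qed

lemma DERIV_pos_part_scaled: "((\<lambda>s::real. (max 0 (s - c))\<^sup>2 / e) has_real_derivative 2 * max 0 (x - c) / e) (at x)"
proof -
  have "((\<lambda>s. (max 0 (s - c))\<^sup>2) has_real_derivative (2 * max 0 (x - c)) * 1) (at x)"
    by (rule DERIV_chain2[OF DERIV_pos_part_square, where g="\<lambda>s. s - c"]) (auto intro!: derivative_eq_intros)
  then show ?thesis using DERIV_cdivide[of _ "2 * max 0 (x - c)" x UNIV e] by simp
qed

text \<open>Smoothness of \<open>b c\<close> says nothing at 0, but near 0 the positive threshold
  makes the term vanish identically.\<close>

lemma fdiff_b_term: assumes y: "y \<in> Vc c" shows "\<exists>D. fdiff (Vc c) (b c) (\<lambda>y. (max 0 (b c y - \<theta>))\<^sup>2 / (1 - \<theta>)\<^sup>2) y D"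
proof (cases "y = 0")
  case True
  have "fdiff (Vc c) (b c) (\<lambda>y. (max 0 (b c y - \<theta>))\<^sup>2 / (1 - \<theta>)\<^sup>2) y (\<lambda>_. 0)"
    by (rule fdiff_local[OF bsn fdiff_const[OF bsn, of c 0], of \<theta>]) (use True pos in auto)
  then show ?thesis by blast
next
  case False
  then obtain D where "fdiff (Vc c) (b c) (b c) y D" using good_smooth[OF good] y by (auto simp: smooth_on_def)
  from fdiff_chain[OF bsn this DERIV_pos_part_scaled] show ?thesis by blast
qed

lemma fdiff_Ps: assumes z: "z \<in> V" shows "\<exists>D. fdiff V \<nu> (Ps m) z D"
proof -
  obtain D0 where "fdiff V \<nu> (\<lambda>z. lam (slice 0 z)) z D0" using fdiff_lam[OF z] by blast
  from fdiff_chain[OF \<nu>sn this DERIV_pos_part_scaled[of 1 "\<gamma>\<^sup>2"]]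
  obtain D1 where D1: "fdiff V \<nu> (\<lambda>z. (max 0 (lam (slice 0 z) - 1))\<^sup>2 / \<gamma>\<^sup>2) z D1" by blast
  have "\<exists>D. fdiff V \<nu> (\<lambda>z. (max 0 (b c (L c z) - \<theta>))\<^sup>2 / (1 - \<theta>)\<^sup>2) z D" for c
  proof -
    obtain D where "fdiff (Vc c) (b c) (\<lambda>y. (max 0 (b c y - \<theta>))\<^sup>2 / (1 - \<theta>)\<^sup>2) (L c z) D"
      using fdiff_b_term[OF L_mem[OF z]] by blast
    then have "fdiff V \<nu> (\<lambda>z. (max 0 (b c (L c z) - \<theta>))\<^sup>2 / (1 - \<theta>)\<^sup>2) z (\<lambda>h. D (L c h))"
      by (rule fdiff_linear_comp[OF \<nu>sn bsn, where T="L c" and C="2 + \<theta> * B"]) (simp_all add: L_linear z L_\<nu> L_mem)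
    then show ?thesis by blast
  qed
  then obtain D2 where "\<And>c. fdiff V \<nu> (\<lambda>z. (max 0 (b c (L c z) - \<theta>))\<^sup>2 / (1 - \<theta>)\<^sup>2) z (D2 c)" by metis
  then have "fdiff V \<nu> (\<lambda>z. \<Sum>c<m. (max 0 (b c (L c z) - \<theta>))\<^sup>2 / (1 - \<theta>)\<^sup>2) z (\<lambda>h. \<Sum>c<m. D2 c h)"
    by (intro fdiff_sum[OF \<nu>sn]) simp_all
  from fdiff_add[OF \<nu>sn D1 this] show ?thesis unfolding Ps_def by blast
qed

text \<open>If the value were below 1, differentiability would leave room to move outwards along the
  ray inside \<open>K\<close>, against \<open>M z = 1\<close>.\<close>

lemma Ps_eq_1:
  assumes z: "z \<in> V" "M z = 1" and d: "d > 0" "\<And>w. w \<in> V \<Longrightarrow> \<nu> (w - z) < d \<Longrightarrow> (w \<in> K \<longleftrightarrow> Ps m w \<le> 1)"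
  shows "Ps m z = 1"
proof (rule ccontr)
  assume n: "Ps m z \<noteq> 1"
  have "z \<in> K" using M_le1[OF z(1)] z(2) by simp
  then have "Ps m z < 1" using n by (simp add: K_def less_le)
  obtain D where D: "fdiff V \<nu> (Ps m) z D" using fdiff_Ps[OF z(1)] by blast
  obtain t0 where t0: "t0 > 0" "\<And>t. 0 < t \<Longrightarrow> t \<le> t0 \<Longrightarrow> \<bar>Ps m (z + t *\<^sub>R z) - Ps m z - t * D z\<bar> \<le> t * 1"
    using fdiff_ray[OF \<nu>sn D z(1) zero_less_one] by blast
  have \<nu>0: "\<nu> z \<ge> 0" by (rule sn_nonneg[OF \<nu>sn z(1)])
  \<comment> \<open>The step must keep \<open>Ps m\<close> at most 1 and remain in the neighbourhood
    where \<open>Ps m\<close> decides membership in \<open>K\<close>.\<close>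
  define t where "t = min t0 (min ((1 - Ps m z) / (\<bar>D z\<bar> + 1)) (d / (2 * (\<nu> z + 1))))"
  have t: "t > 0" "t \<le> t0" "t \<le> (1 - Ps m z) / (\<bar>D z\<bar> + 1)" "t \<le> d / (2 * (\<nu> z + 1))"
    using t0(1) d(1) \<nu>0 \<open>Ps m z < 1\<close> by (auto simp: t_def)
  have "t * D z + t \<le> t * (\<bar>D z\<bar> + 1)" using t(1) by (simp add: distrib_left)
  also have "\<dots> \<le> 1 - Ps m z" using t(3) by (simp add: pos_le_divide_eq)
  finally have le: "Ps m (z + t *\<^sub>R z) \<le> 1" using t0(2)[OF t(1,2)] by (simp add: abs_le_iff)
  have "\<nu> (t *\<^sub>R z) = t * \<nu> z" using sn_scale[OF \<nu>sn z(1)] t by simp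
  also have "\<dots> \<le> t * (\<nu> z + 1)" using t by simp
  also have "\<dots> \<le> d / 2" using t(4) \<nu>0 by (simp add: field_simps)
  also have "\<dots> < d" using d by simp
  finally have "z + t *\<^sub>R z \<in> K" using d(2)[of "z + t *\<^sub>R z"] le z Vmem by simp
  then have "M (z + t *\<^sub>R z) \<le> 1" using M_le1 K_sub by blast
  moreover have "M (z + t *\<^sub>R z) = 1 + t" using sn_scale[OF Msn z(1), of "1 + t"] t z(2) by (simp add: scaleR_add_left)
  ultimately show False using t by simp
qed

text \<open>Implicit differentiation on the level set of \<open>Ps m\<close>. The radial derivative
  cannot vanish: \<open>Ps m\<close> is convex and drops from 1 to 0 between \<open>z\<close> and
  the origin.\<close>

lemma M_fdiff_unit: assumes z: "z \<in> V" "M z = 1" shows "\<exists>D. fdiff V \<nu> M z D"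
proof -
  have "z \<in> K" using M_le1[OF z(1)] z(2) by simp
  obtain m d where d: "d > 0" "\<And>w. w \<in> V \<Longrightarrow> \<nu> (w - z) < d \<Longrightarrow> (w \<in> K \<longleftrightarrow> Ps m w \<le> 1)"
    using Ps_locally_const[OF z(1) K_msup_less[OF \<open>z \<in> K\<close>]] by (metis order_refl)
  have P1: "Ps m z = 1" by (rule Ps_eq_1[OF z d])
  obtain D where D: "fdiff V \<nu> (Ps m) z D" using fdiff_Ps[OF z(1)] by blast
  obtain t0 where t0: "t0 > 0" "\<And>t. 0 < t \<Longrightarrow> t \<le> t0 \<Longrightarrow> \<bar>Ps m (z + t *\<^sub>R (- z)) - Ps m z - t * D (- z)\<bar> \<le> t * (1 / 2)"
    using fdiff_ray[OF \<nu>sn D Vmem(5)[OF z(1)], of "1 / 2"] by auto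
  define t where "t = min t0 1"
  have t: "0 < t" "t \<le> t0" "t \<le> 1" using t0 by (auto simp: t_def)
  have "Ps m ((1 - t) *\<^sub>R z + (1 - (1 - t)) *\<^sub>R 0) \<le> (1 - t) * Ps m z + (1 - (1 - t)) * Ps m 0"
    by (rule Ps_convex) (use t z Vmem in auto)
  then have "Ps m (z + t *\<^sub>R (- z)) \<le> 1 - t" using P1 by (simp add: Ps_zero scaleR_diff_left)
  moreover have "D (- z) = - D z" by (rule blf_neg[OF \<nu>sn fdiff_blf[OF \<nu>sn D] z(1)])
  moreover have "- (t * (1 / 2)) \<le> Ps m (z + t *\<^sub>R (- z)) - Ps m z - t * D (- z)" using t0(2)[OF t(1,2)] by linarith
  moreover have "t * (- D z) = - (t * D z)" by simp
  ultimately have "t - t * D z \<le> t * (1 / 2)" using P1 by simp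
  then have "t * (1 - D z) \<le> t * (1 / 2)" by (simp add: right_diff_distrib)
  then have "1 - D z \<le> 1 / 2" using t(1) by (subst (asm) mult_le_cancel_left_pos)
  then have "D z > 0" by simp
  then have "fdiff V \<nu> M z (\<lambda>h. D h / D z)"
    by (intro minkowski_fdiff[OF \<nu>sn Msn M_le_\<nu> z D, OF _ P1 _ d(1)]) (use d(2) M_le1 in auto)
  then show ?thesis by blast
qed

lemma M_fdiff: assumes z: "z \<in> V" "z \<noteq> 0" shows "\<exists>D. fdiff V \<nu> M z D"
proof -
  have p: "M z > 0" using sn_nonneg[OF Msn z(1)] Mnorm z by (auto simp: norm_on_def less_le)
  define u where "u = (1 / M z) *\<^sub>R z"
  have u: "u \<in> V" "M u = 1" "M z *\<^sub>R u = z" using z(1) V_scale(1) sn_scale[OF Msn z(1)] p by (auto simp: u_def)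
  obtain D where "fdiff V \<nu> M u D" using M_fdiff_unit[OF u(1,2)] by blast
  from fdiff_homog[OF \<nu>sn this p u(1)] sn_scale[OF Msn] u(3) show ?thesis by fastforce
qed

text \<open>Squaring removes the singularity at 0; the bound on the derivative makes the termwise
  derivatives summable.\<close>

lemma b_square_fdiff: assumes y: "y \<in> Vc c"
  shows "\<exists>E. fdiff (Vc c) (b c) (\<lambda>y. (b c y)\<^sup>2) y E \<and> (\<forall>h\<in>Vc c. \<bar>E h\<bar> \<le> 2 * b c y * b c h)"
proof (cases "y = 0")
  case True
  have "fdiff (Vc c) (b c) (\<lambda>y. (b c y)\<^sup>2) y (\<lambda>_. 0)" unfolding fdiff_def
  proof (intro conjI allI impI blf_0[OF bsn])
    fix e :: real assume "e > 0"
    then show "\<exists>d>0. \<forall>h\<in>Vc c. b c h < d \<longrightarrow> \<bar>(b c (y + h))\<^sup>2 - (b c y)\<^sup>2 - 0\<bar> \<le> e * b c h"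
      using True sn_zero[OF bsn, of c] bnonneg[of _ c] by (intro exI[of _ e]) (auto simp: power2_eq_square intro!: mult_right_mono)
  qed
  then show ?thesis using bnonneg[OF y] bnonneg[of _ c] by (intro exI[of _ "\<lambda>_. 0"]) auto
next
  case False
  then obtain D where D: "fdiff (Vc c) (b c) (b c) y D" using good_smooth[OF good] y by (auto simp: smooth_on_def)
  have "((\<lambda>x. x\<^sup>2) has_real_derivative 2 * b c y) (at (b c y))" by (auto intro!: derivative_eq_intros)
  from fdiff_chain[OF bsn D, OF this] show ?thesis
    using fdiff_norm_le[OF bsn D y] bnonneg[OF y] by (intro exI[of _ "\<lambda>h. 2 * b c y * D h"]) (auto simp: abs_mult intro!: mult_left_mono)
qed

text \<open>Termwise differentiation: finitely many rows are handled by their own derivatives, the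
  others by Cauchy-Schwarz, because the tail of \<open>z\<close> is small in l2.\<close>

lemma l_square_fdiff: assumes z: "z \<in> V" shows "\<exists>D. fdiff V \<nu> (\<lambda>z. (l z)\<^sup>2) z D"
proof -
  let ?y = "\<lambda>c. slice (Suc c) z"
  have "\<forall>c. \<exists>E. fdiff (Vc c) (b c) (\<lambda>y. (b c y)\<^sup>2) (?y c) E \<and> (\<forall>h\<in>Vc c. \<bar>E h\<bar> \<le> 2 * b c (?y c) * b c h)"
    using b_square_fdiff VD(2)[OF z] by blast
  then obtain E where E: "\<And>c. fdiff (Vc c) (b c) (\<lambda>y. (b c y)\<^sup>2) (?y c) (E c)"
    "\<And>c h. h \<in> Vc c \<Longrightarrow> \<bar>E c h\<bar> \<le> 2 * b c (?y c) * b c h" by metis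
  note Eb = fdiff_blf[OF bsn E(1)]
  note bn = bnonneg[OF VD(2)]
  have cs: "summable (\<lambda>c. b c (?y c) * b c (slice (Suc c) h))" "(\<Sum>c. b c (?y c) * b c (slice (Suc c) h)) \<le> l z * l h" if h: "h \<in> V" for h
    using l2_cauchy_schwarz[OF VD(3)[OF z] VD(3)[OF h]] bn[OF z] bn[OF h] by (simp_all add: l_def)
  have El: "\<bar>E c (slice (Suc c) h)\<bar> \<le> 2 * (b c (?y c) * b c (slice (Suc c) h))" if h: "h \<in> V" for c h
    using E(2)[OF VD(2)[OF h], of c] by (simp add: mult.assoc)
  have Es: "summable (\<lambda>c. E c (slice (Suc c) h))" if h: "h \<in> V" for h
    by (rule summable_comparison_test'[OF summable_mult[OF cs(1)[OF h], of 2], of 0]) (use El[OF h] in simp)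
  define D where "D h = (\<Sum>c. E c (slice (Suc c) h))" for h
  have "blf V \<nu> D"
  proof (rule blfI[OF \<nu>sn, where C="2 * l z"])
    fix x y assume "x \<in> V" "y \<in> V"
    then show "D (x + y) = D x + D y"
      using suminf_add[OF Es[of x] Es[of y]] by (simp add: D_def blf_add[OF bsn Eb VD(2) VD(2)])
  next
    fix t x assume "x \<in> V"
    then show "D (t *\<^sub>R x) = t * D x" using suminf_mult[OF Es[of x], of t] by (simp add: D_def blf_scale[OF bsn Eb VD(2)])
  next
    fix x assume x: "x \<in> V"
    have "\<bar>D x\<bar> \<le> (\<Sum>c. 2 * (b c (?y c) * b c (slice (Suc c) x)))"
      unfolding D_def using abs_suminf_le[OF summable_mult[OF cs(1)[OF x], of 2], of "\<lambda>c. E c (slice (Suc c) x)"] El[OF x] by simp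
    also have "\<dots> \<le> 2 * (l z * l x)" using cs(2)[OF x] by (simp add: suminf_mult[OF cs(1)[OF x]])
    also have "\<dots> \<le> 2 * (l z * \<nu> x)" using lnonneg[OF z] msup_nonneg by (intro mult_left_mono) (auto simp: \<nu>_def)
    finally show "\<bar>D x\<bar> \<le> 2 * l z * \<nu> x" by simp
  qed
  moreover have "\<exists>d>0. \<forall>h\<in>V. \<nu> h < d \<longrightarrow> \<bar>(l (z + h))\<^sup>2 - (l z)\<^sup>2 - D h\<bar> \<le> e * \<nu> h" if e: "e > 0" for e
  proof -
    define err where "err h c = (b c (slice (Suc c) (z + h)))\<^sup>2 - (b c (?y c))\<^sup>2 - E c (slice (Suc c) h)" for h c
    have errs: "summable (err h)" "(l (z + h))\<^sup>2 - (l z)\<^sup>2 - D h = (\<Sum>c. err h c)" if h: "h \<in> V" for h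
    proof -
      note s = summable_diff[OF summable_diff[OF VD(3)[OF Vmem(2)[OF z h]] VD(3)[OF z]] Es[OF h]]
      show "summable (err h)" using s unfolding err_def .
      show "(l (z + h))\<^sup>2 - (l z)\<^sup>2 - D h = (\<Sum>c. err h c)"
        unfolding l_square[OF Vmem(2)[OF z h]] l_square[OF z] D_def err_def
        using suminf_diff[OF VD(3)[OF Vmem(2)[OF z h]] VD(3)[OF z]]
          suminf_diff[OF summable_diff[OF VD(3)[OF Vmem(2)[OF z h]] VD(3)[OF z]] Es[OF h]] by simp
    qed
    \<comment> \<open>Valid for every \<open>h\<close>, without a radius depending on the row, hence
      summable over the tail.\<close>
    have errb: "\<bar>err h c\<bar> \<le> 4 * (b c (?y c) * b c (slice (Suc c) h)) + (b c (slice (Suc c) h))\<^sup>2" if h: "h \<in> V" for h c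
    proof -
      define p p' s where "p = b c (?y c)" and "p' = b c (slice (Suc c) h)" and "s = b c (slice (Suc c) (z + h))"
      have n: "p \<ge> 0" "p' \<ge> 0" "s \<ge> 0" unfolding p_def p'_def s_def using bn[OF z] bn[OF h] bn[OF Vmem(2)[OF z h]] by auto
      have "s \<le> p + p'" unfolding p_def p'_def s_def using sn_tri[OF bsn VD(2)[OF z] VD(2)[OF h], of c] by simp
      moreover have "p - p' \<le> s" unfolding p_def p'_def s_def using sn_tri_minus[OF bsn VD(2)[OF z] VD(2)[OF h], of c] by simp
      ultimately have "\<bar>s - p\<bar> \<le> p'" by simp
      then have "\<bar>s - p\<bar> * (s + p) \<le> p' * (2 * p + p')" using n \<open>s \<le> p + p'\<close> by (intro mult_mono) auto
      moreover have "\<bar>s\<^sup>2 - p\<^sup>2\<bar> = \<bar>s - p\<bar> * (s + p)" 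
      proof -
        have "s\<^sup>2 - p\<^sup>2 = (s - p) * (s + p)" by (simp add: power2_eq_square algebra_simps)
        then show ?thesis using n by (simp add: abs_mult)
      qed
      ultimately have "\<bar>s\<^sup>2 - p\<^sup>2\<bar> \<le> 2 * (p * p') + p'\<^sup>2" by (simp add: power2_eq_square algebra_simps)
      moreover have "\<bar>E c (slice (Suc c) h)\<bar> \<le> 2 * (p * p')" using El[OF h, of c] by (simp add: p_def p'_def)
      ultimately show ?thesis unfolding err_def p_def[symmetric] p'_def[symmetric] s_def[symmetric] by linarith
    qed
    \<comment> \<open>In the tail the error is at most \<open>(4 * \<tau> + l h) * l h\<close>; this
      \<open>\<tau>\<close> and the bound \<open>e / 4\<close> on the radius make the bracket at
      most \<open>e / 2\<close>.\<close>
    define \<tau> where "\<tau> = e / 16"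
    have \<tau>: "\<tau> > 0" using e by (simp add: \<tau>_def)
    obtain m where m: "(\<Sum>c. (b (c + m) (?y (c + m)))\<^sup>2) < \<tau>\<^sup>2"
    proof -
      have "\<exists>n0. \<forall>n\<ge>n0. norm (\<Sum>i. (b (i + n) (?y (i + n)))\<^sup>2) < \<tau>\<^sup>2"
        using suminf_exist_split[OF _ VD(3)[OF z], of "\<tau>\<^sup>2"] \<tau> by simp
      then show ?thesis using that by (metis abs_ge_self order_refl order_le_less_trans real_norm_def)
    qed
    define e' where "e' = e / (4 * (real m + 1))"
    have e': "e' > 0" using e by (simp add: e'_def)
    have "\<forall>c. \<exists>d>0. \<forall>h\<in>Vc c. b c h < d \<longrightarrow> \<bar>(b c (?y c + h))\<^sup>2 - (b c (?y c))\<^sup>2 - E c h\<bar> \<le> e' * b c h"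
      using E(1) e' unfolding fdiff_def by blast
    then obtain d where d: "\<And>c. d c > 0" "\<And>c h. h \<in> Vc c \<Longrightarrow> b c h < d c \<Longrightarrow> \<bar>(b c (?y c + h))\<^sup>2 - (b c (?y c))\<^sup>2 - E c h\<bar> \<le> e' * b c h" by metis
    define d0 where "d0 = Min (insert (e / 4) (d ` {..<m}))"
    have d0: "d0 > 0" "\<And>c. c < m \<Longrightarrow> d0 \<le> d c" using e d(1) by (auto simp: d0_def)
    have d0e: "d0 \<le> e / 4" unfolding d0_def by (rule Min_le) auto
    have "\<bar>(l (z + h))\<^sup>2 - (l z)\<^sup>2 - D h\<bar> \<le> e * \<nu> h" if h: "h \<in> V" and hd: "\<nu> h < d0" for h
    proof -
      have lv: "l h \<le> \<nu> h" using msup_nonneg by (simp add: \<nu>_def)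
      have bv: "b c (slice (Suc c) h) \<le> \<nu> h" for c using b_le_l[OF h, of c] lv by simp
      have \<nu>0: "\<nu> h \<ge> 0" by (rule sn_nonneg[OF \<nu>sn h])
      have head: "\<bar>\<Sum>c<m. err h c\<bar> \<le> e / 2 * \<nu> h"
      proof -
        have "\<bar>err h c\<bar> \<le> e' * \<nu> h" if c: "c < m" for c
        proof -
          have "b c (slice (Suc c) h) < d c" using bv[of c] hd d0(2)[OF c] by linarith
          then have "\<bar>err h c\<bar> \<le> e' * b c (slice (Suc c) h)" using d(2)[OF VD(2)[OF h], of c] by (simp add: err_def)
          also have "\<dots> \<le> e' * \<nu> h" using bv e' by (intro mult_left_mono) auto
          finally show ?thesis .
        qed
        then have "\<bar>\<Sum>c<m. err h c\<bar> \<le> (\<Sum>c<m. e' * \<nu> h)" by (intro order_trans[OF sum_abs] sum_mono) auto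
        also have "\<dots> = (real m * e') * \<nu> h" by simp
        also have "\<dots> \<le> e / 2 * \<nu> h"
        proof (rule mult_right_mono[OF _ \<nu>0])
          show "real m * e' \<le> e / 2" unfolding e'_def using e by (simp add: field_simps)
        qed
        finally show ?thesis .
      qed
      have tail: "\<bar>\<Sum>c. err h (c + m)\<bar> \<le> e / 2 * \<nu> h"
      proof -
        have sz: "summable (\<lambda>c. (b (c + m) (?y (c + m)))\<^sup>2)" by (rule summable_ignore_initial_segment[OF VD(3)[OF z]])
        have sh: "summable (\<lambda>c. (b (c + m) (slice (Suc (c + m)) h))\<^sup>2)" by (rule summable_ignore_initial_segment[OF VD(3)[OF h]])
        have hle: "(\<Sum>c. (b (c + m) (slice (Suc (c + m)) h))\<^sup>2) \<le> (l h)\<^sup>2"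
          unfolding l_square[OF h] suminf_split_initial_segment[OF VD(3)[OF h], of m] by (simp add: sum_nonneg)
        note c2 = l2_cauchy_schwarz[OF sz sh, unfolded abs_of_nonneg[OF bn[OF z]] abs_of_nonneg[OF bn[OF h]]]
        have s2: "sqrt (\<Sum>c. (b (c + m) (slice (Suc (c + m)) h))\<^sup>2) \<le> l h" using hle lnonneg[OF h] by (simp add: real_le_lsqrt)
        have s1: "sqrt (\<Sum>c. (b (c + m) (?y (c + m)))\<^sup>2) \<le> \<tau>" using m \<tau> by (simp add: real_le_lsqrt)
        have "\<bar>\<Sum>c. err h (c + m)\<bar> \<le> (\<Sum>c. 4 * (b (c + m) (?y (c + m)) * b (c + m) (slice (Suc (c + m)) h)) + (b (c + m) (slice (Suc (c + m)) h))\<^sup>2)"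
          using abs_suminf_le[OF summable_add[OF summable_mult[OF c2(1), of 4] sh], of "\<lambda>c. err h (c + m)"] errb[OF h] by simp
        also have "\<dots> = 4 * (\<Sum>c. b (c + m) (?y (c + m)) * b (c + m) (slice (Suc (c + m)) h)) + (\<Sum>c. (b (c + m) (slice (Suc (c + m)) h))\<^sup>2)"
          using suminf_add[OF summable_mult[OF c2(1), of 4] sh] suminf_mult[OF c2(1), of 4] by simp
        also have "\<dots> \<le> 4 * (\<tau> * l h) + (l h)\<^sup>2"
          using c2(2) mult_mono[OF s1 s2] \<tau> hle by (simp add: suminf_nonneg sh)
        also have "\<dots> = (4 * \<tau> + l h) * l h" by (simp add: power2_eq_square algebra_simps)
        also have "\<dots> \<le> (e / 2) * l h"
        proof (rule mult_right_mono[OF _ lnonneg[OF h]])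
          show "4 * \<tau> + l h \<le> e / 2" using lv hd d0e by (simp add: \<tau>_def)
        qed
        also have "\<dots> \<le> e / 2 * \<nu> h" using lv e by (intro mult_left_mono) auto
        finally show ?thesis .
      qed
      have "(\<Sum>c. err h c) = (\<Sum>c. err h (c + m)) + (\<Sum>c<m. err h c)"
        by (rule suminf_split_initial_segment[OF errs(1)[OF h]])
      then show ?thesis unfolding errs(2)[OF h] using head tail by linarith
    qed
    then show ?thesis using d0(1) by blast
  qed
  ultimately show ?thesis unfolding fdiff_def by blast
qed

text \<open>Away from 0 the sum under the root is positive, so the root is differentiable there; the
  derivative is then transferred from \<open>\<nu>\<close> to \<open>N\<close>.\<close>

lemma N_smooth: "smooth_on V N"
  unfolding smooth_on_def
proof (intro ballI impI)
  fix z assume z: "z \<in> V" "z \<noteq> 0"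
  have p: "M z > 0" using sn_nonneg[OF Msn z(1)] Mnorm z by (auto simp: norm_on_def less_le)
  obtain D1 where D1: "fdiff V \<nu> M z D1" using M_fdiff[OF z] by blast
  obtain D2 where D2: "fdiff V \<nu> (\<lambda>z. (l z)\<^sup>2) z D2" using l_square_fdiff[OF z(1)] by blast
  have "((\<lambda>x. x\<^sup>2) has_real_derivative 2 * M z) (at (M z))" by (auto intro!: derivative_eq_intros)
  from fdiff_add[OF \<nu>sn fdiff_chain[OF \<nu>sn D1, OF this] fdiff_cmul[OF \<nu>sn D2, of \<delta>]]
  obtain D3 where D3: "fdiff V \<nu> (\<lambda>z. (M z)\<^sup>2 + \<delta> * (l z)\<^sup>2) z D3" by blast
  have "(M z)\<^sup>2 + \<delta> * (l z)\<^sup>2 > 0" using p pos by (intro add_pos_nonneg) auto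
  then obtain s where "((\<lambda>x. sqrt x / sqrt (1 + \<delta>)) has_real_derivative s) (at ((M z)\<^sup>2 + \<delta> * (l z)\<^sup>2))"
    using DERIV_cdivide[OF DERIV_real_sqrt] by blast
  from fdiff_chain[OF \<nu>sn D3, OF this]
  have "fdiff V \<nu> N z (\<lambda>h. s * D3 h)" using pos by (simp add: N_def[abs_def] power_mult_distrib)
  from fdiff_equiv[OF Nsn \<nu>sn \<nu>_le_N this z(1)] show "\<exists>D. fdiff V N N z D" by blast
qed

end

section \<open>Truncation to finitely many rows, weak limits and separability\<close>

definition trunc :: "nat \<Rightarrow> (nat \<Rightarrow> real) \<Rightarrow> nat \<Rightarrow> real" where
  "trunc m z = (\<lambda>j. if fst (prod_decode j) \<le> m then z j else 0)"

lemma slice_trunc [simp]: "slice c (trunc m z) = (if c \<le> m then slice c z else 0)"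
  by (auto simp: slice_def trunc_def fun_eq_iff)

lemma trunc_linear: "trunc m (x + y) = trunc m x + trunc m y" "trunc m (x - y) = trunc m x - trunc m y"
  by (auto simp: trunc_def fun_eq_iff)

lemma trunc_0: "trunc 0 z = put 0 (slice 0 z)"
  by (rule slice_ext) auto

lemma trunc_Suc: "trunc (Suc m) z = trunc m z + put (Suc m) (slice (Suc m) z)"
  by (rule slice_ext) auto

context amalgam
begin

lemma b_zero: "b c 0 = 0" by (rule sn_zero[OF bsn])

lemma put_0_mem: assumes v: "v \<in> supported k" shows "put 0 v \<in> V" "l (put 0 v) = 0" "\<nu> (put 0 v) = msup k v"
  using v bmem(1) b_zero by (simp_all add: V_def l_def \<nu>_def)

lemma put_Suc_mem: assumes y: "y \<in> Vc c" shows "put (Suc c) y \<in> V" "l (put (Suc c) y) = b c y" "\<nu> (put (Suc c) y) = b c y"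
proof -
  have e: "(b i (slice (Suc i) (put (Suc c) y)))\<^sup>2 = (if i = c then (b c y)\<^sup>2 else 0)" for i
    using b_zero by auto
  have s: "(\<lambda>i. (b i (slice (Suc i) (put (Suc c) y)))\<^sup>2) sums (b c y)\<^sup>2"
    unfolding e by (rule sums_single)
  show "put (Suc c) y \<in> V" using sums_summable[OF s] y bmem(1) subspace_0[OF subspace_supported] by (auto simp: V_def)
  show l: "l (put (Suc c) y) = b c y" unfolding l_def sums_unique[OF s, symmetric] using bnonneg[OF y] by simp
  have "msup k 0 = 0" using msup_scale[of k 0 0] by simp
  then show "\<nu> (put (Suc c) y) = b c y" using l by (simp add: \<nu>_def)
qed

lemma trunc_mem: assumes z: "z \<in> V" shows "trunc m z \<in> V"
proof (induction m)
  case 0 show ?case unfolding trunc_0 by (rule put_0_mem(1)[OF VD(1)[OF z]])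
next
  case (Suc m) show ?case unfolding trunc_Suc by (rule Vmem(2)[OF Suc put_Suc_mem(1)[OF VD(2)[OF z]]])
qed

lemma trunc_l: assumes z: "z \<in> V"
  shows "(l (trunc m z))\<^sup>2 = (\<Sum>c<m. (b c (slice (Suc c) z))\<^sup>2)"
    "(l (z - trunc m z))\<^sup>2 = (l z)\<^sup>2 - (\<Sum>c<m. (b c (slice (Suc c) z))\<^sup>2)"
proof -
  have e: "(b c (slice (Suc c) (trunc m z)))\<^sup>2 = (if c \<in> {..<m} then (b c (slice (Suc c) z))\<^sup>2 else 0)" for c
    using b_zero by auto
  have s: "(\<lambda>c. (b c (slice (Suc c) (trunc m z)))\<^sup>2) sums (\<Sum>c<m. (b c (slice (Suc c) z))\<^sup>2)"
    unfolding e by (rule sums_If_finite_set) simp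
  show "(l (trunc m z))\<^sup>2 = (\<Sum>c<m. (b c (slice (Suc c) z))\<^sup>2)"
    unfolding l_square[OF trunc_mem[OF z]] by (rule sums_unique[OF s, symmetric])
  have "(b c (slice (Suc c) (z - trunc m z)))\<^sup>2 = (b c (slice (Suc c) z))\<^sup>2 - (b c (slice (Suc c) (trunc m z)))\<^sup>2" for c
    using b_zero by simp
  then show "(l (z - trunc m z))\<^sup>2 = (l z)\<^sup>2 - (\<Sum>c<m. (b c (slice (Suc c) z))\<^sup>2)"
    using suminf_diff[OF VD(3)[OF z] sums_summable[OF s]] sums_unique[OF s]
    unfolding l_square[OF Vmem(4)[OF z trunc_mem[OF z]]] l_square[OF z] by simp
qed

lemma trunc_l_le: assumes z: "z \<in> V" shows "l (trunc m z) \<le> l z" "l (z - trunc m z) \<le> l z"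
proof -
  have "(\<Sum>c<m. (b c (slice (Suc c) z))\<^sup>2) \<le> (l z)\<^sup>2"
    unfolding l_square[OF z] by (rule sum_le_suminf[OF VD(3)[OF z]]) auto
  moreover have "0 \<le> (\<Sum>c<m. (b c (slice (Suc c) z))\<^sup>2)" by (simp add: sum_nonneg)
  ultimately show "l (trunc m z) \<le> l z" "l (z - trunc m z) \<le> l z"
    using trunc_l[OF z, of m] lnonneg[OF z] by (auto intro: power2_le_imp_le)
qed

lemma trunc_tendsto: assumes z: "z \<in> V" shows "(\<lambda>m. l (z - trunc m z)) \<longlonglongrightarrow> 0"
proof -
  have "(\<lambda>m. (l z)\<^sup>2 - (\<Sum>c<m. (b c (slice (Suc c) z))\<^sup>2)) \<longlonglongrightarrow> (l z)\<^sup>2 - (l z)\<^sup>2"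
    using summable_LIMSEQ[OF VD(3)[OF z]] unfolding l_square[OF z, symmetric] by (intro tendsto_diff tendsto_const)
  then have "(\<lambda>m. (l (z - trunc m z))\<^sup>2) \<longlonglongrightarrow> 0" by (simp add: trunc_l(2)[OF z])
  from tendsto_real_sqrt[OF this] show ?thesis using lnonneg[OF Vmem(4)[OF z trunc_mem[OF z]]] by simp
qed

lemma \<nu>_eq_l: "slice 0 z = 0 \<Longrightarrow> \<nu> z = l z"
  using msup_scale[of k 0 0] by (simp add: \<nu>_def)

lemma l_disjoint:
  assumes "x \<in> V" "y \<in> V" "\<And>c. slice (Suc c) x = 0 \<or> slice (Suc c) y = 0"
  shows "(l (x + y))\<^sup>2 = (l x)\<^sup>2 + (l y)\<^sup>2"
proof -
  have "(b c (slice (Suc c) (x + y)))\<^sup>2 = (b c (slice (Suc c) x))\<^sup>2 + (b c (slice (Suc c) y))\<^sup>2" for c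
    using assms(3)[of c] b_zero by auto
  then show ?thesis unfolding l_square[OF assms(1)] l_square[OF assms(2)] l_square[OF Vmem(2)[OF assms(1,2)]]
    using suminf_add[OF VD(3)[OF assms(1)] VD(3)[OF assms(2)]] by simp
qed

text \<open>If the tail estimate failed, gluing many disjointly supported blocks would give vectors on which
  the functional grows linearly while the norm grows like a square root.\<close>

lemma tail_small:
  assumes f: "blf V \<nu> f" and e: "e > 0"
  obtains m where "\<And>w. w \<in> V \<Longrightarrow> (\<And>c. c \<le> m \<Longrightarrow> slice c w = 0) \<Longrightarrow> \<bar>f w\<bar> \<le> e * \<nu> w"
proof (rule ccontr)
  assume neg: "\<not> thesis"
  obtain C where C: "C > 0" "\<And>x. x \<in> V \<Longrightarrow> \<bar>f x\<bar> \<le> C * \<nu> x" using blf_bound[OF \<nu>sn f] by blast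
  have block: "\<exists>u\<in>V. \<exists>m'. (\<forall>c\<le>m. slice c u = 0) \<and> trunc m' u = u \<and> l u \<le> 1 \<and> f u \<ge> e / 2" for m
  proof -
    have "\<exists>w. w \<in> V \<and> (\<forall>c\<le>m. slice c w = 0) \<and> \<not> \<bar>f w\<bar> \<le> e * \<nu> w" using neg that[of m] by blast
    then obtain w where w: "w \<in> V" "\<And>c. c \<le> m \<Longrightarrow> slice c w = 0" "\<bar>f w\<bar> > e * \<nu> w" by auto
    have \<nu>l: "\<nu> w = l w" using \<nu>_eq_l w(2) by simp
    have lp: "l w > 0"
    proof (rule ccontr)
      assume "\<not> l w > 0"
      then have "l w = 0" using lnonneg[OF w(1)] by simp
      then show False using w(3) C(2)[OF w(1)] \<nu>l by simp
    qed
    define w1 where "w1 = (sgn (f w) / l w) *\<^sub>R w"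
    have w1: "w1 \<in> V" "\<And>c. c \<le> m \<Longrightarrow> slice c w1 = 0" using w Vmem by (auto simp: w1_def)
    have "f w1 = \<bar>f w\<bar> / l w" using blf_scale[OF \<nu>sn f w(1)] by (simp add: w1_def sgn_mult_self_eq abs_sgn mult.commute)
    then have "e * l w < f w1 * l w" using w(3) lp \<nu>l by simp
    then have fw1: "f w1 > e" using lp by (simp add: mult_less_cancel_right)
    have "f w \<noteq> 0" using fw1 \<open>f w1 = \<bar>f w\<bar> / l w\<close> e by auto
    then have lw1: "l w1 = 1" using V_scale(2)[OF w(1)] lp by (simp add: w1_def abs_sgn_eq)
    have "eventually (\<lambda>m. l (w1 - trunc m w1) < e / (2 * C)) sequentially"
      using order_tendstoD(2)[OF trunc_tendsto[OF w1(1)], of "e / (2 * C)"] e C by simp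
    then obtain m' where m': "l (w1 - trunc m' w1) < e / (2 * C)" by (auto simp: eventually_sequentially)
    define u where "u = trunc m' w1"
    have "slice 0 (w1 - u) = 0" by (simp add: u_def)
    then have "\<bar>f (w1 - u)\<bar> \<le> C * l (w1 - u)" using C(2)[of "w1 - u"] \<nu>_eq_l Vmem w1 trunc_mem by (simp add: u_def)
    also have "\<dots> < C * (e / (2 * C))" by (rule mult_strict_left_mono) (use m' C(1) in \<open>auto simp: u_def\<close>)
    also have "\<dots> = e / 2" using C by simp
    finally have "\<bar>f w1 - f u\<bar> < e / 2" using blf_diff[OF \<nu>sn f w1(1) trunc_mem[OF w1(1)]] by (simp add: u_def)
    then have "f u \<ge> e / 2" using fw1 by linarith
    moreover have "trunc m' u = u" by (rule slice_ext) (simp add: u_def)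
    moreover have "l u \<le> 1" using trunc_l_le(1)[OF w1(1)] lw1 by (simp add: u_def)
    moreover have "\<forall>c\<le>m. slice c u = 0" using w1(2) by (simp add: u_def)
    ultimately show ?thesis using trunc_mem[OF w1(1)] u_def by blast
  qed
  have glue: "\<exists>u\<in>V. \<exists>m. trunc m u = u \<and> slice 0 u = 0 \<and> (l u)\<^sup>2 \<le> real n \<and> f u \<ge> real n * (e / 2)" for n
  proof (induction n)
    case 0
    have "trunc 0 0 = 0" by (rule slice_ext) simp
    then have "trunc 0 0 = 0 \<and> slice 0 0 = 0 \<and> (l 0)\<^sup>2 \<le> real 0 \<and> f 0 \<ge> real 0 * (e / 2)"
      using V_zero(2) blf_zero[OF \<nu>sn f] by (simp del: slice_trunc)
    then show ?case using Vmem(1) by blast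
  next
    case (Suc n)
    then obtain u m where u: "u \<in> V" "trunc m u = u" "slice 0 u = 0" "(l u)\<^sup>2 \<le> real n" "f u \<ge> real n * (e / 2)" by blast
    obtain w m' where w: "w \<in> V" "\<And>c. c \<le> m \<Longrightarrow> slice c w = 0" "trunc m' w = w" "l w \<le> 1" "f w \<ge> e / 2" using block[of m] by blast
    have us: "slice c u = 0" if "c > m" for c using arg_cong[OF u(2), of "slice c"] that by simp
    have ws: "slice c w = 0" if "c > m'" for c using arg_cong[OF w(3), of "slice c"] that by simp
    have "(l (u + w))\<^sup>2 = (l u)\<^sup>2 + (l w)\<^sup>2" by (rule l_disjoint[OF u(1) w(1)]) (meson not_le us w(2))
    moreover have "(l w)\<^sup>2 \<le> 1" using w(4) lnonneg[OF w(1)] by (simp add: power_le_one)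
    ultimately have "(l (u + w))\<^sup>2 \<le> real (Suc n)" using u(4) by simp
    moreover have "f (u + w) \<ge> real (Suc n) * (e / 2)" using blf_add[OF \<nu>sn f u(1) w(1)] u(5) w(5) by (simp add: algebra_simps)
    moreover have "trunc (max m m') (u + w) = u + w" by (rule slice_ext) (auto simp: us ws)
    moreover have "slice 0 (u + w) = 0" using u(3) w(2) by simp
    ultimately show ?case using Vmem(2)[OF u(1) w(1)] by blast
  qed
  obtain n :: nat where n: "real n > (2 * C / e)\<^sup>2" using reals_Archimedean2 by blast
  obtain u where u: "u \<in> V" "slice 0 u = 0" "(l u)\<^sup>2 \<le> real n" "f u \<ge> real n * (e / 2)" using glue[of n] by blast
  have "real n > 0" using n by (meson le_less_trans zero_le_power2)
  have "l u \<le> sqrt (real n)" using u(3) by (simp add: real_le_rsqrt)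
  then have "C * l u \<le> C * sqrt (real n)" by (rule mult_left_mono) (use C(1) in simp)
  moreover have "f u \<le> C * l u" using C(2)[OF u(1)] \<nu>_eq_l[OF u(2)] by simp
  ultimately have "f u \<le> C * sqrt (real n)" by linarith
  moreover have "real n * (e / 2) = sqrt (real n) * (sqrt (real n) * (e / 2))" by (simp add: mult.assoc[symmetric])
  ultimately have "sqrt (real n) * (sqrt (real n) * (e / 2)) \<le> sqrt (real n) * C" using u(4) by (simp only: mult.commute[of C])
  then have "sqrt (real n) * (e / 2) \<le> C" using \<open>real n > 0\<close> by (subst (asm) mult_le_cancel_left_pos) auto
  then have "sqrt (real n) \<le> 2 * C / e" using e by (simp add: field_simps)
  then have "(sqrt (real n))\<^sup>2 \<le> (2 * C / e)\<^sup>2" by (intro power_mono) auto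
  then show False using n by simp
qed

lemma N_bound_parts: assumes z: "z \<in> V" shows "msup k (slice 0 z) \<le> C\<nu> * N z" "l z \<le> C\<nu> * N z" "b c (slice (Suc c) z) \<le> C\<nu> * N z"
  using \<nu>_le_N[OF z] msup_nonneg[of k "slice 0 z"] lnonneg[OF z] b_le_l[OF z, of c] by (auto simp: \<nu>_def)

lemma C\<nu>_pos: "C\<nu> > 0" using pos by (simp add: C\<nu>_def add_pos_pos)

lemma N_coord: "\<exists>C. \<forall>z\<in>V. \<bar>z i\<bar> \<le> C * N z"
proof -
  obtain c j where cj: "i = prod_encode (c, j)" by (metis prod_decode_inverse surj_pair)
  show ?thesis
  proof (cases c)
    case 0
    have "\<bar>z i\<bar> \<le> C\<nu> * N z" if z: "z \<in> V" for z
    proof -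
      have "\<bar>slice 0 z j\<bar> \<le> msup k (slice 0 z)"
        using VD(1)[OF z] msup_nonneg[of k "slice 0 z"] by (cases "j < k") (auto intro: msup_upper simp: supported_def)
      then show ?thesis using N_bound_parts(1)[OF z] cj 0 by (simp add: slice_def)
    qed
    then show ?thesis by blast
  next
    case (Suc c')
    obtain C where C: "\<forall>y\<in>Vc c'. \<bar>y j\<bar> \<le> C * b c' y" using good_coord[OF good] by blast
    have "\<bar>z i\<bar> \<le> \<bar>C\<bar> * C\<nu> * N z" if z: "z \<in> V" for z
    proof -
      have "\<bar>slice (Suc c') z j\<bar> \<le> C * b c' (slice (Suc c') z)" using C VD(2)[OF z] by blast
      also have "\<dots> \<le> \<bar>C\<bar> * b c' (slice (Suc c') z)" using bnonneg[OF VD(2)[OF z]] by (intro mult_right_mono) auto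
      also have "\<dots> \<le> \<bar>C\<bar> * (C\<nu> * N z)" using N_bound_parts(3)[OF z] by (intro mult_left_mono) auto
      finally show ?thesis using cj Suc by (simp add: slice_def mult.assoc)
    qed
    then show ?thesis by blast
  qed
qed

text \<open>Rows converge weakly in their own spaces, and their limits stay square summable. A
  functional converges on truncations, and by \<open>tail_small\<close> the remaining rows
  contribute uniformly little.\<close>

lemma N_weak: "coordinatewise_weak V N"
  unfolding coordinatewise_weak_def
proof (intro allI impI)
  fix s x C assume sC: "\<forall>n. s n \<in> V \<and> N (s n) \<le> C" and lim: "\<forall>i. (\<lambda>n. s n i) \<longlonglongrightarrow> x i"
  have s: "\<And>n. s n \<in> V" and NC: "\<And>n. N (s n) \<le> C" using sC by auto
  define C' where "C' = C\<nu> * C"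
  have nC: "C\<nu> * N (s n) \<le> C'" for n using NC C\<nu>_pos by (simp add: C'_def)
  have lb: "l (s n) \<le> C'" and bb: "b c (slice (Suc c) (s n)) \<le> C'" for n c
    using N_bound_parts(2)[OF s] N_bound_parts(3)[OF s] nC by (meson order_trans)+
  have C'0: "C' \<ge> 0" using lb[of 0] lnonneg[OF s[of 0]] by simp
  have slim: "(\<lambda>n. slice c (s n) i) \<longlonglongrightarrow> slice c x i" for c i using lim by (simp add: slice_def)
  have v: "slice 0 x \<in> supported k" unfolding supported_def
  proof clarify
    fix i assume "k \<le> i"
    then have "(\<lambda>n. slice 0 (s n) i) = (\<lambda>n. 0)" using VD(1)[OF s] by (auto simp: supported_def)
    then show "slice 0 x i = 0" using slim[of 0 i] by (simp add: LIMSEQ_const_iff)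
  qed
  note wc = weak_limit[OF good_weak[OF good], of "\<lambda>n. slice (Suc _) (s n)", OF VD(2)[OF s] bb slim]
  \<comment> \<open>Lower semicontinuity of \<open>m\<close> row norms simultaneously: each is
    replaced by a norming functional at the limit row.\<close>
  have part: "(\<Sum>c<m. (b c (slice (Suc c) x))\<^sup>2) \<le> C'\<^sup>2" for m
  proof -
    have "\<exists>L. blf (Vc c) (b c) L \<and> L (slice (Suc c) x) = b c (slice (Suc c) x) \<and> (\<forall>y\<in>Vc c. \<bar>L y\<bar> \<le> b c y)" for c
      using smooth_norming[OF good_norm[OF good] good_smooth[OF good] wc(1)] by metis
    then obtain L where L: "\<And>c. blf (Vc c) (b c) (L c)" "\<And>c. L c (slice (Suc c) x) = b c (slice (Suc c) x)"
      "\<And>c y. y \<in> Vc c \<Longrightarrow> \<bar>L c y\<bar> \<le> b c y" by metis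
    have lm: "(\<lambda>n. L c (slice (Suc c) (s n))) \<longlonglongrightarrow> b c (slice (Suc c) x)" for c
      using wc(2)[OF L(1)] L(2) by metis
    have "(\<lambda>n. \<Sum>c<m. (L c (slice (Suc c) (s n)))\<^sup>2) \<longlonglongrightarrow> (\<Sum>c<m. (b c (slice (Suc c) x))\<^sup>2)"
      by (intro tendsto_sum tendsto_power lm)
    then show ?thesis
    proof (rule LIMSEQ_le_const2, intro exI[of _ 0] allI impI)
      fix n
      have "(\<Sum>c<m. (L c (slice (Suc c) (s n)))\<^sup>2) \<le> (\<Sum>c<m. (b c (slice (Suc c) (s n)))\<^sup>2)"
        using L(3)[OF VD(2)[OF s]] by (intro sum_mono) (metis abs_ge_zero power2_abs power_mono)
      also have "\<dots> \<le> (l (s n))\<^sup>2" unfolding l_square[OF s] by (rule sum_le_suminf[OF VD(3)[OF s]]) auto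
      also have "\<dots> \<le> C'\<^sup>2" using lb lnonneg[OF s] by (intro power_mono) auto
      finally show "(\<Sum>c<m. (L c (slice (Suc c) (s n)))\<^sup>2) \<le> C'\<^sup>2" .
    qed
  qed
  have "summable (\<lambda>c. (b c (slice (Suc c) x))\<^sup>2)"
    by (rule bounded_imp_summable[where B="C'\<^sup>2"]) (use part[of "Suc _"] in \<open>auto simp: lessThan_Suc_atMost\<close>)
  then have x: "x \<in> V" using v wc(1) by (simp add: V_def)
  moreover have "(\<lambda>n. f (s n)) \<longlonglongrightarrow> f x" if fN: "blf V N f" for f
  proof -
    have f: "blf V \<nu> f" by (rule blf_equiv[OF \<nu>sn Nsn N_le_\<nu> fN])
    obtain Cf where Cf: "Cf > 0" "\<And>x. x \<in> V \<Longrightarrow> \<bar>f x\<bar> \<le> Cf * \<nu> x" using blf_bound[OF \<nu>sn f] by blast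
    have head: "(\<lambda>n. f (put 0 (slice 0 (s n)))) \<longlonglongrightarrow> f (put 0 (slice 0 x))"
    proof -
      have sup: "slice 0 (s n) - slice 0 x \<in> supported k" for n by (intro subspace_diff[OF subspace_supported] v VD(1) s)
      have "(\<lambda>n. Cf * (\<Sum>i<k. \<bar>slice 0 (s n) i - slice 0 x i\<bar>)) \<longlonglongrightarrow> Cf * (\<Sum>i<k. \<bar>slice 0 x i - slice 0 x i\<bar>)"
        by (intro tendsto_intros slim)
      then have t: "(\<lambda>n. Cf * (\<Sum>i<k. \<bar>slice 0 (s n) i - slice 0 x i\<bar>)) \<longlonglongrightarrow> 0" by simp
      have "(\<lambda>n. f (put 0 (slice 0 (s n))) - f (put 0 (slice 0 x))) \<longlonglongrightarrow> 0"
      proof (rule Lim_null_comparison[OF always_eventually t], rule allI)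
        fix n
        have "f (put 0 (slice 0 (s n))) - f (put 0 (slice 0 x)) = f (put 0 (slice 0 (s n) - slice 0 x))"
          using blf_diff[OF \<nu>sn f put_0_mem(1)[OF VD(1)[OF s]] put_0_mem(1)[OF v]] by simp
        moreover have "\<bar>f (put 0 (slice 0 (s n) - slice 0 x))\<bar> \<le> Cf * msup k (slice 0 (s n) - slice 0 x)"
          using Cf(2)[OF put_0_mem(1)[OF sup]] put_0_mem(3)[OF sup] by simp
        moreover have "Cf * msup k (slice 0 (s n) - slice 0 x) \<le> Cf * (\<Sum>i<k. \<bar>slice 0 (s n) i - slice 0 x i\<bar>)"
        proof (rule mult_left_mono)
          show "msup k (slice 0 (s n) - slice 0 x) \<le> (\<Sum>i<k. \<bar>slice 0 (s n) i - slice 0 x i\<bar>)"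
            by (rule msup_least) (auto simp: sum_nonneg intro!: member_le_sum[of _ _ "\<lambda>i. \<bar>slice 0 (s n) i - slice 0 x i\<bar>"])
        qed (use Cf(1) in simp)
        ultimately show "norm (f (put 0 (slice 0 (s n))) - f (put 0 (slice 0 x))) \<le> Cf * (\<Sum>i<k. \<bar>slice 0 (s n) i - slice 0 x i\<bar>)"
          by (simp only: real_norm_def)
      qed
      then show ?thesis by (rule LIM_zero_cancel)
    qed
    have Sc: "(\<lambda>n. f (put (Suc c) (slice (Suc c) (s n)))) \<longlonglongrightarrow> f (put (Suc c) (slice (Suc c) x))" for c
    proof -
      have "blf (Vc c) (b c) (\<lambda>y. f (put (Suc c) y))"
      proof (rule blfI[OF bsn, where C=Cf])
        show "\<bar>f (put (Suc c) y)\<bar> \<le> Cf * b c y" if "y \<in> Vc c" for y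
          using Cf(2)[OF put_Suc_mem(1)[OF that]] put_Suc_mem(3)[OF that] by simp
      qed (simp_all add: put_Suc_mem(1) blf_add[OF \<nu>sn f] blf_scale[OF \<nu>sn f])
      from wc(2)[OF this] show ?thesis .
    qed
    have tr: "(\<lambda>n. f (trunc m (s n))) \<longlonglongrightarrow> f (trunc m x)" for m
    proof (induction m)
      case 0 then show ?case using head by (simp add: trunc_0)
    next
      case (Suc m)
      have "f (trunc (Suc m) z) = f (trunc m z) + f (put (Suc m) (slice (Suc m) z))" if "z \<in> V" for z
        unfolding trunc_Suc using blf_add[OF \<nu>sn f trunc_mem[OF that] put_Suc_mem(1)[OF VD(2)[OF that]]] .
      then show ?case using tendsto_add[OF Suc Sc[of m]] s x by simp
    qed
    show ?thesis
    proof (rule LIMSEQ_I)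
      fix e :: real assume e: "e > 0"
      \<comment> \<open>Bounds \<open>l (s n - x)\<close> for all \<open>n\<close>;
        \<open>e'\<close> is chosen so that the tail costs at most \<open>e / 2\<close>.\<close>
      define D where "D = C' + l x"
      have D0: "D \<ge> 0" using C'0 lnonneg[OF x] by (simp add: D_def)
      define e' where "e' = e / (2 * (D + 1))"
      have e': "e' > 0" using e D0 by (simp add: e'_def)
      obtain m where m: "\<And>w. w \<in> V \<Longrightarrow> (\<And>c. c \<le> m \<Longrightarrow> slice c w = 0) \<Longrightarrow> \<bar>f w\<bar> \<le> e' * \<nu> w"
        using tail_small[OF f e'] by blast
      obtain n0 where n0: "\<And>n. n \<ge> n0 \<Longrightarrow> \<bar>f (trunc m (s n)) - f (trunc m x)\<bar> < e / 2"
        using LIMSEQ_D[OF tr[of m], of "e / 2"] e by auto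
      have "norm (f (s n) - f x) < e" if n: "n \<ge> n0" for n
      proof -
        let ?w = "s n - x"
        have w: "?w \<in> V" using Vmem(4) s x by blast
        have "\<bar>f (?w - trunc m ?w)\<bar> \<le> e' * \<nu> (?w - trunc m ?w)" by (rule m) (use Vmem(4)[OF w trunc_mem[OF w]] in auto)
        also have "\<nu> (?w - trunc m ?w) = l (?w - trunc m ?w)" by (rule \<nu>_eq_l) simp
        also have "e' * l (?w - trunc m ?w) \<le> e' * D"
        proof (rule mult_left_mono)
          have "l (?w - trunc m ?w) \<le> l ?w" by (rule trunc_l_le(2)[OF w])
          also have "\<dots> \<le> l (s n) + l x" by (rule sn_diff[OF lsn s x])
          finally show "l (?w - trunc m ?w) \<le> D" using lb[of n] by (simp add: D_def)
        qed (use e' in simp)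
        also have "\<dots> \<le> e / 2" unfolding e'_def using e D0 by (simp add: field_simps)
        finally have "\<bar>f (?w - trunc m ?w)\<bar> \<le> e / 2" .
        moreover have "f (?w - trunc m ?w) = (f (s n) - f x) - (f (trunc m (s n)) - f (trunc m x))"
          using blf_diff[OF \<nu>sn f w trunc_mem[OF w]] blf_diff[OF \<nu>sn f s x] blf_diff[OF \<nu>sn f trunc_mem[OF s] trunc_mem[OF x]]
          by (simp add: trunc_linear)
        ultimately have "\<bar>(f (s n) - f x) - (f (trunc m (s n)) - f (trunc m x))\<bar> \<le> e / 2" by simp
        then show ?thesis using n0[OF n] unfolding real_norm_def by linarith
      qed
      then show "\<exists>no. \<forall>n\<ge>no. norm (f (s n) - f x) < e" by blast
    qed
  qed
  ultimately show "x \<in> V \<and> (\<forall>f. blf V N f \<longrightarrow> (\<lambda>n. f (s n)) \<longlonglongrightarrow> f x)" by blast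
qed

lemma separable_supported:
  obtains D where "countable D" "D \<subseteq> supported k" "\<And>v e. v \<in> supported k \<Longrightarrow> e > 0 \<Longrightarrow> \<exists>d\<in>D. msup k (v - d) < e"
proof -
  define D where "D = (\<lambda>xs i. if i < k then (xs ! i :: real) else 0) ` lists \<rat>"
  have "countable D" unfolding D_def by (intro countable_image countable_lists countable_rat)
  moreover have "D \<subseteq> supported k" by (auto simp: D_def supported_def)
  moreover have "\<exists>d\<in>D. msup k (v - d) < e" if v: "v \<in> supported k" and e: "e > 0" for v e
  proof -
    have "\<exists>x\<in>\<rat>. v i - e / 2 < x \<and> x < v i" for i using Rats_dense_in_real[of "v i - e / 2" "v i"] e by auto
    then obtain x where x: "\<And>i. x i \<in> \<rat>" "\<And>i. v i - e / 2 < x i" "\<And>i. x i < v i" by metis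
    define d where "d = (\<lambda>i. if i < k then (map x [0..<k] ! i :: real) else 0)"
    have "d \<in> D" unfolding D_def d_def using x(1) by (intro imageI) auto
    moreover have "msup k (v - d) \<le> e / 2"
    proof (rule msup_least)
      show "\<bar>(v - d) i\<bar> \<le> e / 2" if "i < k" for i using x(2,3)[of i] that by (simp add: d_def)
    qed (use e in simp)
    ultimately show ?thesis using e by force
  qed
  ultimately show ?thesis using that by blast
qed

text \<open>Finite lists of points from the dense sets approximate a truncation; the three errors
  come from the omitted rows, the common part and the kept rows.\<close>

lemma N_separable: "separable_on V N"
proof -
  obtain D0 where D0: "countable D0" "D0 \<subseteq> supported k" "\<And>v e. v \<in> supported k \<Longrightarrow> e > 0 \<Longrightarrow> \<exists>d\<in>D0. msup k (v - d) < e"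
    using separable_supported by metis
  have "\<exists>D. countable D \<and> D \<subseteq> Vc c \<and> (\<forall>y\<in>Vc c. \<forall>e>0. \<exists>d\<in>D. b c (y - d) < e)" for c
    using good_separable[OF good, of c] by (simp add: separable_on_def)
  then obtain D where D: "\<And>c. countable (D c)" "\<And>c. D c \<subseteq> Vc c" "\<And>c y e. y \<in> Vc c \<Longrightarrow> e > 0 \<Longrightarrow> \<exists>d\<in>D c. b c (y - d) < e" by metis
  \<comment> \<open>A list may place a point of one dense set into a row of another space;
    intersecting with \<open>V\<close> discards such vectors.\<close>
  define E where "E = (\<lambda>(v, ys). put 0 v + (\<Sum>c<length ys. put (Suc c) (ys ! c))) ` (D0 \<times> lists (\<Union>c. D c)) \<inter> V"
  have "countable E" unfolding E_def using D0(1) D(1) by (intro countable_Int1 countable_image countable_SIGMA countable_lists countable_UN) auto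
  moreover have "\<exists>d\<in>E. N (z - d) < e" if z: "z \<in> V" and e: "e > 0" for z e
  proof -
    define e' where "e' = e / (CN + 1) / 3"
    have CN: "CN > 0" using pos by (simp add: CN_def add_pos_pos)
    have e': "e' > 0" using e CN by (simp add: e'_def)
    obtain m where m: "l (z - trunc m z) < e'"
      using order_tendstoD(2)[OF trunc_tendsto[OF z] e'] by (auto simp: eventually_sequentially)
    obtain v where v: "v \<in> D0" "msup k (slice 0 z - v) < e'" using D0(3)[OF VD(1)[OF z] e'] by blast
    have "\<exists>d\<in>D c. b c (slice (Suc c) z - d) < e' / (real m + 1)" for c
      by (rule D(3)[OF VD(2)[OF z]]) (use e' in simp)
    then obtain y where y: "\<And>c. y c \<in> D c" "\<And>c. b c (slice (Suc c) z - y c) < e' / (real m + 1)" by metis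
    define d where "d = put 0 v + (\<Sum>c<m. put (Suc c) (y c))"
    have yV: "y c \<in> Vc c" and vs: "v \<in> supported k" for c using y(1) D(2) v(1) D0(2) by auto
    have sV: "(\<Sum>c<m. put (Suc c) (y c)) \<in> V" using sn_sum[OF \<nu>sn, of "{..<m}"] put_Suc_mem(1)[OF yV] by auto
    then have dV: "d \<in> V" unfolding d_def using put_0_mem(1)[OF vs] Vmem by auto
    have "d = (\<lambda>(v, ys). put 0 v + (\<Sum>c<length ys. put (Suc c) (ys ! c))) (v, map y [0..<m])" by (simp add: d_def)
    moreover have "map y [0..<m] \<in> lists (\<Union>c. D c)" unfolding in_lists_conv_set set_map using y(1) by blast
    ultimately have "d \<in> E" unfolding E_def using dV v(1)
      by (intro IntI image_eqI[where x="(v, map y [0..<m])"]) (auto simp del: UN_iff)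
    have tr: "trunc m z - d = put 0 (slice 0 z - v) + (\<Sum>c<m. put (Suc c) (slice (Suc c) z - y c))"
    proof -
      have "trunc m z = put 0 (slice 0 z) + (\<Sum>c<m. put (Suc c) (slice (Suc c) z))"
        by (induction m) (simp_all add: trunc_0 trunc_Suc add.assoc)
      then show ?thesis by (simp add: d_def sum_subtractf algebra_simps)
    qed
    have y2: "slice (Suc c) z - y c \<in> Vc c" and v2: "slice 0 z - v \<in> supported k" for c
      using bmem(4)[OF VD(2)[OF z] yV] subspace_diff[OF subspace_supported VD(1)[OF z] vs] by auto
    have "\<nu> (\<Sum>c<m. put (Suc c) (slice (Suc c) z - y c)) \<le> (\<Sum>c<m. \<nu> (put (Suc c) (slice (Suc c) z - y c)))"
      and s2: "(\<Sum>c<m. put (Suc c) (slice (Suc c) z - y c)) \<in> V"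
      using sn_sum[OF \<nu>sn finite_lessThan, of m "\<lambda>c. put (Suc c) (slice (Suc c) z - y c)"] put_Suc_mem(1)[OF y2] by auto
    moreover have "(\<Sum>c<m. \<nu> (put (Suc c) (slice (Suc c) z - y c))) \<le> (\<Sum>c<m. e' / (real m + 1))"
      using y(2) by (intro sum_mono) (simp add: put_Suc_mem(3)[OF y2] less_imp_le del: put_linear)
    moreover have "(\<Sum>c<m. e' / (real m + 1)) \<le> e'" using e' by (simp add: field_simps)
    ultimately have "\<nu> (\<Sum>c<m. put (Suc c) (slice (Suc c) z - y c)) \<le> e'" by linarith
    then have "\<nu> (trunc m z - d) < e' + e'" unfolding tr
      using sn_tri[OF \<nu>sn put_0_mem(1)[OF v2] s2] put_0_mem(3)[OF v2] v(2) by linarith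
    moreover have "\<nu> (z - trunc m z) < e'" using m \<nu>_eq_l[of "z - trunc m z"] by simp
    moreover have "\<nu> (z - d) \<le> \<nu> (z - trunc m z) + \<nu> (trunc m z - d)"
      using sn_tri[OF \<nu>sn Vmem(4)[OF z trunc_mem[OF z, of m]] Vmem(4)[OF trunc_mem[OF z, of m] dV]] by simp
    ultimately have "\<nu> (z - d) \<le> 3 * e'" by linarith
    then have "N (z - d) \<le> CN * (3 * e')" using N_le_\<nu>[OF Vmem(4)[OF z dV]] CN mult_left_mono[of "\<nu> (z - d)" "3 * e'" CN] by linarith
    also have "\<dots> < (CN + 1) * (3 * e')" using e' by simp
    also have "\<dots> = e" using CN by (simp add: e'_def divide_eq_eq)
    finally show ?thesis using \<open>d \<in> E\<close> by blast
  qed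
  ultimately show ?thesis unfolding separable_on_def by (intro exI[of _ E]) (auto simp: E_def)
qed

end

section \<open>Local uniform rotundity of the amalgamated norm\<close>

lemma lur_strict:
  assumes N: "norm_on V N" and l: "lur_on V N" and x: "x \<in> V" "y \<in> V" and e: "N y = N x" "N (x + y) = 2 * N x"
  shows "x = y"
proof -
  have "(\<lambda>k::nat. N (y - x)) \<longlonglongrightarrow> 0"
    using l[unfolded lur_on_def, rule_format, of x "\<lambda>_. y"] x e by simp
  then have "N (y - x) = 0" by (simp add: LIMSEQ_const_iff)
  then show ?thesis using N x sn_mem(4)[OF norm_on_seminorm[OF N]] by (auto simp: norm_on_def)
qed

context amalgam
begin

text \<open>At a midpoint on the sphere some term of \<open>Ps m\<close> is active, and its
  convexity estimate must be an equality. For the \<open>lam\<close> term strict convexity of even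
  powers applies, for a row term the rotundity of \<open>b c\<close>.\<close>

lemma M_rotund:
  assumes x: "x \<in> V" "M x = 1" and z: "z \<in> V" "M z = 1" and mid: "M ((1 / 2) *\<^sub>R x + (1 - 1 / 2) *\<^sub>R z) = 1"
    and eq: "\<And>c. slice (Suc c) x = slice (Suc c) z"
  shows "slice 0 x = slice 0 z"
proof -
  define w where "w = (1 / 2) *\<^sub>R x + (1 - 1 / 2) *\<^sub>R z"
  have w: "w \<in> V" "M w = 1" using Vmem x z mid by (simp_all add: w_def)
  have "\<exists>m0. \<forall>m\<ge>m0. Ps m u = 1" if u: "u \<in> V" "M u = 1" for u
  proof -
    have "u \<in> K" using M_le1[OF u(1)] u(2) by simp
    obtain d m0 where d: "d > 0" "\<And>m w. m0 \<le> m \<Longrightarrow> w \<in> V \<Longrightarrow> \<nu> (w - u) < d \<Longrightarrow> (w \<in> K \<longleftrightarrow> Ps m w \<le> 1)"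
      using Ps_locally_const[OF u(1) K_msup_less[OF \<open>u \<in> K\<close>]] by metis
    have "Ps m u = 1" if "m \<ge> m0" for m by (rule Ps_eq_1[OF u d(1)]) (rule d(2)[OF that])
    then show ?thesis by blast
  qed
  from this[OF x] this[OF z] this[OF w] obtain m1 m2 m3 where
    "\<And>m. m \<ge> m1 \<Longrightarrow> Ps m x = 1" "\<And>m. m \<ge> m2 \<Longrightarrow> Ps m z = 1" "\<And>m. m \<ge> m3 \<Longrightarrow> Ps m w = 1" by metis
  then obtain m where P: "Ps m x = 1" "Ps m z = 1" "Ps m w = 1" by (metis max.cobounded1 max.cobounded2 le_max_iff_disj)
  define A where "A u = (max 0 (lam (slice 0 u) - 1))\<^sup>2" for u
  define E where "E c u = (max 0 (b c (L c u) - \<theta>))\<^sup>2" for c u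
  have PA: "Ps m u = A u / \<gamma>\<^sup>2 + (\<Sum>c<m. E c u / (1 - \<theta>)\<^sup>2)" for u by (simp add: Ps_def A_def E_def)
  have Ale: "2 * A w \<le> A x + A z"
    using lam_term_convex[of "1 / 2" "slice 0 x" "slice 0 z"] by (simp add: A_def w_def)
  have Ele: "2 * E c w \<le> E c x + E c z" for c
    using bL_term_convex[of "1 / 2" x z c] x z by (simp add: E_def w_def)
  define dA where "dA = (A x + A z - 2 * A w) / \<gamma>\<^sup>2"
  define dE where "dE c = (E c x + E c z - 2 * E c w) / (1 - \<theta>)\<^sup>2" for c
  have d0: "dA \<ge> 0" "\<And>c. dE c \<ge> 0" using Ale Ele by (simp_all add: dA_def dE_def)
  have "dA + (\<Sum>c<m. dE c) = Ps m x + Ps m z - 2 * Ps m w"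
    by (simp add: dA_def dE_def PA sum.distrib sum_subtractf sum_distrib_left add_divide_distrib diff_divide_distrib)
  then have sum0: "dA + (\<Sum>c<m. dE c) = 0" using P by simp
  moreover have "(\<Sum>c<m. dE c) \<ge> 0" using d0 by (simp add: sum_nonneg)
  ultimately have "dA = 0" "(\<Sum>c<m. dE c) = 0" using d0(1) by linarith+
  then have "dE c = 0" if "c < m" for c using sum_nonneg_eq_0_iff[of "{..<m}" dE] d0 that by auto
  then have Eeq: "2 * E c w = E c x + E c z" if "c < m" for c using that pos by (auto simp: dE_def)
  have Aeq: "2 * A w = A x + A z" using \<open>dA = 0\<close> pos by (simp add: dA_def)
  have "A w \<noteq> 0 \<or> (\<exists>c<m. E c w \<noteq> 0)"
  proof (rule ccontr)
    assume "\<not> ?thesis"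
    then have "Ps m w = 0" by (simp add: PA)
    then show False using P by simp
  qed
  then show ?thesis
  proof
    assume "A w \<noteq> 0"
    then have p: "lam (slice 0 w) - 1 > 0" by (auto simp: A_def)
    have le: "lam (slice 0 w) - 1 \<le> ((lam (slice 0 x) - 1) + (lam (slice 0 z) - 1)) / 2"
      using lam_convex[of "1 / 2" "slice 0 x" "slice 0 z"] by (simp add: w_def field_simps)
    have st: "lam (slice 0 x) = lam (slice 0 z)" "lam (slice 0 w) = lam (slice 0 x)"
      using pos_part_square_strict[OF le p] Aeq by (simp_all add: A_def)
    define g where "g i = (a * slice 0 x i) ^ (2 * q) + (a * slice 0 z i) ^ (2 * q) - 2 * (a * slice 0 w i) ^ (2 * q)" for i
    have aw: "a * slice 0 w i = (a * slice 0 x i + a * slice 0 z i) / 2" for i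
      by (simp add: w_def slice_def field_simps)
    have "0 \<le> g i" for i
      using even_power_convex[of "1 / 2" "a * slice 0 x i" "a * slice 0 z i" q] unfolding g_def aw by (simp add: field_simps)
    moreover have "(\<Sum>i<k. g i) = 0" using st by (simp add: g_def lam_def sum.distrib sum_subtractf sum_distrib_left[symmetric])
    ultimately have "g i = 0" if "i < k" for i using sum_nonneg_eq_0_iff[of "{..<k}" g] that by auto
    then have "a * slice 0 x i = a * slice 0 z i" if "i < k" for i
      using even_power_strict[OF pos(8), of "a * slice 0 x i" "a * slice 0 z i"] that unfolding g_def aw by simp
    then show ?thesis using apos VD(1)[OF x(1)] VD(1)[OF z(1)] by (auto simp: supported_def fun_eq_iff) (metis not_le)
  next
    assume "\<exists>c<m. E c w \<noteq> 0"
    then obtain c where c: "c < m" "E c w \<noteq> 0" by blast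
    have p: "b c (L c w) - \<theta> > 0" using c(2) by (auto simp: E_def)
    have le: "b c (L c w) - \<theta> \<le> ((b c (L c x) - \<theta>) + (b c (L c z) - \<theta>)) / 2"
      using bL_convex[of "1 / 2" x z c] x z by (simp add: w_def field_simps)
    have st: "b c (L c x) = b c (L c z)" "b c (L c w) = b c (L c x)"
      using pos_part_square_strict[OF le p] Eeq[OF c(1)] by (simp_all add: E_def)
    have "L c w = (1 / 2) *\<^sub>R (L c x + L c z)" by (simp add: w_def L_linear scaleR_add_right)
    then have "b c (L c w) = 1 / 2 * b c (L c x + L c z)"
      using sn_scale[OF bsn bmem(2)[OF L_mem[OF x(1)] L_mem[OF z(1)]], of c "1 / 2"] by simp
    \<comment> \<open>The rows of \<open>x\<close> and \<open>z\<close> agree, so equal values of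
      \<open>L c\<close> leave only the common part. On it \<open>T c\<close> is injective for
      \<open>c \<in> I\<close>, because \<open>r\<close> fixes the indices below
      \<open>k\<close>.\<close>
    then have "L c x = L c z"
      using lur_strict[OF good_norm[OF good] good_lur[OF good] L_mem[OF x(1)] L_mem[OF z(1)]] st by simp
    then have "(\<theta> * B / A') *\<^sub>R T c (slice 0 x - slice 0 z) = 0" using eq[of c] by (simp add: L_def T_linear scaleR_diff_right)
    then have T0: "T c (slice 0 x - slice 0 z) = 0" using pos by simp
    \<comment> \<open>A filler space is zero and cannot carry an active term.\<close>
    have "c \<in> I"
    proof (rule ccontr)
      assume "c \<notin> I"
      then have "L c w = 0" using triv L_mem[OF w(1)] by blast
      then show False using p b_zero pos by simp
    qed
    then have "slice 0 (put 0 (ext (slice 0 x - slice 0 z))) = 0" using T0 by (simp add: T_def del: slice_put)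
    then have e0: "ext (slice 0 x - slice 0 z) = 0" by simp
    have "slice 0 x i = slice 0 z i" if "i < k" for i
      using fun_cong[OF e0, of i] that kk r_id by (simp add: ext_def)
    then show ?thesis using VD(1)[OF x(1)] VD(1)[OF z(1)] by (auto simp: supported_def fun_eq_iff) (metis not_le)
  qed
qed

lemma M_rotund_scaled:
  assumes x: "x \<in> V" "x \<noteq> 0" and z: "z \<in> V" "M z = M x" "M (x + z) = 2 * M x"
    and eq: "\<And>c. slice (Suc c) x = slice (Suc c) z"
  shows "slice 0 x = slice 0 z"
proof -
  define t where "t = 1 / M x"
  have p: "M x > 0" using sn_nonneg[OF Msn x(1)] Mnorm x by (auto simp: norm_on_def less_le)
  have t: "t > 0" "t * M x = 1" using p by (auto simp: t_def)
  have "(1 / 2) *\<^sub>R t *\<^sub>R x + (1 - 1 / 2) *\<^sub>R t *\<^sub>R z = (t / 2) *\<^sub>R (x + z)" by (simp add: scaleR_add_right)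
  then have "M ((1 / 2) *\<^sub>R t *\<^sub>R x + (1 - 1 / 2) *\<^sub>R t *\<^sub>R z) = t / 2 * M (x + z)"
    using sn_scale[OF Msn Vmem(2)[OF x(1) z(1)], of "t / 2"] t(1) by simp
  also have "\<dots> = 1" using z(3) t(2) by simp
  finally have m: "M ((1 / 2) *\<^sub>R t *\<^sub>R x + (1 - 1 / 2) *\<^sub>R t *\<^sub>R z) = 1" .
  have "M (t *\<^sub>R x) = 1" "M (t *\<^sub>R z) = 1" using sn_scale[OF Msn x(1), of t] sn_scale[OF Msn z(1), of t] t z(2) by auto
  from M_rotund[OF V_scale(1)[OF x(1)] this(1) V_scale(1)[OF z(1)] this(2) m]
  have "slice 0 (t *\<^sub>R x) = slice 0 (t *\<^sub>R z)" using eq by simp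
  then show ?thesis using t(1) by simp
qed

text \<open>The defect of the l2 sum is the sum of the nonnegative defects of the rows, so every row
  meets the hypotheses of its own local uniform rotundity. Finitely many rows then converge, and the
  tails are small because \<open>l (s n)\<close> tends to \<open>l x\<close>.\<close>

lemma l_convergence:
  assumes x: "x \<in> V" and s: "\<And>n. s n \<in> V"
    and D: "(\<lambda>n. 2 * (l x)\<^sup>2 + 2 * (l (s n))\<^sup>2 - (l (x + s n))\<^sup>2) \<longlonglongrightarrow> 0"
  shows "(\<lambda>n. l (s n - x)) \<longlonglongrightarrow> 0"
proof -
  have xs: "x + s n \<in> V" "s n - x \<in> V" for n using Vmem x s by auto
  have ls: "(\<lambda>n. l (s n)) \<longlonglongrightarrow> l x"
    by (rule defect_limit(1)[OF _ _ lnonneg[OF x] D]) (use lnonneg[OF xs(1)] sn_tri[OF lsn x s] in auto)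
  have bc: "(\<lambda>n. b c (slice (Suc c) (s n))) \<longlonglongrightarrow> b c (slice (Suc c) x)"
    and bd: "(\<lambda>n. b c (slice (Suc c) (s n - x))) \<longlonglongrightarrow> 0" for c
  proof -
    define d where "d n c = 2 * (b c (slice (Suc c) x))\<^sup>2 + 2 * (b c (slice (Suc c) (s n)))\<^sup>2 - (b c (slice (Suc c) (x + s n)))\<^sup>2" for n c
    have tri: "b c (slice (Suc c) (x + s n)) \<le> b c (slice (Suc c) x) + b c (slice (Suc c) (s n))" for n c
      using sn_tri[OF bsn VD(2)[OF x] VD(2)[OF s], of c n] by simp
    have d0: "0 \<le> d n c" for n c
      unfolding d_def by (rule order_trans[OF zero_le_power2 parallelogram_defect[OF bnonneg[OF VD(2)[OF xs(1)]] tri]])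
    have S: "(\<lambda>c. d n c) sums (2 * (l x)\<^sup>2 + 2 * (l (s n))\<^sup>2 - (l (x + s n))\<^sup>2)" for n
      unfolding d_def l_square[OF x] l_square[OF s] l_square[OF xs(1)]
      by (intro sums_diff sums_add sums_mult summable_sums VD(3) x s xs)
    have dle: "d n c \<le> 2 * (l x)\<^sup>2 + 2 * (l (s n))\<^sup>2 - (l (x + s n))\<^sup>2" for n
      using sum_le_suminf[OF sums_summable[OF S[of n]], of "{c}"] d0 sums_unique[OF S[of n]] by simp
    have "(\<lambda>n. d n c) \<longlonglongrightarrow> 0"
      by (rule tendsto_sandwich[OF _ _ tendsto_const D]) (use d0 dle in auto)
    note lim = defect_limit[OF bnonneg[OF VD(2)[OF xs(1)]] tri bnonneg[OF VD(2)[OF x]], OF this[unfolded d_def]]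
    show "(\<lambda>n. b c (slice (Suc c) (s n))) \<longlonglongrightarrow> b c (slice (Suc c) x)" by (rule lim(1))
    show "(\<lambda>n. b c (slice (Suc c) (s n - x))) \<longlonglongrightarrow> 0"
      using good_lur[OF good, unfolded lur_on_def, rule_format, OF VD(2)[OF x] VD(2)[OF s]] lim by simp
  qed
  show ?thesis
  proof (rule LIMSEQ_I)
    fix e :: real assume e: "e > 0"
    obtain m where m: "l (x - trunc m x) < e / 3"
      using order_tendstoD(2)[OF trunc_tendsto[OF x], of "e / 3"] e by (auto simp: eventually_sequentially)
    have t1: "(\<lambda>n. l (trunc m (s n - x))) \<longlonglongrightarrow> 0"
    proof -
      have "(\<lambda>n. sqrt (\<Sum>c<m. (b c (slice (Suc c) (s n - x)))\<^sup>2)) \<longlonglongrightarrow> sqrt (\<Sum>c<m. 0\<^sup>2)"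
        by (intro tendsto_real_sqrt tendsto_sum tendsto_power bd)
      moreover have "sqrt (\<Sum>c<m. (b c (slice (Suc c) (s n - x)))\<^sup>2) = l (trunc m (s n - x))" for n
        unfolding trunc_l(1)[OF xs(2), symmetric] using lnonneg[OF trunc_mem[OF xs(2)]] by simp
      ultimately show ?thesis by (simp del: slice_linear)
    qed
    have t2: "(\<lambda>n. l (s n - trunc m (s n))) \<longlonglongrightarrow> l (x - trunc m x)"
    proof -
      have "(\<lambda>n. sqrt ((l (s n))\<^sup>2 - (\<Sum>c<m. (b c (slice (Suc c) (s n)))\<^sup>2))) \<longlonglongrightarrow> sqrt ((l x)\<^sup>2 - (\<Sum>c<m. (b c (slice (Suc c) x))\<^sup>2))"
        by (intro tendsto_real_sqrt tendsto_diff tendsto_sum tendsto_power bc ls)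
      then show ?thesis unfolding trunc_l(2)[OF s, symmetric] trunc_l(2)[OF x, symmetric]
        using lnonneg[OF Vmem(4)[OF s trunc_mem[OF s]]] lnonneg[OF Vmem(4)[OF x trunc_mem[OF x]]] by simp
    qed
    have "eventually (\<lambda>n. l (trunc m (s n - x)) < e / 3 \<and> l (s n - trunc m (s n)) < e / 3) sequentially"
      using order_tendstoD(2)[OF t1, of "e / 3"] order_tendstoD(2)[OF t2 m] e by (intro eventually_conj) auto
    then obtain n0 where n0: "\<And>n. n \<ge> n0 \<Longrightarrow> l (trunc m (s n - x)) < e / 3 \<and> l (s n - trunc m (s n)) < e / 3"
      by (auto simp: eventually_sequentially)
    have "norm (l (s n - x) - 0) < e" if n: "n \<ge> n0" for n
    proof -
      have "s n - x = trunc m (s n - x) + ((s n - trunc m (s n)) - (x - trunc m x))" by (simp add: trunc_linear)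
      then have "l (s n - x) \<le> l (trunc m (s n - x)) + l ((s n - trunc m (s n)) - (x - trunc m x))"
        using sn_tri[OF lsn trunc_mem[OF xs(2)]] Vmem s x trunc_mem by metis
      moreover have "l ((s n - trunc m (s n)) - (x - trunc m x)) \<le> l (s n - trunc m (s n)) + l (x - trunc m x)"
        by (intro sn_diff[OF lsn] Vmem s x trunc_mem)
      ultimately have "l (s n - x) < e" using n0[OF n] m by linarith
      then show ?thesis using lnonneg[OF xs(2)[of n]] by simp
    qed
    then show "\<exists>no. \<forall>n\<ge>no. norm (l (s n - x) - 0) < e" by blast
  qed
qed

text \<open>Compactness of the finite-dimensional common part: a subsequence staying away from
  \<open>x\<close> has a limit \<open>z\<close> with the same rows as \<open>x\<close>, and
  rotundity of \<open>M\<close> makes the common parts agree as well.\<close>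

lemma msup_convergence:
  assumes x: "x \<in> V" "x \<noteq> 0" and s: "\<And>n. s n \<in> V"
    and M: "(\<lambda>n. M (s n)) \<longlonglongrightarrow> M x" "(\<lambda>n. M (x + s n)) \<longlonglongrightarrow> 2 * M x" and l: "(\<lambda>n. l (s n - x)) \<longlonglongrightarrow> 0"
  shows "(\<lambda>n. msup k (slice 0 (s n - x))) \<longlonglongrightarrow> 0"
proof (rule ccontr)
  define f where "f n = msup k (slice 0 (s n - x))" for n
  assume "\<not> ?thesis"
  then obtain e where e: "e > 0" "\<And>N. \<exists>n\<ge>N. f n \<ge> e"
    unfolding f_def[symmetric] LIMSEQ_def by (auto simp: f_def msup_nonneg not_less)
  have inf: "infinite {n. f n \<ge> e}" unfolding infinite_nat_iff_unbounded_le using e(2) by auto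
  define g where "g = enumerate {n. f n \<ge> e}"
  have g: "strict_mono g" "\<And>n. f (g n) \<ge> e"
    using strict_mono_enumerate[OF inf] enumerate_in_set[OF inf] by (auto simp: g_def)
  obtain Bd where Bd: "\<And>n. M (s n) \<le> Bd" using convergent_imp_Bseq[OF convergentI[OF M(1)]]
    by (metis BseqE abs_le_D1 real_norm_def)
  have "\<exists>C. \<forall>n. \<bar>slice 0 (s (g n)) i\<bar> \<le> C" for i
  proof -
    have "\<bar>slice 0 (s n) i\<bar> \<le> Bd / (B * sqrt (1 + \<delta>))" for n
    proof -
      have "\<bar>slice 0 (s n) i\<bar> \<le> msup k (slice 0 (s n))"
        using VD(1)[OF s] msup_nonneg[of k "slice 0 (s n)"] by (cases "i < k") (auto intro: msup_upper simp: supported_def)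
      also have "\<dots> \<le> Bd / (B * sqrt (1 + \<delta>))" using order_trans[OF M_msup[OF s] Bd, of n] pos by (simp add: field_simps)
      finally show ?thesis .
    qed
    then show ?thesis by blast
  qed
  then obtain h v where h: "strict_mono h" "\<And>i. (\<lambda>n. slice 0 (s (g (h n))) i) \<longlonglongrightarrow> v i"
    using coordinatewise_subseq[of "\<lambda>n. slice 0 (s (g n))"] by metis
  define u where "u n = s (g (h n))" for n
  have u: "u n \<in> V" for n using s by (simp add: u_def)
  have gh: "strict_mono (g \<circ> h)" using g(1) h(1) by (simp add: strict_mono_o)
  have v: "v \<in> supported k" unfolding supported_def
  proof clarify
    fix i assume "k \<le> i"
    then have "(\<lambda>n. slice 0 (s (g (h n))) i) = (\<lambda>n. 0)" using VD(1)[OF s] by (auto simp: supported_def)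
    then show "v i = 0" using h(2)[of i] by (simp add: LIMSEQ_const_iff)
  qed
  define z where "z = x + put 0 (v - slice 0 x)"
  have vx: "v - slice 0 x \<in> supported k" using subspace_diff[OF subspace_supported v VD(1)[OF x(1)]] .
  have z: "z \<in> V" using Vmem(2)[OF x(1) put_0_mem(1)[OF vx]] by (simp add: z_def)
  have z0: "slice 0 z = v" and zS: "\<And>c. slice (Suc c) z = slice (Suc c) x" by (simp_all add: z_def)
  have lz: "l (w - z) = l (w - x)" for w using zS by (simp add: l_def)
  have m0: "(\<lambda>n. msup k (slice 0 (u n - z))) \<longlonglongrightarrow> 0"
  proof (rule Lim_null_comparison[OF always_eventually])
    show "\<forall>n. norm (msup k (slice 0 (u n - z))) \<le> (\<Sum>i<k. \<bar>slice 0 (u n) i - v i\<bar>)"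
    proof
      fix n
      have "msup k (slice 0 (u n) - v) \<le> (\<Sum>i<k. \<bar>slice 0 (u n) i - v i\<bar>)"
        by (rule msup_least) (auto simp: sum_nonneg intro!: member_le_sum[of _ _ "\<lambda>i. \<bar>slice 0 (u n) i - v i\<bar>"])
      then show "norm (msup k (slice 0 (u n - z))) \<le> (\<Sum>i<k. \<bar>slice 0 (u n) i - v i\<bar>)" using z0 msup_nonneg by simp
    qed
    have "(\<lambda>n. \<Sum>i<k. \<bar>slice 0 (u n) i - v i\<bar>) \<longlonglongrightarrow> (\<Sum>i<k. \<bar>v i - v i\<bar>)"
      unfolding u_def by (intro tendsto_intros h(2))
    then show "(\<lambda>n. \<Sum>i<k. \<bar>slice 0 (u n) i - v i\<bar>) \<longlonglongrightarrow> 0" by simp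
  qed
  have "(\<lambda>n. l (u n - z)) \<longlonglongrightarrow> 0"
    unfolding lz u_def using LIMSEQ_subseq_LIMSEQ[OF l gh] by (simp add: o_def)
  from tendsto_add[OF m0 this] have \<nu>0: "(\<lambda>n. \<nu> (u n - z)) \<longlonglongrightarrow> 0" by (simp add: \<nu>_def del: slice_linear)
  define C where "C = (2 + \<theta> * B + B') / \<theta>"
  from tendsto_mult[OF tendsto_const \<nu>0, of C] have C\<nu>: "(\<lambda>n. C * \<nu> (u n - z)) \<longlonglongrightarrow> 0" by simp
  have close: "(\<lambda>n. M (y + u n)) \<longlonglongrightarrow> M (y + z)" if y: "y \<in> V" for y
  proof -
    have "(\<lambda>n. M (y + u n) - M (y + z)) \<longlonglongrightarrow> 0"
    proof (rule Lim_null_comparison[OF always_eventually C\<nu>], rule allI)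
      fix n
      have "\<bar>M (y + u n) - M (y + z)\<bar> \<le> M ((y + u n) - (y + z))" by (intro sn_tri3[OF Msn] Vmem y u z)
      also have "\<dots> \<le> C * \<nu> (u n - z)" unfolding C_def using M_le_\<nu>[OF Vmem(4)[OF u z]] by simp
      finally show "norm (M (y + u n) - M (y + z)) \<le> C * \<nu> (u n - z)" by simp
    qed
    then show ?thesis by (rule LIM_zero_cancel)
  qed
  have "(\<lambda>n. M (u n)) \<longlonglongrightarrow> M x" "(\<lambda>n. M (x + u n)) \<longlonglongrightarrow> 2 * M x"
    unfolding u_def using LIMSEQ_subseq_LIMSEQ[OF M(1) gh] LIMSEQ_subseq_LIMSEQ[OF M(2) gh] by (simp_all add: o_def)
  then have "M z = M x" "M (x + z) = 2 * M x"
    using close[OF Vmem(1)] close[OF x(1)] by (auto intro: LIMSEQ_unique)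
  from M_rotund_scaled[OF x z this] zS have "slice 0 x = v" using z0 by simp
  then have "slice 0 (u n - z) = slice 0 (u n - x)" for n using z0 by simp
  then have "(\<lambda>n. f (g (h n))) \<longlonglongrightarrow> 0" using m0 by (simp add: f_def u_def del: slice_linear)
  from LIMSEQ_le_const[OF this, of e] g(2) have "e \<le> 0" by blast
  then show False using e(1) by simp
qed

text \<open>By \<open>N_square\<close> the defect of \<open>N\<close> is a positive combination of
  the defects of \<open>M\<close> and \<open>l\<close>, so both vanish. The defect of
  \<open>l\<close> controls the rows, that of \<open>M\<close> the common part.\<close>

lemma N_lur: "lur_on V N"
  unfolding lur_on_def
proof (intro ballI allI impI)
  fix x and s :: "nat \<Rightarrow> nat \<Rightarrow> real"
  assume x: "x \<in> V" and sV: "\<forall>n. s n \<in> V" and N1: "(\<lambda>n. N (s n)) \<longlonglongrightarrow> N x" and N2: "(\<lambda>n. N (x + s n)) \<longlonglongrightarrow> 2 * N x"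
  have s: "\<And>n. s n \<in> V" using sV by blast
  have xs: "x + s n \<in> V" "s n - x \<in> V" for n using Vmem x s by auto
  show "(\<lambda>n. N (s n - x)) \<longlonglongrightarrow> 0"
  proof (cases "x = 0")
    case True
    then show ?thesis using N1 sn_zero[OF Nsn] by simp
  next
    case False
    define DM where "DM n = 2 * (M x)\<^sup>2 + 2 * (M (s n))\<^sup>2 - (M (x + s n))\<^sup>2" for n
    define DL where "DL n = 2 * (l x)\<^sup>2 + 2 * (l (s n))\<^sup>2 - (l (x + s n))\<^sup>2" for n
    have D0: "DM n \<ge> 0" "DL n \<ge> 0" for n
      unfolding DM_def DL_def
      by (rule order_trans[OF zero_le_power2 parallelogram_defect[OF sn_nonneg[OF Msn xs(1)] sn_tri[OF Msn x s]]],
        rule order_trans[OF zero_le_power2 parallelogram_defect[OF lnonneg[OF xs(1)] sn_tri[OF lsn x s]]])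
    have e: "DM n + \<delta> * DL n = (1 + \<delta>) * (2 * (N x)\<^sup>2 + 2 * (N (s n))\<^sup>2 - (N (x + s n))\<^sup>2)" for n
      using N_square[OF x] N_square[OF s, of n] N_square[OF xs(1), of n] by (simp add: DM_def DL_def algebra_simps)
    have "(\<lambda>n. (1 + \<delta>) * (2 * (N x)\<^sup>2 + 2 * (N (s n))\<^sup>2 - (N (x + s n))\<^sup>2)) \<longlonglongrightarrow> (1 + \<delta>) * (2 * (N x)\<^sup>2 + 2 * (N x)\<^sup>2 - (2 * N x)\<^sup>2)"
      by (intro tendsto_intros N1 N2)
    then have lim: "(\<lambda>n. DM n + \<delta> * DL n) \<longlonglongrightarrow> 0" unfolding e by (simp add: power2_eq_square)
    have "DM \<longlonglongrightarrow> 0" by (rule tendsto_sandwich[OF _ _ tendsto_const lim]) (use D0 pos in auto)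
    then have "(\<lambda>n. 2 * (M x)\<^sup>2 + 2 * (M (s n))\<^sup>2 - (M (x + s n))\<^sup>2) \<longlonglongrightarrow> 0" by (simp add: DM_def[abs_def])
    note Mlim = defect_limit[OF sn_nonneg[OF Msn xs(1)] sn_tri[OF Msn x s] sn_nonneg[OF Msn x] this]
    have "(\<lambda>n. \<delta> * DL n) \<longlonglongrightarrow> 0" by (rule tendsto_sandwich[OF _ _ tendsto_const lim]) (use D0 pos in auto)
    from tendsto_mult[OF tendsto_const this, of "1 / \<delta>"] have "DL \<longlonglongrightarrow> 0" using pos by simp
    then have "(\<lambda>n. 2 * (l x)\<^sup>2 + 2 * (l (s n))\<^sup>2 - (l (x + s n))\<^sup>2) \<longlonglongrightarrow> 0" by (simp add: DL_def[abs_def])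
    from l_convergence[OF x s this] have ll: "(\<lambda>n. l (s n - x)) \<longlonglongrightarrow> 0" .
    have mm: "(\<lambda>n. msup k (slice 0 (s n - x))) \<longlonglongrightarrow> 0" by (rule msup_convergence[OF x False s Mlim ll])
    from tendsto_mult[OF tendsto_const tendsto_add[OF mm ll], of CN]
    have t: "(\<lambda>n. CN * \<nu> (s n - x)) \<longlonglongrightarrow> 0" by (simp add: \<nu>_def del: slice_linear)
    show ?thesis
      by (rule tendsto_sandwich[OF _ _ tendsto_const t]) (use N_le_\<nu>[OF xs(2)] sn_nonneg[OF Nsn xs(2)] in auto)
  qed
qed

lemma N_good: "good V N"
  unfolding good_def using Nnorm N_smooth N_lur N_weak N_separable N_coord by blast

section \<open>Isometric copies of the given spaces\<close>

definition "J c y = put 0 (\<lambda>i. if i < k then slice 0 y i else 0) + put (Suc c) y" for c y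

lemma J_linear: "J c (x + y) = J c x + J c y" "J c (x - y) = J c x - J c y" "J c (t *\<^sub>R x) = t *\<^sub>R J c x"
  by (auto simp: J_def put_def slice_def fun_eq_iff)

lemma J_slice: "slice 0 (J c y) = (\<lambda>i. if i < k then slice 0 y i else 0)" "slice (Suc d) (J c y) = (if d = c then y else 0)"
  by (auto simp: J_def)

lemma msup_J: assumes y: "y \<in> Vc c" shows "B' * msup k (slice 0 (J c y)) \<le> b c y"
proof -
  have "msup k (slice 0 (J c y)) \<le> msup k (slice 0 y)"
    by (rule msup_least) (auto simp: J_slice msup_nonneg intro: msup_upper)
  also have "\<dots> \<le> msup k' (slice 0 y)" by (rule msup_mono[OF kk])
  finally have "B' * msup k (slice 0 (J c y)) \<le> B' * msup k' (slice 0 y)" using pos by (intro mult_left_mono) auto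
  then show ?thesis using lower[OF y] by linarith
qed

lemma J_mem: assumes y: "y \<in> Vc c" shows "J c y \<in> V" "l (J c y) = b c y"
proof -
  have "(\<lambda>i. if i < k then slice 0 y i else 0) \<in> supported k" by (simp add: supported_def)
  from Vmem(2)[OF put_0_mem(1)[OF this] put_Suc_mem(1)[OF y]] show "J c y \<in> V" by (simp add: J_def)
  have "l (J c y) = l (put (Suc c) y)" unfolding l_def by (simp add: J_slice)
  then show "l (J c y) = b c y" using put_Suc_mem(2)[OF y] by simp
qed

text \<open>\<open>ext\<close> reads only indices \<open>r j < k\<close>, where row 0 of
  \<open>J c y\<close> repeats the common part of \<open>y\<close>; hence the correction vanishes in
  \<open>L c\<close>, while \<open>L d\<close> sees nothing but the common part.\<close>

lemma L_J: "L c (J c y) = y" and L_J_other: "d \<noteq> c \<Longrightarrow> L d (J c y) = (\<theta> * B / A') *\<^sub>R T d (slice 0 (J c y))"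
proof -
  have "ext ((\<lambda>i. if i < k then slice 0 y i else 0) - slice 0 y) = 0"
    using r_less by (auto simp: ext_def fun_eq_iff)
  then have "T c (slice 0 (J c y) - slice 0 y) = 0" by (simp add: T_def J_slice)
  then show "L c (J c y) = y" by (simp add: L_def J_slice(2))
  show "d \<noteq> c \<Longrightarrow> L d (J c y) = (\<theta> * B / A') *\<^sub>R T d (slice 0 (J c y))" by (simp add: L_def J_slice(2))
qed

text \<open>For \<open>b c y \<le> 1\<close> the \<open>lam\<close> term and all foreign terms are
  inactive, the latter thanks to \<open>B < B'\<close>, and the remaining term is at most 1.
  Conversely, that term alone already forces \<open>b c y \<le> 1\<close>.\<close>

lemma M_J: assumes y: "y \<in> Vc c" shows "M (J c y) = b c y"
proof (rule antisym)
  have sJ: "seminorm_on (Vc c) (\<lambda>y. M (J c y))"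
    unfolding seminorm_on_def
    using sn_sub[OF bsn, of c] sn_scale[OF Msn J_mem(1)] sn_tri[OF Msn J_mem(1) J_mem(1)] by (simp add: J_linear)
  have "M (J c y) \<le> 1 * b c y"
  proof (rule seminorm_le_from_unit[OF bsn sJ _ y])
    fix y assume y: "y \<in> Vc c" and b1: "b c y \<le> 1"
    have m: "B' * msup k (slice 0 (J c y)) \<le> 1" using msup_J[OF y] b1 by simp
    have other: "b d (L d (J c y)) \<le> \<theta>" if d: "d \<noteq> c" for d
    proof -
      have "b d (L d (J c y)) = (\<theta> * B / A') * b d (T d (slice 0 (J c y)))"
        unfolding L_J_other[OF d] using sn_scale[OF bsn T_mem, of d "\<theta> * B / A'"] pos by (simp add: abs_mult)
      also have "\<dots> \<le> (\<theta> * B / A') * (A' * msup k (slice 0 (J c y)))" using T_bound pos by (intro mult_left_mono) auto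
      also have "\<dots> = \<theta> * (B * msup k (slice 0 (J c y)))" using pos by simp
      also have "\<dots> \<le> \<theta> * (B' * msup k (slice 0 (J c y)))" using pos msup_nonneg by (intro mult_left_mono mult_right_mono) auto
      also have "\<dots> \<le> \<theta> * 1" using m pos by (intro mult_left_mono) auto
      finally show ?thesis by simp
    qed
    have "Ps m (J c y) \<le> 1" for m
    proof -
      have "(max 0 (b d (L d (J c y)) - \<theta>))\<^sup>2 / (1 - \<theta>)\<^sup>2 \<le> (if d = c then 1 else 0)" for d
      proof (cases "d = c")
        case True
        have "(max 0 (b c y - \<theta>))\<^sup>2 \<le> (1 - \<theta>)\<^sup>2" using b1 pos by (intro power_mono) auto
        then show ?thesis using True L_J pos by (simp add: divide_le_eq_1_pos)
      next
        case False
        then have "max 0 (b d (L d (J c y)) - \<theta>) = 0" using other[OF False] by simp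
        then show ?thesis using False by simp
      qed
      then have "(\<Sum>d<m. (max 0 (b d (L d (J c y)) - \<theta>))\<^sup>2 / (1 - \<theta>)\<^sup>2) \<le> (\<Sum>d<m. if d = c then 1 else 0)" by (rule sum_mono)
      also have "\<dots> \<le> 1" by simp
      finally have "(\<Sum>d<m. (max 0 (b d (L d (J c y)) - \<theta>))\<^sup>2 / (1 - \<theta>)\<^sup>2) \<le> 1" .
      moreover have "max 0 (lam (slice 0 (J c y)) - 1) = 0" using lam_le[OF m] by simp
      ultimately show ?thesis by (simp add: Ps_def)
    qed
    then have "J c y \<in> K" using J_mem(1)[OF y] by (simp add: K_def)
    then show "M (J c y) \<le> 1" using M_le1[OF J_mem(1)[OF y]] by simp
  qed
  then show "M (J c y) \<le> b c y" by simp
  have "b c y \<le> 1 * M (J c y)"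
  proof (rule seminorm_le_from_unit[OF sJ bsn _ y])
    fix y assume y: "y \<in> Vc c" and M1: "M (J c y) \<le> 1"
    have "Ps (Suc c) (J c y) \<le> 1" using M1 M_le1[OF J_mem(1)[OF y]] by (simp add: K_def)
    moreover have "(max 0 (b c y - \<theta>))\<^sup>2 / (1 - \<theta>)\<^sup>2 \<le> Ps (Suc c) (J c y)"
      by (simp add: Ps_def L_J sum_nonneg)
    ultimately have "(max 0 (b c y - \<theta>))\<^sup>2 / (1 - \<theta>)\<^sup>2 \<le> 1" by linarith
    then have "(max 0 (b c y - \<theta>))\<^sup>2 \<le> (1 - \<theta>)\<^sup>2" by (subst (asm) divide_le_eq_1_pos) (use pos in auto)
    then have "max 0 (b c y - \<theta>) \<le> 1 - \<theta>" by (rule power2_le_imp_le) (use pos in simp)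
    then show "b c y \<le> 1" by simp
  qed
  then show "b c y \<le> M (J c y)" by simp
qed

lemma N_J: assumes y: "y \<in> Vc c" shows "N (J c y) = b c y"
proof -
  have "(1 + \<delta>) * (N (J c y))\<^sup>2 = (1 + \<delta>) * (b c y)\<^sup>2"
    using N_square[OF J_mem(1)[OF y]] M_J[OF y] J_mem(2)[OF y] by (simp add: algebra_simps)
  then have "(N (J c y))\<^sup>2 = (b c y)\<^sup>2" using pos by simp
  then show ?thesis using sn_nonneg[OF Nsn J_mem(1)[OF y]] bnonneg[OF y] by simp
qed

text \<open>The upper constant improves from \<open>A'\<close> to \<open>B'\<close>: row 0 by itself
  is seen by \<open>L c\<close> only through the damped correction, so \<open>lam\<close> decides,
  and \<open>kq\<close> compares it with \<open>B'\<close>.\<close>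

lemma N_put_0: assumes v: "v \<in> supported k" shows "N (put 0 v) \<le> B' * msup k v"
proof -
  have s: "seminorm_on (supported k) (\<lambda>v. msup k v)" "seminorm_on (supported k) (\<lambda>v. M (put 0 v))"
    unfolding seminorm_on_def using subspace_supported msup_add sn_scale[OF Msn put_0_mem(1)]
      sn_tri[OF Msn put_0_mem(1) put_0_mem(1)] by (simp_all add: msup_scale)
  have "M (put 0 v) \<le> B' * msup k v"
  proof -
    have s': "seminorm_on (supported k) (\<lambda>v. B' * msup k v)"
      using s(1) pos unfolding seminorm_on_def by (auto simp: distrib_left[symmetric])
    have "M (put 0 v) \<le> 1 * (B' * msup k v)"
    proof (rule seminorm_le_from_unit[OF s' s(2) _ v])
      fix v assume v: "v \<in> supported k" and le: "B' * msup k v \<le> 1"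
      have "put 0 v \<in> K"
      proof (rule K_sufficient[OF put_0_mem(1)[OF v]])
        have "B * msup k v \<le> B' * msup k v" using pos msup_nonneg by (intro mult_right_mono) auto
        then have "\<theta> * (B * msup k v) \<le> \<theta> * 1" using le pos by (intro mult_left_mono) auto
        then show "b c (L c (put 0 v)) \<le> \<theta>" for c using L_bound[OF put_0_mem(1)[OF v], of c] b_zero by (simp add: mult.assoc)
      qed (use le in simp)
      then show "M (put 0 v) \<le> 1" using M_le1 put_0_mem(1)[OF v] by blast
    qed
    then show ?thesis by simp
  qed
  moreover have "N (put 0 v) \<le> M (put 0 v)" using N_le[OF put_0_mem(1)[OF v]] put_0_mem(2)[OF v] by simp
  ultimately show ?thesis by simp
qed

text \<open>Both vectors have the same row 0 because \<open>r\<close> is the identity below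
  \<open>k\<close>, so only row \<open>Suc c\<close> is left. On it \<open>L c\<close> acts as
  multiplication by \<open>1 - \<theta> * B / A'\<close> and every other \<open>L d\<close>
  vanishes, so \<open>K_sufficient\<close> bounds the gauge; the l2 part adds
  \<open>sqrt \<delta> * A'\<close>.\<close>

lemma N_close:
  assumes v: "v \<in> supported k" and c: "c \<in> I"
  shows "N (put 0 v - J c (put 0 (ext v))) \<le> ((A' - \<theta> * B) / \<theta> + sqrt \<delta> * A') * msup k v"
proof -
  let ?y = "\<lambda>v. put 0 (ext v)" let ?w = "\<lambda>v. put (Suc c) (put 0 (ext v))"
  have y: "?y v \<in> Vc c" "b c (?y v) \<le> A' * msup k v" for v
    using T_mem[of c v] T_bound[of c v] c by (simp_all add: T_def)
  note w = put_Suc_mem[OF y(1)]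
  have rs: "(\<lambda>i. if i < k then slice 0 (put 0 (ext v)) i else 0) = v"
    using v kk r_id by (auto simp: ext_def supported_def fun_eq_iff)
  have "J c (?y v) = put 0 v + ?w v" by (simp add: J_def rs)
  then have "N (put 0 v - J c (?y v)) = N (?w v)" using sn_neg[OF Nsn w(1)] by simp
  also have "\<dots> \<le> M (?w v) + sqrt \<delta> * l (?w v)" by (rule N_le[OF w(1)])
  also have "sqrt \<delta> * l (?w v) \<le> sqrt \<delta> * (A' * msup k v)" using y(2)[of v] pos w(2) by (intro mult_left_mono) auto
  also have "M (?w v) \<le> (A' - \<theta> * B) / \<theta> * msup k v"
  proof -
    have AB: "A' - \<theta> * B > 0"
    proof -
      have "\<theta> * B < 1 * B" by (rule mult_strict_right_mono) (use pos in auto)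
      then show ?thesis using pos by linarith
    qed
    have s: "seminorm_on (supported k) (\<lambda>v. (A' - \<theta> * B) / \<theta> * msup k v)"
      unfolding seminorm_on_def
    proof (intro conjI allI ballI subspace_supported)
      fix x y :: "nat \<Rightarrow> real"
      show "(A' - \<theta> * B) / \<theta> * msup k (x + y) \<le> (A' - \<theta> * B) / \<theta> * msup k x + (A' - \<theta> * B) / \<theta> * msup k y"
        unfolding distrib_left[symmetric] using msup_add AB pos by (intro mult_left_mono) auto
    qed (simp add: msup_scale)
    have s2: "seminorm_on (supported k) (\<lambda>v. M (?w v))"
      unfolding seminorm_on_def using subspace_supported sn_scale[OF Msn w(1)] sn_tri[OF Msn w(1) w(1)]
      by (simp add: ext_linear)
    have "M (?w v) \<le> 1 * ((A' - \<theta> * B) / \<theta> * msup k v)"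
    proof (rule seminorm_le_from_unit[OF s s2 _ v])
      fix v assume v: "v \<in> supported k" and le: "(A' - \<theta> * B) / \<theta> * msup k v \<le> 1"
      have le': "(A' - \<theta> * B) * msup k v \<le> \<theta>" using le pos by (simp add: field_simps)
      have "?w v \<in> K"
      proof (rule K_sufficient[OF w(1)])
        have "msup k 0 = 0" using msup_scale[of k 0 0] by simp
        then show "B' * msup k (slice 0 (?w v)) \<le> 1" by simp
        fix d
        show "b d (L d (?w v)) \<le> \<theta>"
        proof (cases "d = c")
          case True
          \<comment> \<open>\<open>ext\<close> keeps the entries below \<open>k\<close> and reads no
            others, so it is idempotent, and \<open>L c\<close> merely rescales the row.\<close>
          have ee: "ext (ext v) = ext v" using r_less r_id kk by (auto simp: ext_def fun_eq_iff dest: less_le_trans)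
          have "L c (?w v) = ?y v - (\<theta> * B / A') *\<^sub>R ?y v" using c ee by (simp add: L_def T_neg) (simp add: T_def ee)
          also have "\<dots> = (1 - \<theta> * B / A') *\<^sub>R ?y v" by (simp add: scaleR_diff_left)
          finally have "b c (L c (?w v)) = \<bar>1 - \<theta> * B / A'\<bar> * b c (?y v)" using sn_scale[OF bsn y(1)] by simp
          also have "\<bar>1 - \<theta> * B / A'\<bar> = (A' - \<theta> * B) / A'" using AB pos by (simp add: field_simps)
          also have "(A' - \<theta> * B) / A' * b c (?y v) \<le> (A' - \<theta> * B) / A' * (A' * msup k v)" using y(2) AB pos by (intro mult_left_mono) auto
          also have "\<dots> = (A' - \<theta> * B) * msup k v" using pos by simp
          finally show ?thesis using le' True by simp
        next
          case False
          then have "L d (?w v) = 0" by (simp add: L_def T_linear)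
          then show ?thesis using b_zero pos by simp
        qed
      qed
      then show "M (?w v) \<le> 1" using M_le1 w(1) by blast
    qed
    then show ?thesis by simp
  qed
  finally show ?thesis by (simp add: distrib_right mult.assoc)
qed

end

text \<open>As \<open>\<theta>\<close> tends to 1 and \<open>\<delta>\<close> to 0, the closeness
  bound tends to \<open>A' - B\<close>, which is below \<open>\<epsilon>\<close>. For fixed small
  \<open>\<gamma>\<close> and \<open>\<delta>\<close> the ratio of \<open>a\<close> to
  \<open>B'\<close> stays below 1, so a high power beats the factor \<open>k\<close>.\<close>

lemma amalgam_parameters:
  fixes B B' A' \<epsilon> :: real and k :: nat
  assumes B: "0 < B" "B < B'" "B' < A'" and \<epsilon>: "A' - B < \<epsilon>"
  obtains \<theta> \<delta> \<gamma> q where "0 < \<theta>" "\<theta> < 1" "0 < \<delta>" "0 < \<gamma>" "0 < q"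
    "real k * (B * (1 + \<gamma>) * sqrt (1 + \<delta>)) ^ (2 * q) \<le> B' ^ (2 * q)"
    "(A' - \<theta> * B) / \<theta> + sqrt \<delta> * A' \<le> \<epsilon>"
proof -
  define \<eta> where "\<eta> = \<epsilon> - (A' - B)"
  have \<eta>: "\<eta> > 0" using \<epsilon> by (simp add: \<eta>_def)
  have A: "A' > 0" using B by simp
  \<comment> \<open>Solves \<open>A' / \<theta> = A' + \<eta> / 2\<close>, which spends half of the
    slack.\<close>
  define \<theta> where "\<theta> = A' / (A' + \<eta> / 2)"
  have \<theta>: "0 < \<theta>" "\<theta> < 1" using A \<eta> by (simp_all add: \<theta>_def)
  have "A' / \<theta> = A' + \<eta> / 2" using A \<eta> by (simp add: \<theta>_def)
  then have 1: "(A' - \<theta> * B) / \<theta> = A' + \<eta> / 2 - B" using \<theta> by (simp add: diff_divide_distrib)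
  define s where "s = sqrt (B' / B)"
  have s: "s > 1" using B by (simp add: s_def)
  \<comment> \<open>One number serves as \<open>\<gamma>\<close> and \<open>\<delta>\<close>: the
    first bound keeps \<open>a\<close> below \<open>B'\<close>, the second spends the other half of
    the slack.\<close>
  define d where "d = min ((s - 1) / 2) ((\<eta> / (2 * A'))\<^sup>2)"
  have d: "d > 0" "d < s - 1" "d \<le> (\<eta> / (2 * A'))\<^sup>2" using s \<eta> A by (auto simp: d_def min_def)
  have "sqrt d \<le> \<eta> / (2 * A')" using d(3) \<eta> A by (simp add: real_le_lsqrt)
  then have 2: "sqrt d * A' \<le> \<eta> / 2" using A by (simp add: field_simps)
  have "sqrt (1 + d) \<le> 1 + d" using d(1) by (simp add: real_le_lsqrt power2_eq_square algebra_simps)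
  then have "B * (1 + d) * sqrt (1 + d) \<le> B * (1 + d) * (1 + d)" using B d by (intro mult_left_mono) auto
  also have "\<dots> < B * (s * s)"
  proof -
    have "(1 + d) * (1 + d) < s * s" using d by (intro mult_strict_mono) auto
    then show ?thesis using B by (simp add: mult.assoc)
  qed
  also have "B * (s * s) = B'" using B by (simp add: s_def)
  finally have a: "B * (1 + d) * sqrt (1 + d) < B'" .
  define a where "a = B * (1 + d) * sqrt (1 + d)"
  have a0: "0 \<le> a" "a < B'" using a B d by (simp_all add: a_def)
  define x where "x = (a / B')\<^sup>2"
  have x: "0 \<le> x" "x < 1" using a0 B by (auto simp: x_def power_less_one_iff abs_square_less_1)
  obtain n where n: "x ^ n < 1 / (real k + 1)" using real_arch_pow_inv[of "1 / (real k + 1)" x] x by auto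
  have "x ^ Suc n \<le> x ^ n" using x by (intro power_decreasing) auto
  then have xn: "x ^ Suc n < 1 / (real k + 1)" using n by linarith
  have "real k * x ^ Suc n \<le> (real k + 1) * x ^ Suc n" using x by (intro mult_right_mono) auto
  also have "\<dots> \<le> 1" using xn by (simp add: field_simps)
  finally have kx: "real k * x ^ Suc n \<le> 1" .
  have "a = (a / B') * B'" using B by simp
  then have "a ^ (2 * Suc n) = (a / B') ^ (2 * Suc n) * B' ^ (2 * Suc n)" by (metis power_mult_distrib)
  also have "(a / B') ^ (2 * Suc n) = x ^ Suc n" unfolding x_def by (rule power_mult)
  finally have "real k * a ^ (2 * Suc n) = (real k * x ^ Suc n) * B' ^ (2 * Suc n)" by simp
  also have "\<dots> \<le> 1 * B' ^ (2 * Suc n)" using kx B by (intro mult_right_mono) auto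
  finally have kq: "real k * (B * (1 + d) * sqrt (1 + d)) ^ (2 * Suc n) \<le> B' ^ (2 * Suc n)" by (simp only: a_def mult_1)
  have "A' + \<eta> / 2 - B + sqrt d * A' \<le> \<epsilon>" using 2 \<eta>_def by linarith
  then have fin: "(A' - \<theta> * B) / \<theta> + sqrt d * A' \<le> \<epsilon>" by (simp only: 1)
  show ?thesis by (rule that[OF \<theta> d(1) d(1) zero_less_Suc kq fin])
qed

text \<open>Fills the indices that do not belong to children, so that every amalgam is indexed by
  all natural numbers.\<close>

lemma good_trivial: "good {0} (\<lambda>_. 0)"
  unfolding good_def
proof (intro conjI)
  show "norm_on {0} (\<lambda>_::nat \<Rightarrow> real. 0)" by (simp add: norm_on_def seminorm_on_def)
  show "coordinatewise_weak {0} (\<lambda>_. 0)" unfolding coordinatewise_weak_def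
  proof (intro allI impI)
    fix s :: "nat \<Rightarrow> nat \<Rightarrow> real" and x C
    assume s: "\<forall>k. s k \<in> {0} \<and> 0 \<le> (C::real)" and l: "\<forall>i. (\<lambda>k. s k i) \<longlonglongrightarrow> x i"
    then have s0: "s k = 0" for k by blast
    have "x i = 0" for i using l[rule_format, of i] by (simp add: s0 LIMSEQ_const_iff)
    then have "x = 0" by (simp add: fun_eq_iff)
    then show "x \<in> {0} \<and> (\<forall>f. blf {0} (\<lambda>_. 0) f \<longrightarrow> (\<lambda>k. f (s k)) \<longlonglongrightarrow> f x)" by (simp add: s0)
  qed
  show "separable_on {0} (\<lambda>_::nat \<Rightarrow> real. 0)" unfolding separable_on_def by (intro exI[of _ "{0}"]) auto
qed (auto simp: smooth_on_def lur_on_def)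

section \<open>One good space for a well-founded tree\<close>

text \<open>The closeness achievable by an amalgam is governed by the upper constant of the child
  minus the lower constant of the parent, hence the two steps of \<open>B\<close> in the assumption
  on \<open>\<epsilon>\<close>.\<close>

locale levels =
  fixes k :: "nat \<Rightarrow> nat" and r :: "nat \<Rightarrow> nat \<Rightarrow> nat" and B \<epsilon> :: "nat \<Rightarrow> real"
  assumes k_mono: "k n \<le> k (Suc n)" and r_less: "j < k (Suc n) \<Longrightarrow> r n j < k n" and r_id: "j < k n \<Longrightarrow> r n j = j"
    and B_pos: "0 < B n" and B_less: "B n < B (Suc n)" and \<epsilon>: "B (Suc (Suc n)) - B n < \<epsilon> n"
begin

definition "lift n w = (\<lambda>j. if j < k (Suc n) then w (r n j) else 0 :: real)" for n w

lemma lift_supported: "lift n w \<in> supported (k (Suc n))"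
  by (simp add: lift_def supported_def)

definition embedding :: "nat \<Rightarrow> (nat \<Rightarrow> real) set \<Rightarrow> ((nat \<Rightarrow> real) \<Rightarrow> real) \<Rightarrow> ((nat \<Rightarrow> real) \<Rightarrow> nat \<Rightarrow> real) \<Rightarrow> bool" where
  "embedding n V N U \<longleftrightarrow>
    (\<forall>w\<in>supported (k n). U w \<in> V \<and> B n * msup (k n) w \<le> N (U w) \<and> N (U w) \<le> B (Suc n) * msup (k n) w \<and>
      (\<forall>w'\<in>supported (k n). U (w + w') = U w + U w') \<and> (\<forall>c. U (c *\<^sub>R w) = c *\<^sub>R U w))"

text \<open>Words \<open>u\<close> are relative to the node \<open>t\<close>, so one space serves
  the whole subtree below \<open>t\<close>; at the root this covers all of \<open>A\<close>.
  \<open>W []\<close> is fixed as row 0 because that is the row by which the parent identifies its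
  children.\<close>

definition system :: "nat list set \<Rightarrow> nat list \<Rightarrow> (nat \<Rightarrow> real) set \<Rightarrow> ((nat \<Rightarrow> real) \<Rightarrow> real) \<Rightarrow>
    (nat list \<Rightarrow> (nat \<Rightarrow> real) \<Rightarrow> nat \<Rightarrow> real) \<Rightarrow> bool" where
  "system A t V N W \<longleftrightarrow> good V N \<and> W [] = put 0 \<and> embedding (length t) V N (put 0) \<and>
    (\<forall>y\<in>V. B (length t) * msup (k (length t)) (slice 0 y) \<le> N y) \<and>
    (\<forall>u. t @ u \<in> A \<longrightarrow> embedding (length t + length u) V N (W u)) \<and>
    (\<forall>u c. t @ u @ [c] \<in> A \<longrightarrow> (\<forall>w\<in>supported (k (length t + length u)).
      N (W u w - W (u @ [c]) (lift (length t + length u) w)) \<le> \<epsilon> (length t + length u) * msup (k (length t + length u)) w))"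

text \<open>Induction from the leaves, amalgamating the spaces of all children. Estimates inside the
  subtree of a child survive unchanged because the copies are isometric; the only new closeness is
  between the node and its children, given by \<open>N_close\<close>.\<close>

lemma system_exists:
  assumes prefix: "\<And>t u. t @ u \<in> A \<Longrightarrow> t \<in> A"
    and wf: "wf {(t @ [c], t) | t c. t @ [c] \<in> A}"
  shows "\<exists>V N W. system A t V N W"
  using wf
proof (induction t rule: wf_induct_rule)
  case (less t)
  define n where "n = length t"
  define I where "I = {c. t @ [c] \<in> A}"
  have "\<exists>V N W. system A (t @ [c]) V N W" if "c \<in> I" for c using less[of "t @ [c]"] that by (auto simp: I_def)
  then have "\<forall>c. \<exists>V N W. c \<in> I \<longrightarrow> system A (t @ [c]) V N W" by blast
  then obtain V0 N0 W0 where 0: "\<And>c. c \<in> I \<Longrightarrow> system A (t @ [c]) (V0 c) (N0 c) (W0 c)" by metis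
  define Vc where "Vc c = (if c \<in> I then V0 c else {0})" for c
  define b where "b c = (if c \<in> I then N0 c else (\<lambda>_. 0))" for c
  have sys: "system A (t @ [c]) (Vc c) (b c) (W0 c)" if "c \<in> I" for c using 0[OF that] that by (simp add: Vc_def b_def)
  obtain \<theta> \<delta> \<gamma> q where par: "0 < \<theta>" "\<theta> < 1" "0 < \<delta>" "0 < \<gamma>" "0 < q"
    "real (k n) * (B n * (1 + \<gamma>) * sqrt (1 + \<delta>)) ^ (2 * q) \<le> B (Suc n) ^ (2 * q)"
    "(B (Suc (Suc n)) - \<theta> * B n) / \<theta> + sqrt \<delta> * B (Suc (Suc n)) \<le> \<epsilon> n"
    using amalgam_parameters[OF B_pos B_less B_less \<epsilon>, of "k n" n] by metis
  \<comment> \<open>The children lie at depth \<open>Suc n\<close>, so their bounds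
    \<open>B (Suc n)\<close> and \<open>B (Suc (Suc n))\<close> become \<open>B'\<close> and
    \<open>A'\<close>, and \<open>B n\<close> is the new lower bound.\<close>
  interpret am: amalgam Vc b I "k n" "k (Suc n)" "r n" "B (Suc (Suc n))" "B (Suc n)" "B n" \<theta> \<delta> \<gamma> q
  proof
    show "good (Vc c) (b c)" for c
      using sys[of c] good_trivial by (cases "c \<in> I") (auto simp: system_def Vc_def b_def)
    show "B (Suc n) * msup (k (Suc n)) (slice 0 y) \<le> b c y" if y: "y \<in> Vc c" for c y
    proof (cases "c \<in> I")
      case True
      then show ?thesis using sys[OF True] y by (simp add: system_def n_def)
    next
      case False
      then show ?thesis using y msup_scale[of "k (Suc n)" 0 0] by (simp add: Vc_def b_def)
    qed
    show "put 0 w \<in> Vc c \<and> b c (put 0 w) \<le> B (Suc (Suc n)) * msup (k (Suc n)) w"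
      if "c \<in> I" "w \<in> supported (k (Suc n))" for c w
      using sys[OF that(1)] that(2) by (simp add: system_def embedding_def n_def)
    show "Vc c \<subseteq> {0}" if "c \<notin> I" for c using that by (simp add: Vc_def)
  qed (use k_mono r_less r_id B_pos B_less par in auto)
  have ext: "am.ext = lift n" by (simp add: am.ext_def lift_def fun_eq_iff)
  \<comment> \<open>The first letter of a word chooses the child, whose own maps handle the rest of
    the word.\<close>
  define W where "W u = (case u of [] \<Rightarrow> put 0 | c # u' \<Rightarrow> (\<lambda>w. am.J c (W0 c u' w)))" for u
  have emb0: "embedding n am.V am.N (put 0)" unfolding embedding_def
  proof (intro ballI conjI allI)
    fix w assume w: "w \<in> supported (k n)"
    show "put 0 w \<in> am.V" by (rule am.put_0_mem(1)[OF w])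
    show "B n * msup (k n) w \<le> am.N (put 0 w)" using am.N_msup[OF am.put_0_mem(1)[OF w]] by simp
    show "am.N (put 0 w) \<le> B (Suc n) * msup (k n) w" by (rule am.N_put_0[OF w])
  qed simp_all
  have emb: "embedding (n + length u) am.V am.N (W u)" if u: "t @ u \<in> A" for u
  proof (cases u)
    case Nil then show ?thesis using emb0 by (simp add: W_def)
  next
    case (Cons c u')
    then have u': "(t @ [c]) @ u' \<in> A" using u by simp
    then have c: "c \<in> I" using prefix unfolding I_def by blast
    have "embedding (length (t @ [c]) + length u') (Vc c) (b c) (W0 c u')" using sys[OF c] u' unfolding system_def by blast
    then have "embedding (n + length u) (Vc c) (b c) (W0 c u')" using Cons by (simp add: n_def)
    then show ?thesis unfolding embedding_def W_def Cons by (simp add: am.J_mem(1) am.N_J am.J_linear)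
  qed
  have close: "am.N (W u w - W (u @ [c]) (lift (n + length u) w)) \<le> \<epsilon> (n + length u) * msup (k (n + length u)) w"
    if u: "t @ u @ [c] \<in> A" and w: "w \<in> supported (k (n + length u))" for u c w
  proof (cases u)
    case Nil
    then have c: "c \<in> I" using u by (simp add: I_def)
    have "W0 c [] = put 0" using sys[OF c] by (simp add: system_def)
    then have "am.N (W u w - W (u @ [c]) (lift (n + length u) w)) = am.N (put 0 w - am.J c (put 0 (am.ext w)))"
      using Nil by (simp add: W_def ext)
    also have "\<dots> \<le> ((B (Suc (Suc n)) - \<theta> * B n) / \<theta> + sqrt \<delta> * B (Suc (Suc n))) * msup (k n) w"
      by (rule am.N_close[OF _ c]) (use w Nil in simp)
    also have "\<dots> \<le> \<epsilon> n * msup (k n) w" using par(7) msup_nonneg by (rule mult_right_mono)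
    finally show ?thesis using Nil by simp
  next
    case (Cons d u')
    then have u': "(t @ [d]) @ u' @ [c] \<in> A" using u by simp
    then have d: "d \<in> I" using prefix unfolding I_def by blast
    have u'': "(t @ [d]) @ u' \<in> A" using prefix[of "(t @ [d]) @ u'" "[c]"] u' by simp
    note s = sys[OF d, unfolded system_def]
    have le: "b d (W0 d u' w - W0 d (u' @ [c]) (lift (n + length u) w)) \<le> \<epsilon> (n + length u) * msup (k (n + length u)) w"
      using s u' w Cons by (simp add: n_def)
    have "embedding (length (t @ [d]) + length u') (Vc d) (b d) (W0 d u')"
      "embedding (length (t @ [d]) + length (u' @ [c])) (Vc d) (b d) (W0 d (u' @ [c]))"
      using s u' u'' by blast+
    then have m: "W0 d u' w \<in> Vc d" "W0 d (u' @ [c]) (lift (n + length u) w) \<in> Vc d"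
      using w lift_supported[of "n + length u" w] Cons unfolding embedding_def by (simp_all add: n_def)
    have "W u w - W (u @ [c]) (lift (n + length u) w) = am.J d (W0 d u' w - W0 d (u' @ [c]) (lift (n + length u) w))"
      by (simp add: W_def Cons am.J_linear)
    then show ?thesis using am.N_J[OF am.bmem(4)[OF m]] le by simp
  qed
  have "system A t am.V am.N W" unfolding system_def
    using am.N_good emb0 emb close am.N_msup by (simp add: n_def[symmetric] W_def)
  then show ?case by blast
qed

end

section \<open>The tree of approximate embeddings\<close>

text \<open>The one-dimensional Hahn-Banach extension, phrased with formal coefficients because the
  vectors \<open>e i\<close> may be linearly dependent.\<close>

lemma hahn_banach_step:
  assumes sn: "seminorm_on V p" and e: "\<And>i. e i \<in> V"
    and le: "\<And>c. (\<Sum>i<n. c i * \<phi> i) \<le> p (\<Sum>i<n. c i *\<^sub>R e i)"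
  shows "\<exists>\<alpha>. \<forall>c. (\<Sum>i<n. c i * \<phi> i) + c n * \<alpha> \<le> p (\<Sum>i<Suc n. c i *\<^sub>R e i)"
proof -
  define x where "x c = (\<Sum>i<n. c i *\<^sub>R e i)" for c :: "nat \<Rightarrow> real"
  define f where "f c = (\<Sum>i<n. c i * \<phi> i)" for c :: "nat \<Rightarrow> real"
  have xV: "x c \<in> V" for c unfolding x_def using sn_sum[OF sn, of "{..<n}"] sn_mem(3)[OF sn e] by auto
  have xadd: "x (\<lambda>i. c i + d i) = x c + x d" "f (\<lambda>i. c i + d i) = f c + f d" for c d
    by (simp_all add: x_def f_def scaleR_add_left distrib_right sum.distrib)
  have xscale: "x (\<lambda>i. t * c i) = t *\<^sub>R x c" "f (\<lambda>i. t * c i) = t * f c" for t c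
    by (simp_all add: x_def f_def scaleR_right.sum sum_distrib_left mult.assoc)
  have key: "f c - p (x c - e n) \<le> p (x d + e n) - f d" for c d
  proof -
    have "f c + f d \<le> p (x c + x d)" using le[of "\<lambda>i. c i + d i"] xadd[of c d] by (simp add: x_def f_def)
    also have "x c + x d = (x c - e n) + (x d + e n)" by simp
    also have "p ((x c - e n) + (x d + e n)) \<le> p (x c - e n) + p (x d + e n)" by (intro sn_tri[OF sn] sn_mem[OF sn] xV e)
    finally show ?thesis by simp
  qed
  define \<alpha> where "\<alpha> = (SUP c. f c - p (x c - e n))"
  have bdd: "bdd_above (range (\<lambda>c. f c - p (x c - e n)))" using key by (auto intro!: bdd_aboveI)
  have lo: "f c - p (x c - e n) \<le> \<alpha>" for c unfolding \<alpha>_def by (rule cSUP_upper[OF _ bdd]) simp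
  have hi: "\<alpha> \<le> p (x d + e n) - f d" for d unfolding \<alpha>_def by (rule cSUP_least) (use key in auto)
  have "f c + t * \<alpha> \<le> p (x c + t *\<^sub>R e n)" for c t
  proof -
    consider "t = 0" | "t > 0" | "t < 0" by linarith
    then show ?thesis
    proof cases
      case 1 then show ?thesis using le[of c] by (simp add: x_def f_def)
    next
      case 2
      have "t * \<alpha> \<le> t * (p (x (\<lambda>i. (1 / t) * c i) + e n) - f (\<lambda>i. (1 / t) * c i))" using hi 2 by (intro mult_left_mono) auto
      also have "\<dots> = t * p ((1 / t) *\<^sub>R x c + e n) - f c" unfolding xscale using 2 by (simp add: right_diff_distrib)
      also have "t * p ((1 / t) *\<^sub>R x c + e n) = p (t *\<^sub>R ((1 / t) *\<^sub>R x c + e n))"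
        using sn_scale[OF sn, of "(1 / t) *\<^sub>R x c + e n" t] sn_mem[OF sn] xV e 2 by simp
      also have "t *\<^sub>R ((1 / t) *\<^sub>R x c + e n) = x c + t *\<^sub>R e n" using 2 by (simp add: scaleR_add_right)
      finally show ?thesis by simp
    next
      case 3
      define s where "s = - t"
      have s: "s > 0" using 3 by (simp add: s_def)
      have "s * (f (\<lambda>i. (1 / s) * c i) - p (x (\<lambda>i. (1 / s) * c i) - e n)) \<le> s * \<alpha>" using lo s by (intro mult_left_mono) auto
      then have "f c - s * p ((1 / s) *\<^sub>R x c - e n) \<le> s * \<alpha>" unfolding xscale using s by (simp add: right_diff_distrib)
      moreover have "s * p ((1 / s) *\<^sub>R x c - e n) = p (s *\<^sub>R ((1 / s) *\<^sub>R x c - e n))"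
        using sn_scale[OF sn, of "(1 / s) *\<^sub>R x c - e n" s] sn_mem[OF sn] xV e s by simp
      moreover have "s *\<^sub>R ((1 / s) *\<^sub>R x c - e n) = x c + t *\<^sub>R e n" using s by (simp add: scaleR_diff_right s_def)
      ultimately show ?thesis by (simp add: s_def)
    qed
  qed
  then show ?thesis by (intro exI[of _ \<alpha>]) (simp add: x_def f_def)
qed

text \<open>Starting with the value \<open>p (e 0)\<close> makes the functional norming at the first
  vector; each later value is an extension by one vector.\<close>

lemma hahn_banach_sequence:
  assumes sn: "seminorm_on V p" and e: "\<And>i. e i \<in> V"
  obtains \<phi> :: "nat \<Rightarrow> real" where "\<phi> 0 = p (e 0)" "\<And>n c. (\<Sum>i<n. c i * \<phi> i) \<le> p (\<Sum>i<n. c i *\<^sub>R e i)"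
proof -
  define P where "P n \<phi> \<longleftrightarrow> (\<forall>c. (\<Sum>i<Suc n. c i * \<phi> i) \<le> p (\<Sum>i<Suc n. c i *\<^sub>R e i)) \<and> \<phi> 0 = p (e 0)" for n and \<phi> :: "nat \<Rightarrow> real"
  have "\<exists>f. \<forall>n. P n (f n) \<and> (\<forall>i\<le>n. f (Suc n) i = f n i)"
  proof (rule dependent_nat_choice)
    have "c * p (e 0) \<le> p (c *\<^sub>R e 0)" for c
      using sn_scale[OF sn e, of c 0] sn_nonneg[OF sn e, of 0] by (simp add: mult_right_mono)
    then show "\<exists>\<phi>. P 0 \<phi>" unfolding P_def by (intro exI[of _ "\<lambda>_. p (e 0)"]) simp
    fix \<phi> n assume P: "P n \<phi>"
    obtain \<alpha> where \<alpha>: "\<forall>c. (\<Sum>i<Suc n. c i * \<phi> i) + c (Suc n) * \<alpha> \<le> p (\<Sum>i<Suc (Suc n). c i *\<^sub>R e i)"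
      using hahn_banach_step[where n="Suc n" and \<phi>=\<phi> and e=e, OF sn e] P unfolding P_def by blast
    have "P (Suc n) (\<phi>(Suc n := \<alpha>))" unfolding P_def
    proof (intro conjI allI)
      fix c
      have "(\<Sum>i<Suc (Suc n). c i * (\<phi>(Suc n := \<alpha>)) i) = (\<Sum>i<Suc n. c i * \<phi> i) + c (Suc n) * \<alpha>" by simp
      then show "(\<Sum>i<Suc (Suc n). c i * (\<phi>(Suc n := \<alpha>)) i) \<le> p (\<Sum>i<Suc (Suc n). c i *\<^sub>R e i)" using \<alpha> by simp
    qed (use P in \<open>simp add: P_def\<close>)
    then show "\<exists>\<psi>. P (Suc n) \<psi> \<and> (\<forall>i\<le>n. \<psi> i = \<phi> i)" by (intro exI[of _ "\<phi>(Suc n := \<alpha>)"]) auto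
  qed
  then obtain f where f: "\<And>n. P n (f n)" "\<And>n i. i \<le> n \<Longrightarrow> f (Suc n) i = f n i" by blast
  have ff: "f m i = f i i" if "i \<le> m" for m i using that by (induction m rule: dec_induct) (auto simp: f(2))
  show ?thesis
  proof (rule that[of "\<lambda>i. f i i"])
    show "f 0 0 = p (e 0)" using f(1)[of 0] by (simp add: P_def)
    fix n c
    show "(\<Sum>i<n. c i * f i i) \<le> p (\<Sum>i<n. c i *\<^sub>R e i)"
    proof (cases n)
      case 0 then show ?thesis using sn_zero[OF sn] by simp
    next
      case (Suc m)
      have "(\<Sum>i<n. c i * f i i) = (\<Sum>i<Suc m. c i * f m i)" unfolding Suc by (rule sum.cong) (use ff[of _ m] in auto)
      then show ?thesis using f(1)[of m] Suc by (simp add: P_def)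
    qed
  qed
qed

text \<open>Rounding the first \<open>n\<close> values to a grid of width \<open>e\<close> leaves
  finitely many tuples, and one representative of each suffices.\<close>

lemma totally_bounded_sequence:
  fixes f :: "nat \<Rightarrow> nat \<Rightarrow> real"
  assumes bd: "\<And>l. \<exists>C. \<forall>j. \<bar>f j l\<bar> \<le> C" and e: "e > 0"
  obtains K where "\<And>j. \<exists>i<K. \<forall>l<n. \<bar>f j l - f i l\<bar> \<le> e"
proof -
  obtain C where C: "\<And>l j. \<bar>f j l\<bar> \<le> C l" using bd by metis
  define g where "g j = restrict (\<lambda>l. \<lfloor>f j l / e\<rfloor>) {..<n}" for j
  have "g j \<in> (\<Pi>\<^sub>E l\<in>{..<n}. {\<lfloor>- C l / e\<rfloor>..\<lfloor>C l / e\<rfloor>})" for j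
  proof -
    have "- C l \<le> f j l" "f j l \<le> C l" for l using C[of j l] by auto
    then have "- C l / e \<le> f j l / e" "f j l / e \<le> C l / e" for l
      using divide_right_mono[of "- C l" "f j l" e] divide_right_mono[of "f j l" "C l" e] e by auto
    then show ?thesis unfolding g_def by (auto intro!: floor_mono)
  qed
  then have "range g \<subseteq> (\<Pi>\<^sub>E l\<in>{..<n}. {\<lfloor>- C l / e\<rfloor>..\<lfloor>C l / e\<rfloor>})" by blast
  then have "finite (range g)" by (rule finite_subset) (intro finite_PiE, auto)
  then obtain R where R: "finite R" "range g = g ` R" using finite_subset_image[of "range g" g UNIV] by auto
  have "\<exists>i<Suc (Max (insert 0 R)). \<forall>l<n. \<bar>f j l - f i l\<bar> \<le> e" for j
  proof -
    obtain i where i: "i \<in> R" "g j = g i" using R(2) by (metis imageE rangeI)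
    have "\<bar>f j l - f i l\<bar> \<le> e" if l: "l < n" for l
    proof -
      have "\<lfloor>f j l / e\<rfloor> = \<lfloor>f i l / e\<rfloor>" using fun_cong[OF i(2), of l] l by (simp add: g_def)
      then have "\<bar>f j l / e - f i l / e\<bar> \<le> 1" by linarith
      then show ?thesis using e by (simp add: diff_divide_distrib[symmetric] divide_le_eq)
    qed
    moreover have "i \<le> Max (insert 0 R)" using i(1) R(1) by (intro Max_ge) auto
    ultimately show ?thesis by (metis le_imp_less_Suc)
  qed
  then show ?thesis using that by blast
qed

lemma linear_map_sum:
  fixes H :: "'v::real_vector \<Rightarrow> 'w::real_vector"
  assumes S: "subspace S" and add: "\<And>x y. x \<in> S \<Longrightarrow> y \<in> S \<Longrightarrow> H (x + y) = H x + H y"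
    and scale: "\<And>c x. x \<in> S \<Longrightarrow> H (c *\<^sub>R x) = c *\<^sub>R H x" and g: "\<And>i. g i \<in> S"
  shows "H (\<Sum>i<(n::nat). c i *\<^sub>R g i) = (\<Sum>i<n. c i *\<^sub>R H (g i))"
proof (induction n)
  case 0
  show ?case using scale[of 0 0] subspace_0[OF S] by simp
next
  case (Suc n)
  have "(\<Sum>i<n. c i *\<^sub>R g i) \<in> S" "c n *\<^sub>R g n \<in> S"
    using g S by (auto intro!: subspace_sum subspace_scale)
  then show ?case using Suc by (simp add: add scale g)
qed

definition unit :: "nat \<Rightarrow> nat \<Rightarrow> real" where
  "unit i = (\<lambda>j. if j = i then 1 else 0)"

definition fin :: "(nat \<Rightarrow> real) set" where
  "fin = (\<Union>n. supported n)"

lemma supported_mono: "m \<le> n \<Longrightarrow> supported m \<subseteq> supported n"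
  by (auto simp: supported_def)

lemma unit_supported: "i < n \<Longrightarrow> unit i \<in> supported n"
  by (auto simp: unit_def supported_def)

lemma unit_fin: "unit i \<in> fin" unfolding fin_def using unit_supported by blast

lemma supported_fin: "c \<in> supported n \<Longrightarrow> c \<in> fin" unfolding fin_def by blast

lemma supported_sum: assumes "c \<in> supported n" shows "(\<Sum>i<n. c i *\<^sub>R unit i) = c"
proof (rule ext)
  fix j
  have "(\<Sum>i<m. c i *\<^sub>R unit i) j = (if j < m then c j else 0)" for m
    by (induction m) (auto simp: unit_def less_Suc_eq)
  then show "(\<Sum>i<n. c i *\<^sub>R unit i) j = c j" using assms by (auto simp: supported_def)
qed

lemma supported_sum_extend:
  fixes g :: "nat \<Rightarrow> 'v::real_vector"
  assumes "c \<in> supported n" "n \<le> m" shows "(\<Sum>i<m. c i *\<^sub>R g i) = (\<Sum>i<n. c i *\<^sub>R g i)"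
  by (rule sum.mono_neutral_right) (use assms in \<open>auto simp: supported_def\<close>)

lemma diff_add_diff_cancel: "(a - b) + (b - c) = a - (c::'v::real_vector)"
  by simp

text \<open>Formal finite combinations of a dense sequence, with \<open>unit j\<close> standing for
  its \<open>j\<close>-th member. A seminorm is the right notion since different combinations may
  represent the same vector.\<close>

locale separable_target =
  fixes p :: "(nat \<Rightarrow> real) \<Rightarrow> real"
  assumes psn: "seminorm_on fin p" and dense: "\<And>c e. c \<in> fin \<Longrightarrow> e > 0 \<Longrightarrow> \<exists>j. p (c - unit j) < e"
begin

lemma norming_functionals:
  obtains f :: "nat \<Rightarrow> nat \<Rightarrow> real" where
    "\<And>j n c. c \<in> supported n \<Longrightarrow> \<bar>\<Sum>i<n. c i * f j i\<bar> \<le> p c" "\<And>j. f j j = p (unit j)"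
proof -
  have "\<exists>f. (\<forall>n. \<forall>c\<in>supported n. \<bar>\<Sum>i<n. c i * f i\<bar> \<le> p c) \<and> f j = p (unit j)" for j
  proof -
    \<comment> \<open>The vector \<open>unit j\<close> is put in front, so that the functional norms
      it, and occurs a second time at index \<open>Suc j\<close>.\<close>
    define e where "e i = unit (case i of 0 \<Rightarrow> j | Suc i' \<Rightarrow> i')" for i
    have eV: "e i \<in> fin" for i by (simp add: e_def unit_fin)
    obtain \<phi> where \<phi>: "\<phi> 0 = p (e 0)" "\<And>n c. (\<Sum>i<n. c i * \<phi> i) \<le> p (\<Sum>i<n. c i *\<^sub>R e i)"
      using hahn_banach_sequence[where e=e, OF psn eV] by blast
    have le: "(\<Sum>i<n. c i * \<phi> (Suc i)) \<le> p c" if c: "c \<in> supported n" for c n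
    proof -
      have "(\<Sum>i<Suc n. (case i of 0 \<Rightarrow> 0 | Suc i' \<Rightarrow> c i') * \<phi> i) \<le> p (\<Sum>i<Suc n. (case i of 0 \<Rightarrow> 0 | Suc i' \<Rightarrow> c i') *\<^sub>R e i)"
        by (rule \<phi>(2))
      then show ?thesis unfolding sum.lessThan_Suc_shift using supported_sum[OF c] by (simp add: e_def)
    qed
    have "\<bar>\<Sum>i<n. c i * \<phi> (Suc i)\<bar> \<le> p c" if c: "c \<in> supported n" for c n
      using le[OF c] le[OF subspace_neg[OF subspace_supported c]] sn_neg[OF psn supported_fin[OF c]]
      by (simp add: sum_negf abs_le_iff)
    moreover have "\<phi> (Suc j) = p (unit j)"
    proof -
      \<comment> \<open>The combination \<open>e 0 - e (Suc j)\<close> is zero, so domination by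
        \<open>p\<close> for both signs forces equal values at the two occurrences.\<close>
      define cc where "cc s i = (case i of 0 \<Rightarrow> s | Suc i' \<Rightarrow> (if i' = j then - s else 0))" for s :: real and i
      have 1: "(\<Sum>i<Suc (Suc j). cc s i * \<phi> i) = s * \<phi> 0 - s * \<phi> (Suc j)" for s
        by (subst sum.lessThan_Suc_shift) (simp add: cc_def if_distrib[of "\<lambda>x. x * _"] cong: if_cong)
      have "(\<Sum>i<j. cc s (Suc i) *\<^sub>R e (Suc i)) = 0" for s by (intro sum.neutral) (simp add: cc_def)
      then have 2: "(\<Sum>i<Suc (Suc j). cc s i *\<^sub>R e i) = 0" for s
        by (subst sum.lessThan_Suc_shift) (simp add: e_def cc_def)
      have "s * \<phi> 0 - s * \<phi> (Suc j) \<le> 0" for s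
        using \<phi>(2)[where n="Suc (Suc j)" and c="cc s"] unfolding 1 2 sn_zero[OF psn] .
      from this[of 1] this[of "-1"] have "\<phi> 0 = \<phi> (Suc j)" by simp
      then show ?thesis using \<phi>(1) by (simp add: e_def)
    qed
    ultimately show ?thesis by (intro exI[of _ "\<lambda>i. \<phi> (Suc i)"]) blast
  qed
  then show ?thesis using that by metis
qed

text \<open>Density supplies a \<open>unit j\<close> near \<open>c\<close>, and \<open>f j\<close>
  is norming there.\<close>

lemma norming:
  assumes f: "\<And>j n c. c \<in> supported n \<Longrightarrow> \<bar>\<Sum>i<n. c i * f j i\<bar> \<le> p c" "\<And>j. f j j = p (unit j)"
    and c: "c \<in> supported n" and e: "e > 0"
  shows "\<exists>j. p c - e \<le> (\<Sum>i<n. c i * f j i)"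
proof -
  obtain j where j: "p (c - unit j) < e / 2" using dense[OF supported_fin[OF c], of "e / 2"] e by auto
  define m where "m = max n (Suc j)"
  have cm: "c \<in> supported m" "unit j \<in> supported m" using supported_mono[of n m] c by (auto simp: m_def intro: unit_supported)
  have "(\<Sum>i<m. (c - unit j) i * f j i) = (\<Sum>i<m. c i * f j i) - (\<Sum>i<m. unit j i * f j i)"
    by (simp add: left_diff_distrib sum_subtractf)
  moreover have "(\<Sum>i<m. unit j i * f j i) = f j j"
    by (simp add: unit_def m_def if_distrib[of "\<lambda>x. x * _"] cong: if_cong)
  moreover have "(\<Sum>i<m. c i * f j i) = (\<Sum>i<n. c i * f j i)"
    using supported_sum_extend[OF c, of m "f j"] by (simp add: m_def)
  moreover have "\<bar>\<Sum>i<m. (c - unit j) i * f j i\<bar> \<le> p (c - unit j)"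
    by (rule f(1)) (rule subspace_diff[OF subspace_supported cm])
  moreover have "p c - p (unit j) \<le> p (c - unit j)" by (rule sn_tri2[OF psn supported_fin[OF c] unit_fin])
  ultimately have "p c - e \<le> (\<Sum>i<n. c i * f j i)" using j f(2)[of j] by linarith
  then show ?thesis by blast
qed

text \<open>Geometric bounds make the entries Cauchy for each index \<open>i\<close>, and the
  isometry error tends to 0 for each fixed coefficient vector. Stage \<open>j\<close> of a branch
  says something only about indices below \<open>j\<close>.\<close>

lemma branch_limit:
  fixes v :: "nat \<Rightarrow> nat \<Rightarrow> 'a::banach"
  assumes iso: "\<And>j c. c \<in> supported j \<Longrightarrow> \<bar>norm (\<Sum>i<j. c i *\<^sub>R v j i) - p c\<bar> \<le> C * (1 / 2) ^ j * (\<Sum>i<j. \<bar>c i\<bar> * w i)"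
    and clo: "\<And>i j. i < j \<Longrightarrow> norm (v (Suc j) i - v j i) \<le> C * (1 / 2) ^ j * w i"
  shows "\<exists>u::nat \<Rightarrow> 'a. \<forall>n. \<forall>c\<in>supported n. norm (\<Sum>i<n. c i *\<^sub>R u i) = p c"
proof -
  have geo: "summable (\<lambda>j. C * (1 / 2) ^ j * x)" for x :: real
    by (intro summable_mult summable_mult2 summable_geometric) simp
  have "convergent (\<lambda>j. v j i)" for i
  proof -
    have "summable (\<lambda>j. v (Suc j) i - v j i)"
      by (rule summable_comparison_test'[OF geo[of "w i"], of "Suc i"]) (use clo in auto)
    then have "(\<lambda>n. \<Sum>j<n. v (Suc j) i - v j i) \<longlonglongrightarrow> (\<Sum>j. v (Suc j) i - v j i)" by (rule summable_LIMSEQ)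
    then have "(\<lambda>n. v n i - v 0 i) \<longlonglongrightarrow> (\<Sum>j. v (Suc j) i - v j i)"
      using sum_lessThan_telescope[of "\<lambda>j. v j i"] by simp
    from tendsto_add[OF this tendsto_const, of "v 0 i"] show ?thesis by (auto simp: convergent_def)
  qed
  then have lim: "(\<lambda>j. v j i) \<longlonglongrightarrow> lim (\<lambda>j. v j i)" for i by (simp add: convergent_LIMSEQ_iff)
  define u where "u i = lim (\<lambda>j. v j i)" for i
  have "norm (\<Sum>i<n. c i *\<^sub>R u i) = p c" if c: "c \<in> supported n" for n c
  proof (rule LIMSEQ_unique)
    show "(\<lambda>j. norm (\<Sum>i<n. c i *\<^sub>R v j i)) \<longlonglongrightarrow> norm (\<Sum>i<n. c i *\<^sub>R u i)"
      unfolding u_def by (intro tendsto_intros lim)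
    define W where "W = (\<Sum>i<n. \<bar>c i\<bar> * w i)"
    have "(\<lambda>j. norm (\<Sum>i<n. c i *\<^sub>R v j i) - p c) \<longlonglongrightarrow> 0"
    proof (rule Lim_null_comparison)
      show "(\<lambda>j. C * (1 / 2) ^ j * W) \<longlonglongrightarrow> 0" by (rule summable_LIMSEQ_zero[OF geo])
      show "\<forall>\<^sub>F j in sequentially. norm (norm (\<Sum>i<n. c i *\<^sub>R v j i) - p c) \<le> C * (1 / 2) ^ j * W"
      proof (rule eventually_sequentiallyI[of n])
        fix j assume j: "n \<le> j"
        have "(\<Sum>i<j. \<bar>c i\<bar> * w i) = W"
          unfolding W_def by (rule sum.mono_neutral_right) (use c j in \<open>auto simp: supported_def\<close>)
        then show "norm (norm (\<Sum>i<n. c i *\<^sub>R v j i) - p c) \<le> C * (1 / 2) ^ j * W"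
          using iso[of c j] supported_mono[OF j] c supported_sum_extend[OF c j, of "v j"] by auto
      qed
    qed
    then show "(\<lambda>j. norm (\<Sum>i<n. c i *\<^sub>R v j i)) \<longlonglongrightarrow> p c" by (rule LIM_zero_cancel)
  qed
  then show ?thesis by (intro exI[of _ u] allI ballI)
qed

lemma realization:
  fixes D :: "'a::banach set"
  assumes D: "countable D" "closure D = UNIV"
    and univ: "\<And>V N. good V N \<Longrightarrow> isom_embeds (space_of V N) TYPE('a)"
  shows "\<exists>u::nat \<Rightarrow> 'a. \<forall>n. \<forall>c\<in>supported n. norm (\<Sum>i<n. c i *\<^sub>R u i) = p c"
proof -
  obtain f :: "nat \<Rightarrow> nat \<Rightarrow> real" where f: "\<And>j n c. c \<in> supported n \<Longrightarrow> \<bar>\<Sum>i<n. c i * f j i\<bar> \<le> p c" "\<And>j. f j j = p (unit j)"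
    using norming_functionals by blast
  have funit: "\<bar>f j i\<bar> \<le> p (unit i)" for i j
  proof -
    have "(\<Sum>l<Suc i. unit i l * f j l) = f j i" by (simp add: unit_def if_distrib[of "\<lambda>x. x * _"] cong: if_cong)
    then show ?thesis using f(1)[OF unit_supported[of i "Suc i"], of j] by simp
  qed
  have pu: "p (unit i) \<ge> 0" for i by (rule sn_nonneg[OF psn unit_fin])
  have "\<exists>K. \<forall>j. \<exists>i<K. \<forall>l<n. \<bar>f j l - f i l\<bar> \<le> (1 / 2) ^ n" for n
    by (rule totally_bounded_sequence[of f "(1 / 2) ^ n" n]) (use funit in auto)
  then obtain K where K: "\<And>n j. \<exists>i<K n. \<forall>l<n. \<bar>f j l - f i l\<bar> \<le> (1 / 2) ^ n" by metis
  \<comment> \<open>The sum makes \<open>k\<close> monotone while keeping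
    \<open>K n \<le> k n\<close>.\<close>
  define k where "k n = (\<Sum>m\<le>n. K m)" for n
  have Kk: "K n \<le> k n" for n unfolding k_def by (rule member_le_sum) auto
  \<comment> \<open>A functional outside the list is replaced by a listed one that nearly agrees
    with it on the first \<open>n\<close> vectors; the default value for listed ones is required by
    \<open>r_id\<close>.\<close>
  define r where "r n j = (if j < k n then j else (SOME i. i < k n \<and> (\<forall>l<n. \<bar>f j l - f i l\<bar> \<le> (1 / 2) ^ n)))" for n j
  have r: "r n j < k n \<and> (\<forall>l<n. \<bar>f j l - f (r n j) l\<bar> \<le> (1 / 2) ^ n)" for n j
  proof (cases "j < k n")
    case False
    have "\<exists>i. i < k n \<and> (\<forall>l<n. \<bar>f j l - f i l\<bar> \<le> (1 / 2) ^ n)" using K[where n=n and j=j] Kk[of n] less_le_trans by blast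
    from someI_ex[OF this] show ?thesis using False by (simp add: r_def)
  qed (simp add: r_def)
  \<comment> \<open>Increases to 1, with \<open>B (Suc (Suc n)) - B n\<close> equal to three eighths
    of \<open>(1 / 2) ^ n\<close>.\<close>
  define B :: "nat \<Rightarrow> real" where "B n = 1 - (1 / 2) ^ n / 2" for n
  have Bb: "0 < B n" "B n \<le> 1" for n using power_le_one[of "1 / 2 :: real" n] by (auto simp: B_def)
  interpret levels k r B "\<lambda>n. (1 / 2) ^ n"
  proof
    show "k n \<le> k (Suc n)" for n by (simp add: k_def)
    show "r n j < k n" for n j using r by blast
    show "r n j = j" if "j < k n" for n j using that by (simp add: r_def)
    show "0 < B n" for n by (rule Bb)
  qed (auto simp: B_def)
  \<comment> \<open>The image of \<open>unit i\<close> in the sup-norm space of dimension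
    \<open>k n\<close>: its values under the first \<open>k n\<close> norming functionals.\<close>
  define av where "av n i = (\<lambda>j. if j < k n then f j i else 0)" for n i
  have avs: "av n i \<in> supported (k n)" for n i by (simp add: av_def supported_def)
  have avm: "msup (k n) (av n i) \<le> p (unit i)" for n i
    by (rule msup_least[OF pu]) (simp add: av_def funit)
  have av_sum: "(\<Sum>i<m. c i *\<^sub>R av n i) j = (if j < k n then \<Sum>i<m. c i * f j i else 0)" for m n c j
    by (induction m) (auto simp: av_def)
  have av_up: "msup (k n) (\<Sum>i<n. c i *\<^sub>R av n i) \<le> p c" if c: "c \<in> supported n" for n c
    by (rule msup_least) (use sn_nonneg[OF psn supported_fin[OF c]] f(1)[OF c] in \<open>auto simp: av_sum\<close>)
  \<comment> \<open>The best functional for \<open>c\<close> may have a large index; its replacement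
    below \<open>K n\<close> costs \<open>(1 / 2) ^ n\<close> per unit of coefficient.\<close>
  have av_lo: "p c - (1 / 2) ^ n * (\<Sum>i<n. \<bar>c i\<bar>) \<le> msup (k n) (\<Sum>i<n. c i *\<^sub>R av n i)" if c: "c \<in> supported n" for n c
  proof (rule field_le_epsilon)
    fix e :: real assume "e > 0"
    then obtain j where j: "p c - e \<le> (\<Sum>i<n. c i * f j i)" using norming[OF f c] by blast
    obtain i' where i': "i' < K n" "\<And>l. l < n \<Longrightarrow> \<bar>f j l - f i' l\<bar> \<le> (1 / 2) ^ n" using K[where n=n and j=j] by blast
    have "(\<Sum>i<n. c i * f j i) - (\<Sum>i<n. c i * f i' i) = (\<Sum>i<n. c i * (f j i - f i' i))"
      by (simp add: right_diff_distrib sum_subtractf)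
    also have "\<dots> \<le> (\<Sum>i<n. \<bar>c i\<bar> * (1 / 2) ^ n)"
    proof (rule sum_mono)
      fix i assume "i \<in> {..<n}"
      then have "\<bar>c i\<bar> * \<bar>f j i - f i' i\<bar> \<le> \<bar>c i\<bar> * (1 / 2) ^ n" using i'(2) by (intro mult_left_mono) auto
      then show "c i * (f j i - f i' i) \<le> \<bar>c i\<bar> * (1 / 2) ^ n"
        using abs_ge_self[of "c i * (f j i - f i' i)"] unfolding abs_mult by linarith
    qed
    also have "\<dots> = (1 / 2) ^ n * (\<Sum>i<n. \<bar>c i\<bar>)" unfolding sum_distrib_right[symmetric] by (rule mult.commute)
    finally have 1: "(\<Sum>i<n. c i * f j i) - (\<Sum>i<n. c i * f i' i) \<le> (1 / 2) ^ n * (\<Sum>i<n. \<bar>c i\<bar>)" .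
    have "i' < k n" using i'(1) Kk[of n] by simp
    then have "(\<Sum>i<n. c i * f i' i) \<le> msup (k n) (\<Sum>i<n. c i *\<^sub>R av n i)"
      using msup_upper[of i' "k n" "\<Sum>i<n. c i *\<^sub>R av n i"] by (simp add: av_sum abs_le_iff)
    then show "p c - (1 / 2) ^ n * (\<Sum>i<n. \<bar>c i\<bar>) \<le> msup (k n) (\<Sum>i<n. c i *\<^sub>R av n i) + e" using j 1 by linarith
  qed
  have av_lift: "msup (k (Suc n)) (av (Suc n) i - lift n (av n i)) \<le> (1 / 2) ^ n" if "i < n" for n i
    by (rule msup_least) (use r that in \<open>auto simp: av_def lift_def\<close>)
  \<comment> \<open>The summand 1 pays for absolute approximation errors, \<open>p (unit i)\<close>
    for those proportional to the vector.\<close>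
  define w where "w i = 1 + p (unit i)" for i
  have w1: "w i \<ge> 1" for i using pu by (simp add: w_def)
  have pcw: "p c \<le> (\<Sum>i<n. \<bar>c i\<bar> * p (unit i))" if c: "c \<in> supported n" for n c
  proof -
    have "p (\<Sum>i<n. c i *\<^sub>R unit i) \<le> (\<Sum>i<n. p (c i *\<^sub>R unit i))"
      using sn_sum[OF psn, of "{..<n}" "\<lambda>i. c i *\<^sub>R unit i"] sn_mem(3)[OF psn unit_fin] by auto
    then show ?thesis using supported_sum[OF c] sn_scale[OF psn unit_fin] by simp
  qed
  obtain d :: "nat \<Rightarrow> 'a" where d: "\<And>x e. e > 0 \<Longrightarrow> \<exists>i. norm (d i - x) < e"
  proof (rule that)
    have ne: "D \<noteq> {}" using D(2) by auto
    fix x :: 'a and e :: real assume "e > 0"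
    then obtain y where "y \<in> D" "dist y x < e" using D(2) closure_approachable[of x D] by auto
    moreover from this obtain i where "from_nat_into D i = y" using from_nat_into_surj[OF D(1)] by blast
    ultimately show "\<exists>i. norm (from_nat_into D i - x) < e" by (auto simp: dist_norm)
  qed
  \<comment> \<open>A number codes a tuple of points of a dense sequence, so the tree of tuples
    becomes a countably branching tree of lists of numbers.\<close>
  define dec where "dec m i = d (list_decode m ! i)" for m i
  have dec: "\<exists>m. \<forall>i<n. norm (dec m i - h i) \<le> e" if e: "e > 0" for n h and e :: real
  proof -
    have "\<forall>i. \<exists>j. norm (d j - h i) < e" using d[OF e] by blast
    then obtain s where s: "\<And>i. norm (d (s i) - h i) < e" using choice[of "\<lambda>i j. norm (d j - h i) < e"] by blast
    have "norm (dec (list_encode (map s [0..<n])) i - h i) \<le> e" if "i < n" for i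
      using s[of i] that by (simp add: dec_def)
    then show ?thesis by blast
  qed
  \<comment> \<open>The factor 8 leaves ample slack: the errors estimated below add up to at most
    three times the same quantity.\<close>
  define iso where "iso j m \<longleftrightarrow> (\<forall>c\<in>supported j. \<bar>norm (\<Sum>i<j. c i *\<^sub>R dec m i) - p c\<bar> \<le> 8 * (1 / 2) ^ j * (\<Sum>i<j. \<bar>c i\<bar> * w i))" for j m
  define clo where "clo j m m' \<longleftrightarrow> (\<forall>i<j. norm (dec m' i - dec m i) \<le> 8 * (1 / 2) ^ j * w i)" for j m m'
  \<comment> \<open>Entry \<open>j\<close> matters only through the first \<open>j\<close> members
    of its tuple, so entry 0 is unconstrained by \<open>iso\<close>, and neighbouring entries are
    compared on the \<open>j\<close> members they share.\<close>
  define A where "A = {t. (\<forall>j<length t. iso j (t ! j)) \<and> (\<forall>j. Suc j < length t \<longrightarrow> clo j (t ! j) (t ! Suc j))}"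
  have prefix: "t \<in> A" if "t @ u \<in> A" for t u
  proof -
    have "iso j (t ! j)" if "j < length t" for j
      using \<open>t @ u \<in> A\<close> that unfolding A_def by (metis (mono_tags, lifting) length_append mem_Collect_eq nth_append trans_less_add1)
    moreover have "clo j (t ! j) (t ! Suc j)" if "Suc j < length t" for j
    proof -
      have "clo j ((t @ u) ! j) ((t @ u) ! Suc j)" using \<open>t @ u \<in> A\<close> that by (simp add: A_def)
      then show ?thesis using that by (simp add: nth_append)
    qed
    ultimately show ?thesis by (simp add: A_def)
  qed
  show ?thesis
  proof (cases "wf {(t @ [c], t) | t c. t @ [c] \<in> A}")
    case False
    then obtain h where h: "\<And>i. (h (Suc i), h i) \<in> {(t @ [c], t) | t c. t @ [c] \<in> A}"
      unfolding wf_iff_no_infinite_down_chain by blast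
    have "\<exists>c. h (Suc i) = h i @ [c] \<and> h (Suc i) \<in> A" for i using h[of i] by auto
    then obtain e where e: "\<And>i. h (Suc i) = h i @ [e i]" "\<And>i. h (Suc i) \<in> A" by metis
    \<comment> \<open>The descending chain may start at a nonempty list, so only a lower bound on
      the lengths is available.\<close>
    have len: "length (h i) \<ge> i" for i by (induction i) (simp_all add: e(1))
    define g where "g j = h (Suc j) ! j" for j
    have l1: "j < length (h (Suc j))" for j using len[of "Suc j"] by simp
    have "iso j (g j)" for j using e(2)[of j] l1[of j] unfolding A_def g_def by blast
    moreover have "clo j (g j) (g (Suc j))" for j
    proof -
      have "g j = h (Suc (Suc j)) ! j" using l1[of j] unfolding g_def e(1)[of "Suc j"] by (simp add: nth_append del: e)
      moreover have "clo j (h (Suc (Suc j)) ! j) (h (Suc (Suc j)) ! Suc j)"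
        using e(2)[of "Suc j"] l1[of "Suc j"] unfolding A_def by blast
      ultimately show ?thesis by (simp add: g_def)
    qed
    ultimately show ?thesis unfolding iso_def clo_def
      by (intro branch_limit[where v="\<lambda>j. dec (g j)" and C=8 and w=w]) blast+
  next
    case True
    have "\<exists>V N W. system A [] V N W" by (rule system_exists[OF _ True]) (rule prefix)
    then obtain V N W where sys: "system A [] V N W" by blast
    then have g: "good V N" by (simp add: system_def)
    note sn = good_sn[OF g]
    have "\<exists>T :: (nat \<Rightarrow> real) \<Rightarrow> 'a. (\<forall>x\<in>V. \<forall>y\<in>V. T (x + y) = T x + T y) \<and>
        (\<forall>c. \<forall>x\<in>V. T (c *\<^sub>R x) = c *\<^sub>R T x) \<and> (\<forall>x\<in>V. norm (T x) = N x)"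
      using univ[OF g] by (simp add: isom_embeds_def)
    then obtain T :: "(nat \<Rightarrow> real) \<Rightarrow> 'a" where TT: "\<forall>x\<in>V. \<forall>y\<in>V. T (x + y) = T x + T y"
      "\<forall>c. \<forall>x\<in>V. T (c *\<^sub>R x) = c *\<^sub>R T x" "\<forall>x\<in>V. norm (T x) = N x" by blast
    have T: "\<And>x y. x \<in> V \<Longrightarrow> y \<in> V \<Longrightarrow> T (x + y) = T x + T y"
      "\<And>c x. x \<in> V \<Longrightarrow> T (c *\<^sub>R x) = c *\<^sub>R T x" "\<And>x. x \<in> V \<Longrightarrow> norm (T x) = N x"
      using TT by auto
    have Tdist: "norm (T x - T y) = N (x - y)" if "x \<in> V" "y \<in> V" for x y
    proof -
      have "T (x - y) = T (x + (-1) *\<^sub>R y)" by simp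
      also have "\<dots> = T x - T y" using T(1)[OF that(1) sn_mem(3)[OF sn that(2)], of "-1"] T(2)[OF that(2), of "-1"] by simp
      finally show ?thesis using T(3)[OF sn_mem(4)[OF sn that]] by simp
    qed
    have emb: "embedding (length u) V N (W u)" if "u \<in> A" for u using sys that by (simp add: system_def)
    have close: "N (W u x - W (u @ [c]) (lift (length u) x)) \<le> (1 / 2) ^ length u * msup (k (length u)) x"
      if "u @ [c] \<in> A" "x \<in> supported (k (length u))" for u c x
      using sys that by (simp add: system_def)
    \<comment> \<open>Entry \<open>j\<close> approximates the image under \<open>T\<close> of the
      piece attached to the node \<open>take j t\<close>, hence its target depends only on earlier
      entries.\<close>
    define Q where "Q t \<longleftrightarrow> t \<in> A \<and> (\<forall>j<length t. \<forall>i<j. norm (dec (t ! j) i - T (W (take j t) (av j i))) \<le> (1 / 2) ^ j)" for t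
    have step: "\<exists>m. Q (t @ [m])" if Qt: "Q t" for t
    proof -
      define n where "n = length t"
      have tA: "t \<in> A" using Qt by (simp add: Q_def)
      have e: "embedding n V N (W t)" using emb[OF tA] by (simp add: n_def)
      then have WV: "x \<in> supported (k n) \<Longrightarrow> W t x \<in> V" and Wlo: "x \<in> supported (k n) \<Longrightarrow> B n * msup (k n) x \<le> N (W t x)"
        and Wup: "x \<in> supported (k n) \<Longrightarrow> N (W t x) \<le> B (Suc n) * msup (k n) x"
        and Wadd: "x \<in> supported (k n) \<Longrightarrow> y \<in> supported (k n) \<Longrightarrow> W t (x + y) = W t x + W t y"
        and Wscale: "x \<in> supported (k n) \<Longrightarrow> W t (c *\<^sub>R x) = c *\<^sub>R W t x" for x y c
        by (simp_all add: embedding_def)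
      define G where "G i = T (W t (av n i))" for i
      obtain m where m: "\<And>i. i < n \<Longrightarrow> norm (dec m i - G i) \<le> (1 / 2) ^ n" using dec[of "(1 / 2) ^ n" n G] by auto
      have "iso n m" unfolding iso_def
      proof
        fix c :: "nat \<Rightarrow> real" assume c: "c \<in> supported n"
        define x where "x = (\<Sum>i<n. c i *\<^sub>R av n i)"
        have xs: "x \<in> supported (k n)" unfolding x_def using avs subspace_supported
          by (auto intro!: subspace_sum subspace_scale)
        define S where "S = (\<Sum>i<n. \<bar>c i\<bar>)"
        define R where "R = (\<Sum>i<n. \<bar>c i\<bar> * p (unit i))"
        have SR: "(\<Sum>i<n. \<bar>c i\<bar> * w i) = S + R" by (simp add: w_def S_def R_def distrib_left sum.distrib)
        have S0: "S \<ge> 0" "R \<ge> 0" using pu by (simp_all add: S_def R_def sum_nonneg)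
        have "T (W t x) = (\<Sum>i<n. c i *\<^sub>R G i)" unfolding x_def G_def
          by (rule linear_map_sum[where H="\<lambda>x. T (W t x)" and S="supported (k n)"])
            (auto simp: subspace_supported Wadd Wscale WV T avs)
        then have nG: "norm (\<Sum>i<n. c i *\<^sub>R G i) = N (W t x)" using T(3)[OF WV[OF xs]] by simp
        have "\<bar>norm (\<Sum>i<n. c i *\<^sub>R dec m i) - norm (\<Sum>i<n. c i *\<^sub>R G i)\<bar> \<le> norm (\<Sum>i<n. c i *\<^sub>R (dec m i - G i))"
          using norm_triangle_ineq3[of "\<Sum>i<n. c i *\<^sub>R dec m i" "\<Sum>i<n. c i *\<^sub>R G i"]
          by (simp add: scaleR_diff_right sum_subtractf)
        also have "\<dots> \<le> (\<Sum>i<n. \<bar>c i\<bar> * (1 / 2) ^ n)"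
          using m by (intro sum_norm_le) (auto intro!: mult_left_mono)
        also have "\<dots> = (1 / 2) ^ n * S" unfolding S_def sum_distrib_right[symmetric] by (rule mult.commute)
        finally have 1: "\<bar>norm (\<Sum>i<n. c i *\<^sub>R dec m i) - N (W t x)\<bar> \<le> (1 / 2) ^ n * S" unfolding nG .
        have up: "N (W t x) \<le> p c"
        proof -
          have "N (W t x) \<le> 1 * msup (k n) x"
            using Wup[OF xs] mult_right_mono[OF Bb(2)[of "Suc n"] msup_nonneg[of "k n" x]] by linarith
          then show ?thesis using av_up[OF c] by (simp add: x_def)
        qed
        \<comment> \<open>Two losses occur: \<open>B n < 1\<close> costs a proportion of the vector,
          and restricting to finitely many functionals costs an absolute amount per
          coefficient.\<close>
        have lo: "p c - (1 / 2) ^ n * (S + R) \<le> N (W t x)"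
        proof -
          have "(1 / 2) ^ n / 2 * msup (k n) x \<le> (1 / 2) ^ n * R"
          proof -
            have "msup (k n) x \<le> R" using av_up[OF c] pcw[OF c] by (simp add: x_def R_def)
            then have "(1 / 2) ^ n / 2 * msup (k n) x \<le> (1 / 2) ^ n / 2 * R" by (intro mult_left_mono) auto
            also have "\<dots> \<le> (1 / 2) ^ n * R" using S0 by (intro mult_right_mono) auto
            finally show ?thesis .
          qed
          moreover have "B n * msup (k n) x = msup (k n) x - (1 / 2) ^ n / 2 * msup (k n) x" by (simp add: B_def left_diff_distrib)
          moreover have "p c - (1 / 2) ^ n * S \<le> msup (k n) x" using av_lo[OF c] by (simp add: x_def S_def)
          ultimately show ?thesis using Wlo[OF xs] unfolding distrib_left by linarith
        qed
        have "0 \<le> (1 / 2) ^ n * S" "0 \<le> (1 / 2) ^ n * R" using S0 by auto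
        then have "\<bar>norm (\<Sum>i<n. c i *\<^sub>R dec m i) - p c\<bar> \<le> 8 * ((1 / 2) ^ n * S + (1 / 2) ^ n * R)"
          using 1 up lo unfolding distrib_left by linarith
        then show "\<bar>norm (\<Sum>i<n. c i *\<^sub>R dec m i) - p c\<bar> \<le> 8 * (1 / 2) ^ n * (\<Sum>i<n. \<bar>c i\<bar> * w i)"
          unfolding SR by (simp add: distrib_left)
      qed
      moreover have "clo n' (t ! n') m" if n': "n = Suc n'" for n'
        unfolding clo_def
      proof (intro allI impI)
        fix i assume i: "i < n'"
        define t' where "t' = take n' t"
        have t': "t = t' @ [t ! n']" "length t' = n'" using n' unfolding n_def t'_def
          by (simp_all add: take_Suc_conv_app_nth[symmetric])
        have t'A: "t' \<in> A" using prefix[of t' "[t ! n']"] tA t'(1) by simp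
        have ls: "lift n' (av n' i) \<in> supported (k n)" using lift_supported[of n'] n' by simp
        have W'V: "W t' (av n' i) \<in> V" using emb[OF t'A] avs t'(2) by (simp add: embedding_def)
        \<comment> \<open>Piece \<open>n'\<close> is compared with piece \<open>n\<close> in two
          steps: \<open>av n i\<close> against the lifted \<open>av n' i\<close> at the same node
          \<open>t\<close>, then the map at \<open>t\<close> on the lifted vector against the map at
          the parent \<open>t'\<close>.\<close>
        have "N (W t (av n i) - W t (lift n' (av n' i))) \<le> (1 / 2) ^ n'"
        proof -
          have ds: "av n i - lift n' (av n' i) \<in> supported (k n)" by (intro subspace_diff[OF subspace_supported] avs ls)
          have "W t ((av n i - lift n' (av n' i)) + lift n' (av n' i)) = W t (av n i - lift n' (av n' i)) + W t (lift n' (av n' i))"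
            by (rule Wadd[OF ds ls])
          then have "W t (av n i) - W t (lift n' (av n' i)) = W t (av n i - lift n' (av n' i))" by simp
          then have "N (W t (av n i) - W t (lift n' (av n' i))) \<le> B (Suc n) * msup (k n) (av n i - lift n' (av n' i))"
            using Wup[OF ds] by simp
          also have "\<dots> \<le> 1 * (1 / 2) ^ n'" using av_lift[OF i] n' Bb[of "Suc n"] msup_nonneg by (intro mult_mono) auto
          finally show ?thesis by simp
        qed
        moreover have "N (W t (lift n' (av n' i)) - W t' (av n' i)) \<le> (1 / 2) ^ n' * p (unit i)"
        proof -
          have "N (W t' (av n' i) - W t (lift n' (av n' i))) \<le> (1 / 2) ^ n' * msup (k n') (av n' i)"
            using close[of t' "t ! n'" "av n' i"] t' tA avs by simp
          also have "\<dots> \<le> (1 / 2) ^ n' * p (unit i)" using avm by (intro mult_left_mono) auto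
          finally show ?thesis using sn_commute[OF sn W'V WV[OF ls]] by simp
        qed
        moreover have "N (W t (av n i) - W t' (av n' i)) \<le> N (W t (av n i) - W t (lift n' (av n' i))) + N (W t (lift n' (av n' i)) - W t' (av n' i))"
          using sn_tri[where x="W t (av n i) - W t (lift n' (av n' i))" and y="W t (lift n' (av n' i)) - W t' (av n' i)", OF sn
            sn_mem(4)[OF sn WV[OF avs] WV[OF ls]] sn_mem(4)[OF sn WV[OF ls] W'V]] unfolding diff_add_diff_cancel .
        ultimately have 1: "norm (G i - T (W t' (av n' i))) \<le> (1 / 2) ^ n' + (1 / 2) ^ n' * p (unit i)"
          unfolding G_def Tdist[OF WV[OF avs] W'V] by linarith
        have 2: "norm (dec m i - G i) \<le> (1 / 2) ^ n'" using order_trans[OF m[of i]] i n' by simp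
        have 3: "norm (dec (t ! n') i - T (W t' (av n' i))) \<le> (1 / 2) ^ n'"
          using Qt i n' unfolding Q_def t'_def n_def by simp
        have "dec m i - dec (t ! n') i = (dec m i - G i) + (G i - T (W t' (av n' i))) - (dec (t ! n') i - T (W t' (av n' i)))" by simp
        then have "norm (dec m i - dec (t ! n') i) \<le> norm (dec m i - G i) + norm (G i - T (W t' (av n' i))) + norm (dec (t ! n') i - T (W t' (av n' i)))"
          using norm_triangle_ineq4[of "(dec m i - G i) + (G i - T (W t' (av n' i)))" "dec (t ! n') i - T (W t' (av n' i))"]
            norm_triangle_ineq[of "dec m i - G i" "G i - T (W t' (av n' i))"] by simp
        then have "norm (dec m i - dec (t ! n') i) \<le> 3 * (1 / 2) ^ n' + (1 / 2) ^ n' * p (unit i)" using 1 2 3 by linarith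
        also have "\<dots> \<le> 8 * ((1 / 2) ^ n' + (1 / 2) ^ n' * p (unit i))" using pu[of i] by simp
        also have "\<dots> = 8 * (1 / 2) ^ n' * w i" by (simp add: w_def distrib_left)
        finally show "norm (dec m i - dec (t ! n') i) \<le> 8 * (1 / 2) ^ n' * w i" .
      qed
      ultimately have "t @ [m] \<in> A" using tA unfolding A_def n_def by (auto simp: nth_append less_Suc_eq)
      moreover have "norm (dec ((t @ [m]) ! j) i - T (W (take j (t @ [m])) (av j i))) \<le> (1 / 2) ^ j"
        if "j < length (t @ [m])" "i < j" for i j
      proof (cases "j = n")
        case True
        then show ?thesis using m[of i] that by (simp add: n_def G_def nth_append)
      next
        case False
        then have "j < length t" using that by (simp add: n_def)
        then show ?thesis using Qt that by (simp add: Q_def nth_append)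
      qed
      ultimately show ?thesis by (auto simp: Q_def)
    qed
    have "\<not> Q t" for t using True
    proof (induction t rule: wf_induct_rule)
      case (less t)
      show ?case
      proof
        assume "Q t"
        then obtain m where m: "Q (t @ [m])" using step by blast
        then have "(t @ [m], t) \<in> {(t @ [c], t) | t c. t @ [c] \<in> A}" by (auto simp: Q_def)
        from less[OF this] m show False by blast
      qed
    qed
    moreover have "Q []" by (simp add: Q_def A_def)
    ultimately show ?thesis by blast
  qed
qed

end

section \<open>Embedding spaces given by a record\<close>

primrec lincomb :: "('u, 'm) nspace_scheme \<Rightarrow> (nat \<Rightarrow> 'u) \<Rightarrow> nat \<Rightarrow> (nat \<Rightarrow> real) \<Rightarrow> 'u" where
  "lincomb S x 0 c = zer S"
| "lincomb S x (Suc n) c = addv S (lincomb S x n c) (smul S (c n) (x n))"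

locale dense_sequence =
  fixes S :: "('u, 'm) nspace_scheme" and x :: "nat \<Rightarrow> 'u"
  assumes ns: "normed_space_str S" and x_mem: "x i \<in> carr S"
    and x_dense: "y \<in> carr S \<Longrightarrow> e > 0 \<Longrightarrow> \<exists>i. nrm S (minusv S y (x i)) < e"
begin

lemma zer_mem: "zer S \<in> carr S"
  and addv_mem: "a \<in> carr S \<Longrightarrow> b \<in> carr S \<Longrightarrow> addv S a b \<in> carr S"
  and smul_mem: "a \<in> carr S \<Longrightarrow> smul S t a \<in> carr S"
  and addv_assoc: "a \<in> carr S \<Longrightarrow> b \<in> carr S \<Longrightarrow> c \<in> carr S \<Longrightarrow> addv S (addv S a b) c = addv S a (addv S b c)"
  and addv_commute: "a \<in> carr S \<Longrightarrow> b \<in> carr S \<Longrightarrow> addv S a b = addv S b a"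
  and addv_zer: "a \<in> carr S \<Longrightarrow> addv S a (zer S) = a"
  and addv_inverse: "a \<in> carr S \<Longrightarrow> addv S a (smul S (-1) a) = zer S"
  and smul_smul: "a \<in> carr S \<Longrightarrow> smul S s (smul S t a) = smul S (s * t) a"
  and smul_one: "a \<in> carr S \<Longrightarrow> smul S 1 a = a"
  and smul_addv: "a \<in> carr S \<Longrightarrow> b \<in> carr S \<Longrightarrow> smul S t (addv S a b) = addv S (smul S t a) (smul S t b)"
  and smul_plus: "a \<in> carr S \<Longrightarrow> smul S (s + t) a = addv S (smul S s a) (smul S t a)"
  and nrm_eq_0: "a \<in> carr S \<Longrightarrow> nrm S a = 0 \<longleftrightarrow> a = zer S"
  and nrm_smul: "a \<in> carr S \<Longrightarrow> nrm S (smul S t a) = \<bar>t\<bar> * nrm S a"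
  and nrm_addv: "a \<in> carr S \<Longrightarrow> b \<in> carr S \<Longrightarrow> nrm S (addv S a b) \<le> nrm S a + nrm S b"
  using ns by (auto simp: normed_space_str_def)

lemma zer_addv: "a \<in> carr S \<Longrightarrow> addv S (zer S) a = a"
  using addv_commute[of "zer S" a] addv_zer[of a] zer_mem by simp

lemma smul_0: "a \<in> carr S \<Longrightarrow> smul S 0 a = zer S"
  using smul_plus[of a 1 "-1"] smul_one[of a] addv_inverse[of a] by simp

lemma smul_zer: "smul S t (zer S) = zer S"
  using smul_smul[OF zer_mem, of t 0] smul_0[OF zer_mem] by simp

lemma addv_swap:
  assumes "a \<in> carr S" "b \<in> carr S" "c \<in> carr S" "d \<in> carr S"
  shows "addv S (addv S a b) (addv S c d) = addv S (addv S a c) (addv S b d)"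
proof -
  have "addv S b (addv S c d) = addv S c (addv S b d)"
    using assms by (simp add: addv_assoc[symmetric] addv_commute[of b c])
  then show ?thesis using assms by (simp add: addv_assoc addv_mem)
qed

lemma minusv_mem: "a \<in> carr S \<Longrightarrow> b \<in> carr S \<Longrightarrow> minusv S a b \<in> carr S"
  by (simp add: minusv_def addv_mem smul_mem)

lemma minusv_addv:
  assumes "a \<in> carr S" "b \<in> carr S" "c \<in> carr S" "d \<in> carr S"
  shows "minusv S (addv S a b) (addv S c d) = addv S (minusv S a c) (minusv S b d)"
  using assms by (simp add: minusv_def smul_addv addv_swap smul_mem)

lemma minusv_smul: "a \<in> carr S \<Longrightarrow> b \<in> carr S \<Longrightarrow> minusv S (smul S t a) (smul S t b) = smul S t (minusv S a b)"
  by (simp add: minusv_def smul_addv smul_smul smul_mem)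

lemma nrm_minusv_commute:
  assumes "a \<in> carr S" "b \<in> carr S" shows "nrm S (minusv S a b) = nrm S (minusv S b a)"
proof -
  have "smul S (-1) (minusv S a b) = minusv S b a"
    using assms by (simp add: minusv_def smul_addv smul_smul smul_mem smul_one addv_commute)
  then show ?thesis using nrm_smul[OF minusv_mem[OF assms], of "-1"] by simp
qed

lemma minusv_addv_cancel: assumes "a \<in> carr S" "b \<in> carr S" shows "addv S (minusv S a b) b = a"
  using assms addv_commute[of "smul S (-1) b" b]
  by (simp add: minusv_def addv_assoc smul_mem addv_inverse addv_zer)

lemma nrm_diff_le:
  assumes "a \<in> carr S" "b \<in> carr S" shows "\<bar>nrm S a - nrm S b\<bar> \<le> nrm S (minusv S a b)"
  using nrm_addv[OF minusv_mem[OF assms] assms(2)] nrm_addv[OF minusv_mem[OF assms(2,1)] assms(1)]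
    minusv_addv_cancel[OF assms] minusv_addv_cancel[OF assms(2,1)] nrm_minusv_commute[OF assms] by simp

lemma lincomb_mem: "lincomb S x n c \<in> carr S"
  by (induction n) (simp_all add: zer_mem addv_mem smul_mem x_mem)

lemma lincomb_add: "lincomb S x n (c + d) = addv S (lincomb S x n c) (lincomb S x n d)"
  by (induction n) (simp_all add: addv_zer zer_mem smul_plus x_mem addv_swap lincomb_mem smul_mem)

lemma lincomb_scale: "lincomb S x n (t *\<^sub>R c) = smul S t (lincomb S x n c)"
  by (induction n) (simp_all add: smul_zer smul_addv smul_smul x_mem lincomb_mem smul_mem)

lemma lincomb_zero: "(\<And>i. i < n \<Longrightarrow> c i = 0) \<Longrightarrow> lincomb S x n c = zer S"
  by (induction n) (simp_all add: smul_0 x_mem addv_zer zer_mem)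

lemma lincomb_extend: "n \<le> m \<Longrightarrow> c \<in> supported n \<Longrightarrow> lincomb S x m c = lincomb S x n c"
  by (induction m rule: dec_induct) (simp_all add: supported_def smul_0 x_mem addv_zer lincomb_mem)

text \<open>The choice of \<open>n\<close> is immaterial by \<open>lincomb_extend\<close>, since
  coefficients beyond the support vanish.\<close>

definition comb :: "(nat \<Rightarrow> real) \<Rightarrow> 'u" where
  "comb c = lincomb S x (SOME n. c \<in> supported n) c"

lemma comb_eq: assumes c: "c \<in> supported n" shows "comb c = lincomb S x n c"
proof -
  define m where "m = (SOME n. c \<in> supported n)"
  have m: "c \<in> supported m" unfolding m_def by (rule someI[of _ n]) (rule c)
  have "lincomb S x m c = lincomb S x (max m n) c" "lincomb S x n c = lincomb S x (max m n) c"
    using lincomb_extend[of m "max m n" c] lincomb_extend[of n "max m n" c] m c by simp_all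
  then show ?thesis by (simp add: comb_def m_def)
qed

lemma comb_mem: "comb c \<in> carr S"
  by (simp add: comb_def lincomb_mem)

lemma fin_common: assumes "c \<in> fin" "d \<in> fin" obtains n where "c \<in> supported n" "d \<in> supported n"
proof -
  obtain m n where "c \<in> supported m" "d \<in> supported n" using assms by (auto simp: fin_def)
  then show ?thesis using that[of "max m n"] supported_mono[of m "max m n"] supported_mono[of n "max m n"] by auto
qed

lemma comb_add: assumes "c \<in> fin" "d \<in> fin" shows "c + d \<in> fin \<and> comb (c + d) = addv S (comb c) (comb d)"
proof -
  obtain n where n: "c \<in> supported n" "d \<in> supported n" using fin_common[OF assms] .
  then show ?thesis using subspace_add[OF subspace_supported n] supported_fin by (auto simp: comb_eq lincomb_add)
qed

lemma comb_scale: assumes "c \<in> fin" shows "t *\<^sub>R c \<in> fin \<and> comb (t *\<^sub>R c) = smul S t (comb c)"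
proof -
  obtain n where n: "c \<in> supported n" using assms by (auto simp: fin_def)
  have "t *\<^sub>R c \<in> supported n" by (rule subspace_scale[OF subspace_supported n])
  from supported_fin[OF this] comb_eq[OF this] comb_eq[OF n] show ?thesis by (simp add: lincomb_scale)
qed

lemma comb_unit: "comb (unit i) = x i"
proof -
  have "lincomb S x i (unit i) = zer S" by (rule lincomb_zero) (simp add: unit_def)
  then show ?thesis using comb_eq[OF unit_supported[of i "Suc i"]]
    by (simp add: unit_def zer_addv smul_one x_mem)
qed

lemma separable_target: "separable_target (\<lambda>c. nrm S (comb c))"
proof
  have "subspace fin"
    using comb_add comb_scale supported_fin[OF subspace_0[OF subspace_supported]] by (auto simp: subspace_def)
  then show "seminorm_on fin (\<lambda>c. nrm S (comb c))"
    using comb_add comb_scale nrm_addv comb_mem nrm_smul by (simp add: seminorm_on_def)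
  fix c :: "nat \<Rightarrow> real" and e :: real assume c: "c \<in> fin" and "e > 0"
  then obtain j where "nrm S (minusv S (comb c) (x j)) < e" using x_dense[OF comb_mem] by blast
  moreover have "comb (c - unit j) = minusv S (comb c) (x j)"
    using comb_add[OF c, of "(-1) *\<^sub>R unit j"] comb_scale[OF unit_fin, of "-1" j] by (simp add: comb_unit minusv_def)
  ultimately show "\<exists>j. nrm S (comb (c - unit j)) < e" by (intro exI[of _ j]) simp
qed

text \<open>Extension of an isometry from combinations of a dense sequence to the whole space.
  Additivity, homogeneity and isometry all follow from one norm identity for three-term
  combinations.\<close>

lemma isom_embeds_of_sequence:
  fixes u :: "nat \<Rightarrow> 'a::banach"
  assumes u: "\<And>n c. c \<in> supported n \<Longrightarrow> norm (\<Sum>i<n. c i *\<^sub>R u i) = nrm S (comb c)"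
  shows "isom_embeds S TYPE('a)"
proof -
  \<comment> \<open>Three terms suffice: additivity and homogeneity each say that such a combination
    vanishes.\<close>
  define C where "C a b c t s r = addv S (addv S (smul S t a) (smul S s b)) (smul S r c)" for a b c t s r
  have C_mem: "C a b c t s r \<in> carr S" if "a \<in> carr S" "b \<in> carr S" "c \<in> carr S" for a b c t s r
    using that by (simp add: C_def addv_mem smul_mem)
  have iso: "norm (t *\<^sub>R u i + s *\<^sub>R u j + r *\<^sub>R u l) = nrm S (C (x i) (x j) (x l) t s r)" for t s r i j l
  proof -
    define n where "n = Suc (max i (max j l))"
    have lt: "i < n" "j < n" "l < n" by (auto simp: n_def)
    define c where "c = t *\<^sub>R unit i + s *\<^sub>R unit j + r *\<^sub>R unit l"
    have us: "(\<Sum>m<n. unit i m *\<^sub>R u m) = u i" if "i < n" for i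
      using that by (simp add: unit_def if_distrib[of "\<lambda>x. x *\<^sub>R _"] cong: if_cong)
    have "(\<Sum>m<n. c m *\<^sub>R u m) = t *\<^sub>R (\<Sum>m<n. unit i m *\<^sub>R u m) + s *\<^sub>R (\<Sum>m<n. unit j m *\<^sub>R u m) + r *\<^sub>R (\<Sum>m<n. unit l m *\<^sub>R u m)"
      by (simp add: c_def scaleR_add_left sum.distrib scaleR_right.sum)
    then have 1: "(\<Sum>m<n. c m *\<^sub>R u m) = t *\<^sub>R u i + s *\<^sub>R u j + r *\<^sub>R u l" by (simp add: us lt)
    have "c \<in> supported n" unfolding c_def
      by (intro subspace_add[OF subspace_supported] subspace_scale[OF subspace_supported] unit_supported lt)
    moreover have "comb c = C (x i) (x j) (x l) t s r"
      unfolding c_def C_def by (simp add: comb_add comb_scale unit_fin comb_unit)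
    ultimately show ?thesis using u[of c n] 1 by simp
  qed
  have C_diff: "\<bar>nrm S (C a b c t s r) - nrm S (C a' b' c' t s r)\<bar>
      \<le> \<bar>t\<bar> * nrm S (minusv S a a') + \<bar>s\<bar> * nrm S (minusv S b b') + \<bar>r\<bar> * nrm S (minusv S c c')"
    if m: "a \<in> carr S" "b \<in> carr S" "c \<in> carr S" "a' \<in> carr S" "b' \<in> carr S" "c' \<in> carr S" for a b c a' b' c' t s r
  proof -
    have eq: "minusv S (C a b c t s r) (C a' b' c' t s r) = C (minusv S a a') (minusv S b b') (minusv S c c') t s r"
      using m by (simp add: C_def minusv_addv minusv_smul addv_mem smul_mem)
    have tri: "nrm S (C a b c t s r) \<le> \<bar>t\<bar> * nrm S a + \<bar>s\<bar> * nrm S b + \<bar>r\<bar> * nrm S c"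
      if "a \<in> carr S" "b \<in> carr S" "c \<in> carr S" for a b c
      using nrm_addv[of "addv S (smul S t a) (smul S s b)" "smul S r c"] nrm_addv[of "smul S t a" "smul S s b"] that
      by (simp add: C_def nrm_smul addv_mem smul_mem)
    have "\<bar>nrm S (C a b c t s r) - nrm S (C a' b' c' t s r)\<bar> \<le> nrm S (minusv S (C a b c t s r) (C a' b' c' t s r))"
      by (rule nrm_diff_le) (simp_all add: C_mem m)
    also have "\<dots> \<le> \<bar>t\<bar> * nrm S (minusv S a a') + \<bar>s\<bar> * nrm S (minusv S b b') + \<bar>r\<bar> * nrm S (minusv S c c')"
      unfolding eq by (rule tri) (simp_all add: minusv_mem m)
    finally show ?thesis .
  qed
  \<comment> \<open>The image is described by simultaneous approximation in source and target rather
    than through a chosen sequence, so that \<open>key\<close> can approximate three points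
    independently.\<close>
  have "\<exists>z. \<forall>e>0. \<exists>i. nrm S (minusv S y (x i)) < e \<and> norm (z - u i) < e" if y: "y \<in> carr S" for y
  proof -
    have "\<forall>k. \<exists>i. nrm S (minusv S y (x i)) < inverse (Suc k)" using x_dense[OF y] by simp
    then obtain s where s: "\<And>k. nrm S (minusv S y (x (s k))) < inverse (Suc k)"
      using choice[of "\<lambda>k i. nrm S (minusv S y (x i)) < inverse (Suc k)"] by blast
    have d: "norm (u (s k) - u (s m)) < inverse (Suc k) + inverse (Suc m)" for k m
    proof -
      have "C y y y 1 (-1) 0 = zer S" using y by (simp add: C_def smul_one smul_0 addv_inverse addv_zer zer_mem)
      then have "nrm S (C y y y 1 (-1) 0) = 0" using nrm_eq_0[OF zer_mem] by simp
      then show ?thesis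
        using iso[of 1 "s k" "-1" "s m" 0 "s k"] C_diff[of y y y "x (s k)" "x (s m)" "x (s k)" 1 "-1" 0] s[of k] s[of m] y x_mem
        by simp
    qed
    have small: "\<exists>K. \<forall>k\<ge>K. inverse (real (Suc k)) < e" if "e > 0" for e :: real
      using LIMSEQ_inverse_real_of_nat order_tendstoD(2)[of _ 0 sequentially e] that
      by (auto simp: eventually_sequentially)
    have "Cauchy (\<lambda>k. u (s k))"
    proof (rule CauchyI)
      fix e :: real assume "0 < e"
      then obtain K where K: "\<forall>k\<ge>K. inverse (real (Suc k)) < e / 2" using small[of "e / 2"] by auto
      have "norm (u (s m) - u (s n)) < e" if "m \<ge> K" "n \<ge> K" for m n
        using d[of m n] K[rule_format, OF that(1)] K[rule_format, OF that(2)] by linarith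
      then show "\<exists>M. \<forall>m\<ge>M. \<forall>n\<ge>M. norm (u (s m) - u (s n)) < e" by blast
    qed
    then obtain z where z: "(\<lambda>k. u (s k)) \<longlonglongrightarrow> z" using Cauchy_convergent by (auto simp: convergent_def)
    have "\<exists>i. nrm S (minusv S y (x i)) < e \<and> norm (z - u i) < e" if e: "e > 0" for e
    proof -
      obtain K where K: "\<forall>k\<ge>K. inverse (real (Suc k)) < e" using small[OF e] by blast
      obtain L where L: "\<forall>k\<ge>L. norm (u (s k) - z) < e" using LIMSEQ_D[OF z e] by blast
      have "nrm S (minusv S y (x (s (max K L)))) < e" using s[of "max K L"] K[rule_format, of "max K L"] by simp
      moreover have "norm (z - u (s (max K L))) < e" using L[rule_format, of "max K L"] by (simp add: norm_minus_commute)
      ultimately show ?thesis by blast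
    qed
    then show ?thesis by blast
  qed
  then have "\<forall>y. \<exists>z. y \<in> carr S \<longrightarrow> (\<forall>e>0. \<exists>i. nrm S (minusv S y (x i)) < e \<and> norm (z - u i) < e)" by blast
  from choice[OF this] obtain T where T: "\<And>y e. y \<in> carr S \<Longrightarrow> e > 0 \<Longrightarrow> \<exists>i. nrm S (minusv S y (x i)) < e \<and> norm (T y - u i) < e"
    by blast
  have key: "norm (t *\<^sub>R T a + s *\<^sub>R T b + r *\<^sub>R T c) = nrm S (C a b c t s r)"
    if m: "a \<in> carr S" "b \<in> carr S" "c \<in> carr S" for a b c t s r
  proof -
    define B where "B = \<bar>t\<bar> + \<bar>s\<bar> + \<bar>r\<bar>"
    have "\<bar>norm (t *\<^sub>R T a + s *\<^sub>R T b + r *\<^sub>R T c) - nrm S (C a b c t s r)\<bar> \<le> 0 + \<epsilon>" if \<epsilon>: "\<epsilon> > 0" for \<epsilon>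
    proof -
      \<comment> \<open>Two errors of at most \<open>B * e\<close> arise; the summand 1 keeps the
        quotient defined when all coefficients vanish.\<close>
      define e where "e = \<epsilon> / (2 * B + 1)"
      have B0: "B \<ge> 0" by (simp add: B_def)
      have e: "e > 0" using \<epsilon> B0 by (simp add: e_def)
      obtain i j l where ijl: "nrm S (minusv S a (x i)) < e" "norm (T a - u i) < e"
          "nrm S (minusv S b (x j)) < e" "norm (T b - u j) < e" "nrm S (minusv S c (x l)) < e" "norm (T c - u l) < e"
        using T[OF m(1) e] T[OF m(2) e] T[OF m(3) e] by blast
      have mono: "\<bar>t\<bar> * q1 + \<bar>s\<bar> * q2 + \<bar>r\<bar> * q3 \<le> B * e" if "q1 < e" "q2 < e" "q3 < e" for q1 q2 q3
        using mult_left_mono[of q1 e "\<bar>t\<bar>"] mult_left_mono[of q2 e "\<bar>s\<bar>"] mult_left_mono[of q3 e "\<bar>r\<bar>"] that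
        by (simp add: B_def distrib_right)
      have "(t *\<^sub>R T a + s *\<^sub>R T b + r *\<^sub>R T c) - (t *\<^sub>R u i + s *\<^sub>R u j + r *\<^sub>R u l)
          = t *\<^sub>R (T a - u i) + s *\<^sub>R (T b - u j) + r *\<^sub>R (T c - u l)" by (simp add: scaleR_diff_right)
      then have "\<bar>norm (t *\<^sub>R T a + s *\<^sub>R T b + r *\<^sub>R T c) - norm (t *\<^sub>R u i + s *\<^sub>R u j + r *\<^sub>R u l)\<bar>
          \<le> norm (t *\<^sub>R (T a - u i) + s *\<^sub>R (T b - u j) + r *\<^sub>R (T c - u l))"
        using norm_triangle_ineq3[of "t *\<^sub>R T a + s *\<^sub>R T b + r *\<^sub>R T c" "t *\<^sub>R u i + s *\<^sub>R u j + r *\<^sub>R u l"] by simp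
      also have "\<dots> \<le> \<bar>t\<bar> * norm (T a - u i) + \<bar>s\<bar> * norm (T b - u j) + \<bar>r\<bar> * norm (T c - u l)"
        using norm_triangle_ineq[of "t *\<^sub>R (T a - u i) + s *\<^sub>R (T b - u j)" "r *\<^sub>R (T c - u l)"]
          norm_triangle_ineq[of "t *\<^sub>R (T a - u i)" "s *\<^sub>R (T b - u j)"] by simp
      also have "\<dots> \<le> B * e" by (rule mono) (use ijl in auto)
      finally have 1: "\<bar>norm (t *\<^sub>R T a + s *\<^sub>R T b + r *\<^sub>R T c) - nrm S (C (x i) (x j) (x l) t s r)\<bar> \<le> B * e"
        unfolding iso .
      have "\<bar>nrm S (C a b c t s r) - nrm S (C (x i) (x j) (x l) t s r)\<bar> \<le> B * e"
        by (rule order_trans[OF C_diff[OF m x_mem x_mem x_mem] mono]) (use ijl in auto)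
      moreover have "2 * (B * e) \<le> \<epsilon>" using \<epsilon> B0 by (simp add: e_def field_simps)
      ultimately show ?thesis using 1 by linarith
    qed
    from field_le_epsilon[OF this] show ?thesis by simp
  qed
  have "T (addv S a b) = T a + T b" if m: "a \<in> carr S" "b \<in> carr S" for a b
  proof -
    have ab: "addv S a b \<in> carr S" by (rule addv_mem[OF m])
    have "C a b (addv S a b) 1 1 (-1) = zer S" using m ab by (simp add: C_def smul_one addv_inverse)
    then have "norm (T a + T b - T (addv S a b)) = 0"
      using key[OF m ab, of 1 1 "-1"] nrm_eq_0[OF zer_mem] by simp
    then show ?thesis by simp
  qed
  moreover have "T (smul S t a) = t *\<^sub>R T a" if m: "a \<in> carr S" for a t
  proof -
    have ta: "smul S t a \<in> carr S" by (rule smul_mem[OF m])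
    have "C a a (smul S t a) t 0 (-1) = zer S" using m ta by (simp add: C_def smul_0 addv_zer addv_inverse)
    then have "norm (t *\<^sub>R T a - T (smul S t a)) = 0"
      using key[OF m m ta, of t 0 "-1"] nrm_eq_0[OF zer_mem] by simp
    then show ?thesis by simp
  qed
  moreover have "norm (T a) = nrm S a" if m: "a \<in> carr S" for a
    using key[OF m m m, of 1 0 0] m by (simp add: C_def smul_0 smul_one addv_zer)
  ultimately show ?thesis unfolding isom_embeds_def by (intro exI[of _ T]) blast
qed

end

theorem theorem5p4:
  assumes sepX: "\<exists>D :: 'a::banach set. countable D \<and> closure D = UNIV"
    and hyp: "(\<forall>S :: (nat \<Rightarrow> real) nspace.
                 banach_str S \<and> separable_str S \<and> frechet_smooth (dual_space S)
                 \<longrightarrow> isom_embeds S TYPE('a))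
            \<or> (\<forall>S :: (nat \<Rightarrow> real) nspace.
                 banach_str S \<and> separable_str S \<and> reflexive_str S \<and> frechet_smooth S
                 \<longrightarrow> isom_embeds S TYPE('a))"
  shows "\<forall>S :: 'u nspace. banach_str S \<and> separable_str S \<longrightarrow> isom_embeds S TYPE('a)"
proof (intro allI impI, elim conjE)
  fix S :: "'u nspace" assume ban: "banach_str S" and sep: "separable_str S"
  \<comment> \<open>Good spaces are realised on real sequences, the type over which both hypotheses
    quantify, and they meet the requirements of either one.\<close>
  have univ: "isom_embeds (space_of V N) TYPE('a)" if g: "good V N" for V N
    using hyp good_banach_str[OF g] good_separable_str[OF g] good_dual_smooth[OF g] good_reflexive[OF g] good_frechet_smooth[OF g]
    by blast
  obtain D :: "'a set" where D: "countable D" "closure D = UNIV" using sepX by blast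
  have ns: "normed_space_str S" using ban by (simp add: banach_str_def)
  then have z: "zer S \<in> carr S" by (simp add: normed_space_str_def)
  obtain E where E: "countable E" "E \<subseteq> carr S" "\<And>x e. x \<in> carr S \<Longrightarrow> e > 0 \<Longrightarrow> \<exists>d\<in>E. nrm S (minusv S x d) < e"
    using sep unfolding separable_str_def by blast
  \<comment> \<open>The zero vector has to be approximated, so the dense set is inhabited and can be
    enumerated, possibly with repetitions.\<close>
  have ne: "E \<noteq> {}" using E(3)[OF z, of 1] by auto
  interpret dense_sequence S "from_nat_into E"
  proof
    show "from_nat_into E i \<in> carr S" for i using from_nat_into[OF ne] E(2) by blast
    show "\<exists>i. nrm S (minusv S y (from_nat_into E i)) < e" if "y \<in> carr S" "e > 0" for y e
      using E(3)[OF that] from_nat_into_surj[OF E(1)] by metis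
  qed (rule ns)
  obtain u :: "nat \<Rightarrow> 'a" where "\<forall>n. \<forall>c\<in>supported n. norm (\<Sum>i<n. c i *\<^sub>R u i) = nrm S (comb c)"
    using separable_target.realization[OF separable_target D univ] by blast
  then show "isom_embeds S TYPE('a)" by (intro isom_embeds_of_sequence[of u]) blast
qed

end
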